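(* Let $S\in\mathbb{S}^d_m$, $Y\in\mathcal{L}_2(\mathbb{R}^d)$, $\nu:=\mathrm{Law}(Y)$. Let $G\in\mathcal{M}(S)$ be an optimal set for the dual problem (a minimizer of $\int\psi_H\,d\nu$ over $H\in\mathcal{M}(S)$) and assume $\nu(\Sigma_1(P_G))=0$. Then $$X:=\mathbb{E}[Y\mid\sigma(P_G(Y))]$$ is an optimal map (a maximizer of $\frac12\mathbb{E}[S(X',Y)]$ over $X'\in\mathcal{X}(Y)$) and $\mathrm{Law}(X,Y)$ is an optimal plan (a maximizer of $\frac12\int S\,d\gamma$ over $\gamma\in\Gamma(\nu)$). Moreover, if $Z\in\mathcal{L}_2(\mathbb{R}^d)$ and $\mathrm{Law}(Z,Y)$ is an optimal plan (in particular, if $Z$ is an optimal map), then a.s. $Z\in P_G(Z)=P_G(Y)$; furthermore $X$ is $Z$-measurable, $X=\mathbb{E}[Z\mid X]$, and $S(Z-X,Z-X)=0$.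
   Context: $\mathbb{S}^d_m$: symmetric invertible $d\times d$ real matrices with exactly $m$ positive eigenvalues; $S(x,y):=\langle x,Sy\rangle$. A set $G\subset\mathbb{R}^d$ is $S$-monotone if $S(x-y,x-y)\ge0$ for all $x,y\in G$; maximal if not a strict subset of another $S$-monotone set; $\mathcal{M}(S)$ is the family of maximal $S$-monotone sets. $\psi_G(y):=\sup_{x\in G}(S(x,y)-\frac12S(x,x))$, $P_G(y):=\operatorname{argmax}_{x\in G}(S(x,y)-\frac12S(x,x))$. Singular sets: $\Sigma(P_G):=\{y: P_G(y)\neq\emptyset \text{ and is not a single point}\}$, $\Sigma_1(P_G):=\{y\in\Sigma(P_G): S(y_1-y_2,y_1-y_2)>0\text{ for some }y_1,y_2\in P_G(y)\}$. $\sigma(P_G)$ is the $\sigma$-algebra on $\mathbb{R}^d$ generated by the sets $\{y: P_G(y)\cap U\ne\emptyset\}$, $U\subset\mathbb{R}^d$ open, and $\sigma(P_G(Y)):=\{Y^{-1}(A):A\in\sigma(P_G)\}$. Random variables live on $(\Omega,\mathcal{F},\mathbb{P})$, relations hold a.s., $\mathcal{L}_2(\mathbb{R}^d)$ denotes square-integrable $d$-dimensional random variables (the probability space may be enlarged). $\mathcal{X}(Y):=\{X\in\mathcal{L}_2(\mathbb{R}^d): X\ Y\text{-measurable}, \mathbb{E}[Y|X]=X\}$. $\Gamma(\nu)$: Borel probability measures $\gamma$ on $\mathbb{R}^d\times\mathbb{R}^d$ (coordinates $(x,y)$) with finite second moments, second marginal $\nu$, and $\gamma$-conditional expectation of $y$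 given $x$ equal to $x$. *)

theory Defs
  imports "HOL-Probability.Probability"
begin

(* number of positive eigenvalues counted with multiplicity; for a symmetric
   matrix algebraic and geometric multiplicities agree *)
definition num_pos_eig :: "real^'n^'n \<Rightarrow> nat" where
  "num_pos_eig S = (\<Sum>l\<in>{l::real. l > 0 \<and> (\<exists>v. v \<noteq> 0 \<and> S *v v = l *\<^sub>R v)}.
                      dim {v. S *v v = l *\<^sub>R v})"

definition Sdm :: "nat \<Rightarrow> (real^'n^'n) set" where
  "Sdm m = {S. transpose S = S \<and> invertible S \<and> num_pos_eig S = m}"

definition Sform :: "real^'n^'n \<Rightarrow> real^'n \<Rightarrow> real^'n \<Rightarrow> real" where
  "Sform S x y = x \<bullet> (S *v y)"

definition S_monotone :: "real^'n^'n \<Rightarrow> (real^'n) set \<Rightarrow> bool" where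
  "S_monotone S G \<longleftrightarrow> (\<forall>x\<in>G. \<forall>y\<in>G. Sform S (x - y) (x - y) \<ge> 0)"

definition max_S_monotone :: "real^'n^'n \<Rightarrow> (real^'n) set set" where
  "max_S_monotone S = {G. S_monotone S G \<and> \<not> (\<exists>H. G \<subset> H \<and> S_monotone S H)}"

definition psi :: "real^'n^'n \<Rightarrow> (real^'n) set \<Rightarrow> real^'n \<Rightarrow> ereal" where
  "psi S G y = (SUP x\<in>G. ereal (Sform S x y - Sform S x x / 2))"

definition PG :: "real^'n^'n \<Rightarrow> (real^'n) set \<Rightarrow> real^'n \<Rightarrow> (real^'n) set" where
  "PG S G y = {x\<in>G. \<forall>x'\<in>G. Sform S x' y - Sform S x' x' / 2 \<le> Sform S x y - Sform S x x / 2}"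

definition Sigma_sing :: "real^'n^'n \<Rightarrow> (real^'n) set \<Rightarrow> (real^'n) set" where
  "Sigma_sing S G = {y. PG S G y \<noteq> {} \<and> \<not> (\<exists>x. PG S G y = {x})}"

definition Sigma1 :: "real^'n^'n \<Rightarrow> (real^'n) set \<Rightarrow> (real^'n) set" where
  "Sigma1 S G = {y\<in>Sigma_sing S G. \<exists>y1\<in>PG S G y. \<exists>y2\<in>PG S G y. Sform S (y1 - y2) (y1 - y2) > 0}"

definition sigma_PG :: "real^'n^'n \<Rightarrow> (real^'n) set \<Rightarrow> (real^'n) measure" where
  "sigma_PG S G = sigma UNIV {{y. PG S G y \<inter> U \<noteq> {}} | U. open U}"

definition L2 :: "'a measure \<Rightarrow> ('a \<Rightarrow> real^'n) \<Rightarrow> bool" where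
  "L2 M X \<longleftrightarrow> X \<in> borel_measurable M \<and> integrable M (\<lambda>\<omega>. (norm (X \<omega>))\<^sup>2)"

definition vcond_exp :: "'a measure \<Rightarrow> 'a measure \<Rightarrow> ('a \<Rightarrow> real^'n) \<Rightarrow> 'a \<Rightarrow> real^'n" where
  "vcond_exp M F X = (\<lambda>\<omega>. \<chi> i. real_cond_exp M F (\<lambda>\<omega>'. X \<omega>' $ i) \<omega>)"

definition sigma_rv :: "'a measure \<Rightarrow> ('a \<Rightarrow> 'b::topological_space) \<Rightarrow> 'a measure" where
  "sigma_rv M Z = vimage_algebra (space M) Z borel"

(* X is Z-measurable (up to a.s. equality, as all relations hold a.s.) *)
definition rv_measurable_wrt :: "'a measure \<Rightarrow> ('a \<Rightarrow> real^'n) \<Rightarrow> ('a \<Rightarrow> real^'k) \<Rightarrow> bool" where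
  "rv_measurable_wrt M X Z \<longleftrightarrow>
     (\<exists>X'. X' \<in> borel_measurable (sigma_rv M Z) \<and> (AE \<omega> in M. X \<omega> = X' \<omega>))"

definition law :: "'a measure \<Rightarrow> ('a \<Rightarrow> 'b::topological_space) \<Rightarrow> 'b measure" where
  "law M Z = distr M borel Z"

definition Xset :: "'a measure \<Rightarrow> ('a \<Rightarrow> real^'n) \<Rightarrow> ('a \<Rightarrow> real^'n) set" where
  "Xset M Y = {X. L2 M X \<and> rv_measurable_wrt M X Y \<and>
                  (AE \<omega> in M. vcond_exp M (sigma_rv M X) Y \<omega> = X \<omega>)}"

definition optimal_map :: "'a measure \<Rightarrow> real^'n^'n \<Rightarrow> ('a \<Rightarrow> real^'n) \<Rightarrow> ('a \<Rightarrow> real^'n) \<Rightarrow> bool" where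
  "optimal_map M S Y X \<longleftrightarrow> X \<in> Xset M Y \<and>
     (\<forall>X'\<in>Xset M Y. (\<integral>\<omega>. Sform S (X' \<omega>) (Y \<omega>) / 2 \<partial>M) \<le> (\<integral>\<omega>. Sform S (X \<omega>) (Y \<omega>) / 2 \<partial>M))"

definition Gamma :: "(real^'n) measure \<Rightarrow> ((real^'n) \<times> (real^'n)) measure set" where
  "Gamma \<nu> = {\<gamma>. sets \<gamma> = sets borel \<and> prob_space \<gamma> \<and>
      integrable \<gamma> (\<lambda>p. (norm (fst p))\<^sup>2) \<and> integrable \<gamma> (\<lambda>p. (norm (snd p))\<^sup>2) \<and>
      distr \<gamma> borel snd = \<nu> \<and>
      (AE p in \<gamma>. vcond_exp \<gamma> (sigma_rv \<gamma> fst) snd p = fst p)}"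

definition optimal_plan :: "real^'n^'n \<Rightarrow> (real^'n) measure \<Rightarrow> ((real^'n) \<times> (real^'n)) measure \<Rightarrow> bool" where
  "optimal_plan S \<nu> \<gamma> \<longleftrightarrow> \<gamma> \<in> Gamma \<nu> \<and>
     (\<forall>\<gamma>'\<in>Gamma \<nu>. (\<integral>p. Sform S (fst p) (snd p) / 2 \<partial>\<gamma>') \<le> (\<integral>p. Sform S (fst p) (snd p) / 2 \<partial>\<gamma>))"

(* \<integral> \<psi>_H d\<nu>; \<psi>_H is bounded below by an affine (hence \<nu>-integrable) function,
   so the integral is a well-defined value in (-\<infinity>,+\<infinity>], equal to +\<infinity> unless
   \<psi>_H is a.e. finite and integrable *)
definition dual_obj :: "real^'n^'n \<Rightarrow> (real^'n) measure \<Rightarrow> (real^'n) set \<Rightarrow> ereal" where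
  "dual_obj S \<nu> H =
     (if (AE y in \<nu>. psi S H y \<noteq> \<infinity>) \<and> integrable \<nu> (\<lambda>y. real_of_ereal (psi S H y))
      then ereal (\<integral>y. real_of_ereal (psi S H y) \<partial>\<nu>) else \<infinity>)"

definition optimal_dual :: "real^'n^'n \<Rightarrow> (real^'n) measure \<Rightarrow> (real^'n) set \<Rightarrow> bool" where
  "optimal_dual S \<nu> G \<longleftrightarrow> G \<in> max_S_monotone S \<and>
     (\<forall>H\<in>max_S_monotone S. dual_obj S \<nu> G \<le> dual_obj S \<nu> H)"

end

theory Submission
  imports Defs
begin

text \<open>Write q x = S(x,x)/2. A minimal convex function above q touches q exactly on a maximal
  monotone set (if it stays strictly above q at z, minimising its gap to the support line of z plus
  an adapted positive definite form finds a contact point that is not monotonically related to z).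
  Hence an optimal G also minimises the expectation of phi(Y) over all convex phi above q, and a
  minimax argument yields finite martingale decompositions of Y whose barycentres nearly attain the
  dual value. Such barycentres are close in probability to points of P(Y), and because pairs in
  P(Y) are isotropic off the null set Sigma1, events in sigma(P) are almost determined by the label
  of the decomposition. Averaging over labels, the conditional mean X of Y given sigma(P(Y)) cannot
  leave the closed convex set P(Y); this gives equality in weak duality. For an arbitrary optimal Z,
  equality in weak duality forces Z into G and P(Z) = P(Y), and the remaining claims follow because
  sets in sigma(P) do not separate points with equal P.\<close>

subsection \<open>Convex functions and a minimax inequality\<close>

text \<open>One identity drives every use of a decomposition. Let label i have mass m_i and
  barycentre x_i, and let u_i be points of G. The gaps psi(Y) - h u_i Y, weighted by label and
  integrated, sum to (D - sum of m_i q(x_i)) + (sum of m_i q(x_i - u_i)), because h is affine in its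
  second argument and h u x = q x - q (x - u). Near optimality makes the first bracket small. If q
  (x_i - u_i) is clearly negative for some labels, those labels must be rare, so barycentres far
  from G are rare. If q (x_i - u_i) is small, then u_i nearly maximises at Y, even when x_i and u_i
  are far apart. This is how the obstacle is met that a label does not single out one point of P(Y):
  whether P(Y) meets a compact K is read off from whether q (x_i - z) is small for some z in K and
  G. The converse reading needs Sigma1 to be null, since otherwise Y could have two maximisers a, b
  with q (a - b) > 0, only one of them near x_i. Compactness of K turns near maximisers into exact
  ones outside an event of small probability.\<close>

lemma convex_linear_growth:
  fixes \<phi> :: "'v::euclidean_space \<Rightarrow> real"
  assumes "convex_on UNIV \<phi>"
  obtains K where "\<And>y. \<phi> y \<ge> - K * (1 + norm y)"
proof -
  have cont: "continuous_on UNIV \<phi>" using assms by (simp add: convex_on_continuous)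
  have "compact (\<phi> ` sphere 0 1)"
    by (intro compact_continuous_image continuous_on_subset[OF cont]) auto
  then have "bounded (\<phi> ` sphere 0 1)" by (rule compact_imp_bounded)
  then obtain M0 where "\<forall>y\<in>\<phi> ` sphere 0 1. norm y \<le> M0" by (auto simp: bounded_iff)
  then have M0: "norm x = 1 \<Longrightarrow> \<phi> x \<le> M0" for x by force
  define M where "M = max 0 M0"
  have M: "norm x = 1 \<Longrightarrow> \<phi> x \<le> M" for x using M0[of x] by (simp add: M_def)
  have M_nonneg: "0 \<le> M" by (simp add: M_def)
  have "\<phi> y \<ge> - (\<bar>\<phi> 0\<bar> + M) * (1 + norm y)" for y
  proof (cases "y = 0")
    case True
    then show ?thesis using M_nonneg by simp
  next
    case False
    define a where "a = norm y"
    have a: "a > 0" using False by (simp add: a_def)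
    \<comment> \<open>The origin lies on the segment from \<open>y\<close> to the opposite unit
      vector \<open>?u\<close>, where \<open>\<phi>\<close> is at most \<open>M\<close>. Convexity
      at 0 therefore bounds \<open>\<phi> y\<close> from below, with a loss linear in the norm of
      \<open>y\<close>.\<close>
    let ?u = "- (1 / a) *\<^sub>R y"
    have "(1 - 1 / (1 + a)) *\<^sub>R ?u + (1 / (1 + a)) *\<^sub>R y = ((1 / (1 + a)) - (1 - 1 / (1 + a)) / a) *\<^sub>R y"
      by (simp add: scaleR_diff_left)
    also have "(1 / (1 + a)) - (1 - 1 / (1 + a)) / a = 0"
    proof -
      have "1 - 1 / (1 + a) = a / (1 + a)" using a by (simp add: field_simps)
      then show ?thesis using a by simp
    qed
    finally have e: "(1 - 1 / (1 + a)) *\<^sub>R ?u + (1 / (1 + a)) *\<^sub>R y = 0" by simp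
    have "\<phi> 0 \<le> (1 - 1 / (1 + a)) * \<phi> ?u + (1 / (1 + a)) * \<phi> y"
      using convex_onD[OF assms, of "1 / (1 + a)" ?u y] a unfolding e by simp
    also have "\<phi> ?u \<le> M" using a by (intro M) (simp add: a_def[symmetric])
    finally have "\<phi> 0 \<le> (1 - 1 / (1 + a)) * M + (1 / (1 + a)) * \<phi> y"
      using a by (simp add: mult_left_mono)
    then have "(1 + a) * \<phi> 0 \<le> (1 + a) * ((1 - 1 / (1 + a)) * M + (1 / (1 + a)) * \<phi> y)"
      using a by (intro mult_left_mono) auto
    also have "\<dots> = ((1 + a) * (1 - 1 / (1 + a))) * M + ((1 + a) * (1 / (1 + a))) * \<phi> y"
      by (simp only: distrib_left mult.assoc)
    also have "(1 + a) * (1 - 1 / (1 + a)) = a" using a by (simp add: field_simps)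
    also have "(1 + a) * (1 / (1 + a)) = 1" using a by simp
    finally have 1: "\<phi> y \<ge> (1 + a) * \<phi> 0 - a * M" by simp
    have "(1 + a) * (- \<phi> 0) \<le> (1 + a) * \<bar>\<phi> 0\<bar>"
      using a by (intro mult_left_mono) auto
    moreover have "a * M \<le> (1 + a) * M" using M_nonneg by (simp add: algebra_simps)
    ultimately show ?thesis using 1 by (simp add: a_def algebra_simps)
  qed
  then show thesis by (rule that[of "\<bar>\<phi> 0\<bar> + M"])
qed

lemma convex_on_Max_affine:
  fixes c :: "nat \<Rightarrow> real" and k :: "nat \<Rightarrow> 'v::real_inner"
  assumes "0 < N"
  shows "convex_on UNIV (\<lambda>y. Max ((\<lambda>i. c i + k i \<bullet> y) ` {..<N}))"
proof (intro convex_onI)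
  fix t :: real and x y :: 'v
  assume t: "0 < t" "t < 1"
  let ?F = "\<lambda>y. Max ((\<lambda>i. c i + k i \<bullet> y) ` {..<N})"
  have le: "c i + k i \<bullet> y \<le> ?F y" if "i < N" for i y using that by (intro Max_ge) auto
  have "c i + k i \<bullet> ((1 - t) *\<^sub>R x + t *\<^sub>R y) \<le> (1 - t) * ?F x + t * ?F y" if "i < N" for i
  proof -
    have "c i + k i \<bullet> ((1 - t) *\<^sub>R x + t *\<^sub>R y) = (1 - t) * (c i + k i \<bullet> x) + t * (c i + k i \<bullet> y)"
      by (simp add: inner_add_right algebra_simps)
    also have "\<dots> \<le> (1 - t) * ?F x + t * ?F y"
      using t le[OF that] by (intro add_mono mult_left_mono) auto
    finally show ?thesis .
  qed
  then show "?F ((1 - t) *\<^sub>R x + t *\<^sub>R y) \<le> (1 - t) * ?F x + t * ?F y"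
    using assms by (intro Max.boundedI) auto
qed auto

lemma convex_on_sup:
  fixes f g :: "'v::real_vector \<Rightarrow> real"
  assumes "convex_on UNIV f" "convex_on UNIV g"
  shows "convex_on UNIV (\<lambda>x. max (f x) (g x))"
proof (intro convex_onI)
  fix t :: real and x y :: 'v
  assume t: "0 < t" "t < 1"
  let ?F = "\<lambda>x. max (f x) (g x)"
  have "f ((1 - t) *\<^sub>R x + t *\<^sub>R y) \<le> (1 - t) * f x + t * f y"
    "g ((1 - t) *\<^sub>R x + t *\<^sub>R y) \<le> (1 - t) * g x + t * g y"
    using convex_onD[OF assms(1)] convex_onD[OF assms(2)] t by auto
  moreover have "(1 - t) * f x + t * f y \<le> (1 - t) * ?F x + t * ?F y"
    "(1 - t) * g x + t * g y \<le> (1 - t) * ?F x + t * ?F y"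
    using t by (intro add_mono mult_left_mono; simp)+
  ultimately show "?F ((1 - t) *\<^sub>R x + t *\<^sub>R y) \<le> (1 - t) * ?F x + t * ?F y" by simp
qed auto

lemma convex_on_norm_sq: "convex_on UNIV (\<lambda>x :: 'v::real_inner. (norm x)\<^sup>2)"
proof (intro convex_onI)
  fix t :: real and x y :: 'v
  assume t: "0 < t" "t < 1"
  have "(1 - t) * (norm x)\<^sup>2 + t * (norm y)\<^sup>2 - (norm ((1 - t) *\<^sub>R x + t *\<^sub>R y))\<^sup>2
      = t * (1 - t) * (norm (x - y))\<^sup>2"
    unfolding power2_norm_eq_inner
    by (simp add: inner_add_left inner_add_right inner_diff_left inner_diff_right inner_commute[of y x] algebra_simps)
  moreover have "0 \<le> t * (1 - t) * (norm (x - y))\<^sup>2" using t by simp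
  ultimately show "(norm ((1 - t) *\<^sub>R x + t *\<^sub>R y))\<^sup>2 \<le> (1 - t) * (norm x)\<^sup>2 + t * (norm y)\<^sup>2" by linarith
qed auto

text \<open>A finite net from compactness of the ball. The origin is put in front so that a maximum
  of affine functions indexed by the net has one member, at index 0, with explicit linear lower
  bound.\<close>

lemma finite_net:
  assumes "0 < \<eta>" "0 \<le> R"
  obtains N and x :: "nat \<Rightarrow> 'v::euclidean_space" where "0 < N" "x 0 = 0" "\<And>i. i < N \<Longrightarrow> norm (x i) \<le> R"
    "\<And>z. norm z \<le> R \<Longrightarrow> \<exists>i<N. norm (z - x i) < \<eta>"
proof -
  have "compact (cball 0 R :: 'v set)" by simp
  then obtain k :: "'v set" where k: "k \<subseteq> cball 0 R" "finite k" "cball 0 R \<subseteq> (\<Union>x\<in>k. ball x \<eta>)"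
    by (rule compactE_image[of _ "cball 0 R" "\<lambda>x. ball x \<eta>"]) (use assms in auto)
  obtain xs where xs: "set xs = k" using finite_list[OF k(2)] by blast
  show thesis
  proof
    show "0 < length (0 # xs)" "(0 # xs) ! 0 = 0" by auto
    show "norm ((0 # xs) ! i) \<le> R" if "i < length (0 # xs)" for i
    proof -
      have "(0 # xs) ! i \<in> set (0 # xs)" using that by (rule nth_mem)
      then show ?thesis using xs k(1) assms(2) by auto
    qed
    show "\<exists>i<length (0 # xs). norm (z - (0 # xs) ! i) < \<eta>" if "norm z \<le> R" for z
    proof -
      have "z \<in> cball 0 R" using that by simp
      then obtain v where "v \<in> set xs" "norm (z - v) < \<eta>"
        using k(3) xs by (auto simp: dist_norm norm_minus_commute)
      then obtain j where "j < length xs" "norm (z - xs ! j) < \<eta>" by (auto simp: in_set_conv_nth)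
      then show ?thesis by (intro exI[of _ "Suc j"]) simp
    qed
  qed
qed

text \<open>The norms are replaced by smooth majorants; at a near minimiser the response to the gradient
  gives the bound along the segment joining the two, so no minimax theorem is needed.\<close>

lemma approximate_minimax:
  fixes g :: "'w \<Rightarrow> nat \<Rightarrow> 'v::real_inner" and a :: "'w \<Rightarrow> real"
  assumes ne: "W \<noteq> {}"
    and conv: "\<And>w w' t. w \<in> W \<Longrightarrow> w' \<in> W \<Longrightarrow> 0 < t \<Longrightarrow> t < 1 \<Longrightarrow>
      \<exists>w''\<in>W. a w'' = (1 - t) * a w + t * a w' \<and> (\<forall>i<N. g w'' i = (1 - t) *\<^sub>R g w i + t *\<^sub>R g w' i)"
    and bd: "\<And>w. w \<in> W \<Longrightarrow> a w \<le> K" "\<And>w i. w \<in> W \<Longrightarrow> i < N \<Longrightarrow> norm (g w i) \<le> K"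
    and L: "\<And>i. i < N \<Longrightarrow> 0 \<le> L i"
    and resp: "\<And>k. (\<forall>i<N. norm (k i) \<le> L i) \<Longrightarrow> \<exists>w\<in>W. D \<le> a w + (\<Sum>i<N. k i \<bullet> g w i)"
    and \<epsilon>: "0 < \<epsilon>"
  shows "\<exists>w\<in>W. D - \<epsilon> \<le> a w - (\<Sum>i<N. L i * norm (g w i))"
proof -
  define SL where "SL = (\<Sum>i<N. L i)"
  have SL: "SL \<ge> 0" unfolding SL_def by (intro sum_nonneg) (auto intro: L)
  \<comment> \<open>Smoothing raises each norm by at most \<open>\<tau>\<close>, hence the weighted
    sum by at most \<open>SL * \<tau>\<close>, half of the allowed error.\<close>
  define \<tau> where "\<tau> = \<epsilon> / (2 * (SL + 1))"
  have \<tau>: "\<tau> > 0" using \<epsilon> SL by (simp add: \<tau>_def)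
  define s where "s v = sqrt (\<tau>\<^sup>2 + (norm v)\<^sup>2)" for v :: 'v
  have s_ge: "s v \<ge> \<tau>" "s v \<ge> norm v" "s v > 0" for v
  proof -
    show 1: "s v \<ge> \<tau>" unfolding s_def using \<tau> by (intro real_le_rsqrt) simp
    show "s v \<ge> norm v" unfolding s_def by (intro real_le_rsqrt) simp
    show "s v > 0" using 1 \<tau> by linarith
  qed
  have s_sq: "(s v)\<^sup>2 = \<tau>\<^sup>2 + (norm v)\<^sup>2" for v by (simp add: s_def)
  \<comment> \<open>A second-order upper bound for the smoothed norm: its gradient at
    \<open>v\<close> is \<open>v / s v\<close> and its curvature is at most
    \<open>1 / \<tau>\<close>.\<close>
  have s_step: "s (v + t *\<^sub>R d) \<le> s v + t * (v \<bullet> d) / s v + t\<^sup>2 * (norm d)\<^sup>2 / (2 * \<tau>)" for v d t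
  proof -
    define b where "b = 2 * t * (v \<bullet> d) + t\<^sup>2 * (norm d)\<^sup>2"
    have "(norm (v + t *\<^sub>R d))\<^sup>2 = (norm v)\<^sup>2 + b"
      unfolding b_def power2_norm_eq_inner
      by (simp add: inner_add_left inner_add_right inner_commute[of d v] power2_eq_square algebra_simps)
    then have e: "s (v + t *\<^sub>R d) = sqrt ((s v)\<^sup>2 + b)" by (simp add: s_def)
    have "(s v)\<^sup>2 + b \<le> (s v + b / (2 * s v))\<^sup>2"
      using s_ge(3)[of v] by (simp add: power2_sum power_divide)
    moreover have "s v + b / (2 * s v) \<ge> 0"
    proof -
      have "2 * (s v)\<^sup>2 + b \<ge> (s v)\<^sup>2 + (\<tau>\<^sup>2 + (norm v)\<^sup>2 + b)" using s_sq[of v] by simp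
      moreover have "(norm v)\<^sup>2 + b \<ge> 0"
        using \<open>(norm (v + t *\<^sub>R d))\<^sup>2 = (norm v)\<^sup>2 + b\<close> by (metis zero_le_power2)
      ultimately have "2 * (s v)\<^sup>2 + b \<ge> 0"
        by (smt (verit) zero_le_power2)
      then show ?thesis using s_ge(3)[of v] by (simp add: field_simps power2_eq_square)
    qed
    ultimately have "s (v + t *\<^sub>R d) \<le> s v + b / (2 * s v)"
      unfolding e by (intro real_le_lsqrt) auto
    also have "b / (2 * s v) = t * (v \<bullet> d) / s v + t\<^sup>2 * (norm d)\<^sup>2 / (2 * s v)"
      by (simp add: b_def add_divide_distrib)
    also have "t\<^sup>2 * (norm d)\<^sup>2 / (2 * s v) \<le> t\<^sup>2 * (norm d)\<^sup>2 / (2 * \<tau>)"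
      using s_ge(1)[of v] \<tau> by (intro divide_left_mono) (auto intro!: mult_pos_pos s_ge)
    finally show ?thesis by simp
  qed
  define J where "J w = - a w + (\<Sum>i<N. L i * s (g w i))" for w
  have bdd: "bdd_below (J ` W)"
  proof (intro bdd_belowI2)
    show "- K \<le> J w" if "w \<in> W" for w
    proof -
      have "0 \<le> (\<Sum>i<N. L i * s (g w i))"
        by (intro sum_nonneg mult_nonneg_nonneg) (auto intro: L less_imp_le[OF s_ge(3)])
      then show ?thesis using bd(1)[OF that] by (simp add: J_def)
    qed
  qed
  define Bd where "Bd = (\<Sum>i<N. L i * ((2 * K)\<^sup>2 / (2 * \<tau>)))"
  have Bd: "Bd \<ge> 0" unfolding Bd_def using \<tau> by (intro sum_nonneg mult_nonneg_nonneg divide_nonneg_pos) (auto intro: L)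
  \<comment> \<open>Near minimality up to \<open>t\<^sup>2\<close> and the curvature term
    \<open>t\<^sup>2 * Bd\<close> leave, after division by \<open>t\<close>, an error
    \<open>t * (1 + Bd)\<close>; this length makes it at most half of
    \<open>\<epsilon>\<close>.\<close>
  define t where "t = min (1/2) (\<epsilon> / (2 * (1 + Bd)))"
  have t: "0 < t" "t < 1" "t * (1 + Bd) \<le> \<epsilon> / 2"
  proof -
    show "0 < t" "t < 1" using \<epsilon> Bd by (auto simp: t_def)
    have "t * (1 + Bd) \<le> \<epsilon> / (2 * (1 + Bd)) * (1 + Bd)" using Bd by (intro mult_right_mono) (auto simp: t_def)
    also have "\<dots> = \<epsilon> / 2" using Bd by (simp add: field_simps)
    finally show "t * (1 + Bd) \<le> \<epsilon> / 2" .
  qed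
  have "\<exists>w\<in>W. J w < Inf (J ` W) + t\<^sup>2"
    using cINF_less_iff[OF ne bdd, of "Inf (J ` W) + t\<^sup>2"] t by auto
  then obtain w where w: "w \<in> W" "J w < Inf (J ` W) + t\<^sup>2" by blast
  \<comment> \<open>Minus the gradient of the penalty in the i-th coordinate. Its norm is below
    \<open>L i\<close> because \<open>s\<close> dominates the norm, so it is an admissible argument
    of \<open>resp\<close>.\<close>
  define k where "k i = (- (L i / s (g w i))) *\<^sub>R g w i" for i
  have "norm (k i) \<le> L i" if "i < N" for i
  proof -
    have "norm (g w i) / s (g w i) \<le> 1" using s_ge(2,3)[of "g w i"] by simp
    then have "L i * (norm (g w i) / s (g w i)) \<le> L i * 1" using L[OF that] by (intro mult_left_mono)
    then show ?thesis using L[OF that] s_ge(3)[of "g w i"] by (simp add: k_def)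
  qed
  then obtain w' where w': "w' \<in> W" "D \<le> a w' + (\<Sum>i<N. k i \<bullet> g w' i)" using resp by blast
  obtain w'' where w'': "w'' \<in> W" "a w'' = (1 - t) * a w + t * a w'"
    "\<And>i. i < N \<Longrightarrow> g w'' i = (1 - t) *\<^sub>R g w i + t *\<^sub>R g w' i"
    using conv[OF w(1) w'(1) t(1,2)] by blast
  have "J w - t\<^sup>2 \<le> J w''"
    using w(2) cINF_lower[OF bdd w''(1)] by simp
  also have "J w'' \<le> - a w'' + (\<Sum>i<N. L i * s (g w i) - t * (k i \<bullet> (g w' i - g w i)) + t\<^sup>2 * (L i * ((2 * K)\<^sup>2 / (2 * \<tau>))))"
    unfolding J_def
  proof (intro add_left_mono sum_mono)
    fix i assume "i \<in> {..<N}"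
    then have i: "i < N" by simp
    define d where "d = g w' i - g w i"
    have d: "norm d \<le> 2 * K"
      using norm_triangle_ineq4[of "g w' i" "g w i"] bd(2)[OF w(1) i] bd(2)[OF w'(1) i] by (simp add: d_def)
    have "g w'' i = g w i + t *\<^sub>R d" by (simp add: w''(3)[OF i] d_def algebra_simps)
    then have "s (g w'' i) \<le> s (g w i) + t * (g w i \<bullet> d) / s (g w i) + t\<^sup>2 * (norm d)\<^sup>2 / (2 * \<tau>)"
      using s_step by simp
    also have "t\<^sup>2 * (norm d)\<^sup>2 / (2 * \<tau>) \<le> t\<^sup>2 * (2 * K)\<^sup>2 / (2 * \<tau>)"
      using d \<tau> by (intro divide_right_mono mult_left_mono power_mono) auto
    finally have "L i * s (g w'' i) \<le> L i * (s (g w i) + t * (g w i \<bullet> d) / s (g w i) + t\<^sup>2 * (2 * K)\<^sup>2 / (2 * \<tau>))"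
      using L[OF i] by (simp add: mult_left_mono)
    also have "\<dots> = L i * s (g w i) - t * (k i \<bullet> d) + t\<^sup>2 * (L i * ((2 * K)\<^sup>2 / (2 * \<tau>)))"
      by (simp add: k_def algebra_simps)
    finally show "L i * s (g w'' i) \<le> L i * s (g w i) - t * (k i \<bullet> (g w' i - g w i)) + t\<^sup>2 * (L i * ((2 * K)\<^sup>2 / (2 * \<tau>)))"
      by (simp add: d_def)
  qed
  also have "\<dots> = J w - t * (a w' - a w) - t * (\<Sum>i<N. k i \<bullet> (g w' i - g w i)) + t\<^sup>2 * Bd"
  proof -
    have "(\<Sum>i<N. t\<^sup>2 * (L i * ((2 * K)\<^sup>2 / (2 * \<tau>)))) = t\<^sup>2 * Bd"
      unfolding Bd_def by (rule sum_distrib_left[symmetric])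
    moreover have "(\<Sum>i<N. t * (k i \<bullet> (g w' i - g w i))) = t * (\<Sum>i<N. k i \<bullet> (g w' i - g w i))"
      by (rule sum_distrib_left[symmetric])
    ultimately show ?thesis
      by (simp only: sum.distrib sum_subtractf J_def w''(2)) (simp add: algebra_simps)
  qed
  finally have "t * ((a w' - a w) + (\<Sum>i<N. k i \<bullet> (g w' i - g w i))) \<le> t * (t * (1 + Bd))"
    by (simp add: algebra_simps power2_eq_square)
  then have "(a w' - a w) + (\<Sum>i<N. k i \<bullet> (g w' i - g w i)) \<le> t * (1 + Bd)"
    using t(1) by (simp only: mult_le_cancel_left_pos)
  \<comment> \<open>The first-order condition carries the response bound from \<open>w'\<close> back
    to \<open>w\<close>. It remains to see that pairing \<open>k i\<close> with \<open>g w i\<close>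
    itself gives the negative penalty up to \<open>L i * \<tau>\<close>.\<close>
  then have 1: "D \<le> a w + (\<Sum>i<N. k i \<bullet> g w i) + \<epsilon> / 2"
    using w'(2) t(3) by (simp add: inner_diff_right sum_subtractf)
  have "(\<Sum>i<N. k i \<bullet> g w i) \<le> (\<Sum>i<N. L i * \<tau> - L i * norm (g w i))"
  proof (intro sum_mono)
    fix i assume "i \<in> {..<N}"
    then have i: "i < N" by simp
    let ?v = "g w i"
    have "(norm ?v)\<^sup>2 / s ?v \<ge> norm ?v - \<tau>"
    proof (cases "norm ?v \<le> \<tau>")
      case True
      moreover have "(norm ?v)\<^sup>2 / s ?v \<ge> 0" using s_ge(3)[of ?v] by simp
      ultimately show ?thesis by linarith
    next
      case False
      have "s ?v \<le> norm ?v + \<tau>" unfolding s_def using \<tau> by (intro real_le_lsqrt) (auto simp: power2_sum)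
      then have "(norm ?v - \<tau>) * s ?v \<le> (norm ?v - \<tau>) * (norm ?v + \<tau>)"
        using False by (intro mult_left_mono) auto
      also have "\<dots> \<le> (norm ?v)\<^sup>2" by (simp add: algebra_simps power2_eq_square)
      finally show ?thesis using s_ge(3)[of ?v] by (simp add: field_simps)
    qed
    then have "L i * (norm ?v - \<tau>) \<le> L i * ((norm ?v)\<^sup>2 / s ?v)" using L[OF i] by (rule mult_left_mono)
    then show "k i \<bullet> g w i \<le> L i * \<tau> - L i * norm (g w i)"
      by (simp add: k_def power2_norm_eq_inner right_diff_distrib)
  qed
  also have "\<dots> = SL * \<tau> - (\<Sum>i<N. L i * norm (g w i))"
    by (simp add: sum_subtractf SL_def sum_distrib_right)
  also have "SL * \<tau> \<le> \<epsilon> / 2"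
  proof -
    have "SL * \<tau> \<le> (SL + 1) * \<tau>" using \<tau> by simp
    also have "\<dots> = \<epsilon> / 2" using SL by (simp add: \<tau>_def field_simps add_nonneg_eq_0_iff)
    finally show ?thesis .
  qed
  finally show ?thesis using 1 w(1) by (intro bexI[of _ w]) auto
qed

subsection \<open>Integrals and conditional expectations\<close>

text \<open>The bound follows from the arithmetic-geometric mean inequality.\<close>

lemma linear_on_event_le:
  fixes t \<kappa> :: real
  assumes "0 < \<kappa>"
  shows "(1 + t) * (if E then 1 else 0) \<le> 2 * \<kappa> * (1 + t\<^sup>2) + (1 / (4 * \<kappa>)) * (if E then 1 else 0)"
proof (cases E)
  case True
  have "0 \<le> (2 * \<kappa> * (1 + t) - 1)\<^sup>2" by simp
  then have "4 * \<kappa> * (1 + t) \<le> 4 * \<kappa>\<^sup>2 * (1 + t)\<^sup>2 + 1" by (simp add: power2_diff power_mult_distrib)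
  moreover have "(1 + t)\<^sup>2 \<le> 2 * (1 + t\<^sup>2)"
    using zero_le_power2[of "1 - t"] by (simp add: power2_sum power2_diff)
  then have "4 * \<kappa>\<^sup>2 * (1 + t)\<^sup>2 \<le> 4 * \<kappa>\<^sup>2 * (2 * (1 + t\<^sup>2))" by (intro mult_left_mono) auto
  ultimately have "4 * \<kappa> * (1 + t) \<le> 4 * \<kappa> * (2 * \<kappa> * (1 + t\<^sup>2) + 1 / (4 * \<kappa>))"
    using assms by (simp add: power2_eq_square distrib_left)
  then have "1 + t \<le> 2 * \<kappa> * (1 + t\<^sup>2) + 1 / (4 * \<kappa>)"
    using assms by (simp only: mult_le_cancel_left_pos mult_pos_pos zero_less_numeral)
  then show ?thesis using True by simp
qed (use assms in simp)

lemma tail_small: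
  fixes f :: "'a \<Rightarrow> real" and Y :: "'a \<Rightarrow> 'v::real_normed_vector"
  assumes [measurable]: "Y \<in> borel_measurable M" and f: "integrable M f" "\<And>\<omega>. 0 \<le> f \<omega>" and "0 < \<epsilon>"
  obtains r where "0 < r" "(\<integral>\<omega>. (if norm (Y \<omega>) > r then f \<omega> else 0) \<partial>M) < \<epsilon>"
proof -
  have [measurable]: "f \<in> borel_measurable M" using f(1) by simp
  have "(\<lambda>n. \<integral>\<omega>. (if norm (Y \<omega>) > real n then f \<omega> else 0) \<partial>M) \<longlonglongrightarrow> (\<integral>\<omega>. 0 \<partial>M)"
  proof (rule integral_dominated_convergence[where w = f])
    show "AE \<omega> in M. (\<lambda>n. if norm (Y \<omega>) > real n then f \<omega> else 0) \<longlonglongrightarrow> 0"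
    proof (intro AE_I2)
      fix \<omega>
      obtain n0 where "norm (Y \<omega>) \<le> real n0" using real_arch_simple by blast
      then have "eventually (\<lambda>n. (if norm (Y \<omega>) > real n then f \<omega> else 0) = 0) sequentially"
        by (intro eventually_sequentiallyI[of n0]) auto
      then show "(\<lambda>n. if norm (Y \<omega>) > real n then f \<omega> else 0) \<longlonglongrightarrow> 0" by (rule tendsto_eventually)
    qed
  qed (use f in auto)
  then have "eventually (\<lambda>n. (\<integral>\<omega>. (if norm (Y \<omega>) > real n then f \<omega> else 0) \<partial>M) < \<epsilon>) sequentially"
    using \<open>0 < \<epsilon>\<close> by (intro order_tendstoD(2)) auto
  then obtain n0 where n0: "\<And>n. n \<ge> n0 \<Longrightarrow> (\<integral>\<omega>. (if norm (Y \<omega>) > real n then f \<omega> else 0) \<partial>M) < \<epsilon>"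
    by (auto simp: eventually_sequentially)
  then show thesis by (intro that[of "real (Suc n0)"]) (use n0[of "Suc n0"] in simp_all)
qed

section \<open>Random vectors: components, factorisation, conditional means and martingale
  pairs\<close>

lemma borel_measurable_component [measurable (raw)]:
  fixes f :: "'a \<Rightarrow> real^'n"
  assumes "f \<in> borel_measurable M"
  shows "(\<lambda>x. f x $ i) \<in> borel_measurable M"
proof -
  have "(\<lambda>x. f x \<bullet> axis i 1) \<in> borel_measurable M" using assms by (intro borel_measurable_inner) auto
  then show ?thesis by (simp add: inner_axis)
qed

lemma borel_measurable_vec_lambda:
  fixes f :: "'n::finite \<Rightarrow> 'a \<Rightarrow> real"
  assumes "\<And>i. f i \<in> borel_measurable M"
  shows "(\<lambda>x. \<chi> i. f i x) \<in> borel_measurable M"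
proof (subst borel_measurable_euclidean_space, intro ballI)
  fix b :: "real^'n" assume "b \<in> Basis"
  then obtain i where "b = axis i 1" by (auto simp: Basis_vec_def)
  then show "(\<lambda>x. (\<chi> i. f i x) \<bullet> b) \<in> borel_measurable M" using assms by (simp add: inner_axis)
qed

text \<open>Doob-Dynkin factorisation: \<open>f\<close> is recovered from its superlevel sets at
  rational levels, each of which is a preimage under \<open>g\<close>. The target \<open>N\<close>
  is arbitrary because the factor is later wanted measurable for \<open>sigma_PG\<close>, a
  sub-sigma-algebra of the Borel sets.\<close>

lemma vimage_algebra_factor:
  fixes f :: "'a \<Rightarrow> real"
  assumes f: "f \<in> borel_measurable (vimage_algebra \<Omega> g N)" and g: "g \<in> \<Omega> \<rightarrow> space N"
  obtains \<xi> where "\<xi> \<in> borel_measurable N" "\<And>x. x \<in> \<Omega> \<Longrightarrow> f x = \<xi> (g x)"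
proof -
  have "\<exists>A\<in>sets N. {x\<in>\<Omega>. real_of_rat r < f x} = g -` A \<inter> \<Omega>" for r
  proof -
    have "{x\<in>space (vimage_algebra \<Omega> g N). real_of_rat r < f x} \<in> sets (vimage_algebra \<Omega> g N)"
      using f by measurable
    then show ?thesis by (auto simp: sets_vimage_algebra2[OF g])
  qed
  then obtain A where A[measurable]: "\<And>r. A r \<in> sets N" and Ar: "\<And>r. {x\<in>\<Omega>. real_of_rat r < f x} = g -` A r \<inter> \<Omega>"
    by metis
  \<comment> \<open>On the range of \<open>g\<close> the supremum runs exactly over the rationals
    below \<open>f x\<close>. Elsewhere it may be infinite, and \<open>real_of_ereal\<close> then
    supplies 0.\<close>
  define \<xi> where "\<xi> y = real_of_ereal (SUP r. if y \<in> A r then ereal (real_of_rat r) else - \<infinity>)" for y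
  show thesis
  proof
    show "\<xi> \<in> borel_measurable N" unfolding \<xi>_def[abs_def] by measurable
    show "f x = \<xi> (g x)" if x: "x \<in> \<Omega>" for x
    proof -
      let ?s = "SUP r. if g x \<in> A r then ereal (real_of_rat r) else - \<infinity>"
      have mem: "g x \<in> A r \<longleftrightarrow> real_of_rat r < f x" for r using Ar[of r] x by auto
      have "?s \<le> ereal (f x)" by (intro SUP_least) (auto simp: mem)
      moreover have "\<not> ?s < ereal (f x)"
      proof
        assume "?s < ereal (f x)"
        then obtain r where r: "?s < ereal (real_of_rat r)" "ereal (real_of_rat r) < ereal (f x)"
          using ereal_dense3 by blast
        have "(if g x \<in> A r then ereal (real_of_rat r) else - \<infinity>) \<le> ?s" by (rule SUP_upper) simp
        then show False using r by (simp add: mem)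
      qed
      ultimately have "?s = ereal (f x)" by simp
      then show ?thesis by (simp add: \<xi>_def)
    qed
  qed
qed

lemma (in sigma_finite_subalgebra) vcond_exp_inner:
  fixes Y :: "'a \<Rightarrow> real^'n"
  assumes Y: "integrable M Y"
  shows "AE \<omega> in M. real_cond_exp M F (\<lambda>\<omega>. v \<bullet> Y \<omega>) \<omega> = v \<bullet> vcond_exp M F Y \<omega>"
proof -
  have Yi: "integrable M (\<lambda>\<omega>. Y \<omega> $ i)" for i
    using integrable_inner_right[OF Y, of "axis i 1"] by (simp add: inner_axis')
  have "AE \<omega> in M. real_cond_exp M F (\<lambda>\<omega>. \<Sum>i\<in>UNIV. v $ i * Y \<omega> $ i) \<omega>
      = (\<Sum>i\<in>UNIV. real_cond_exp M F (\<lambda>\<omega>. v $ i * Y \<omega> $ i) \<omega>)"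
    by (rule real_cond_exp_sum) (intro integrable_mult_right Yi)
  moreover have "AE \<omega> in M. \<forall>i\<in>UNIV. real_cond_exp M F (\<lambda>\<omega>. v $ i * Y \<omega> $ i) \<omega> = v $ i * real_cond_exp M F (\<lambda>\<omega>. Y \<omega> $ i) \<omega>"
    by (intro AE_finite_allI real_cond_exp_cmult Yi) auto
  ultimately show ?thesis
    by eventually_elim (simp add: inner_vec_def vcond_exp_def)
qed

text \<open>The hypothesis is tested on the part \<open>B\<close> of \<open>A\<close> where the
  conditional expectation is positive: a nonnegative function with nonpositive integral vanishes
  almost everywhere.\<close>

lemma (in sigma_finite_subalgebra) real_cond_exp_nonpos_on:
  assumes f: "integrable M f" and A: "A \<in> sets F"
    and le: "\<And>B. B \<in> sets F \<Longrightarrow> B \<subseteq> A \<Longrightarrow> (\<integral>x\<in>B. f x \<partial>M) \<le> 0"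
  shows "AE x in M. x \<in> A \<longrightarrow> real_cond_exp M F f x \<le> 0"
proof -
  let ?g = "real_cond_exp M F f"
  define B where "B = {x\<in>A. 0 < ?g x}"
  have sub: "A \<subseteq> space F" using A by (rule sets.sets_into_space)
  have B: "B \<in> sets F"
  proof -
    have "B = A \<inter> {x\<in>space F. 0 < ?g x}" using sub by (auto simp: B_def)
    moreover have "{x\<in>space F. 0 < ?g x} \<in> sets F" by measurable
    ultimately show ?thesis using A by auto
  qed
  have BM: "B \<in> sets M" using B subalg by (auto simp: subalgebra_def)
  have int: "integrable M (\<lambda>x. indicator B x * ?g x)"
    using integrable_mult_indicator[OF BM real_cond_exp_int(1)[OF f]] by simp
  have "(\<integral>x. indicator B x * ?g x \<partial>M) \<le> 0"
    using le[OF B] real_cond_exp_intA[OF f B] by (auto simp: B_def set_lebesgue_integral_def)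
  moreover have nn: "0 \<le> indicator B x * ?g x" for x by (auto simp: B_def indicator_def)
  moreover have "0 \<le> (\<integral>x. indicator B x * ?g x \<partial>M)"
    by (intro Bochner_Integration.integral_nonneg nn)
  ultimately have "(\<integral>x. indicator B x * ?g x \<partial>M) = 0" by linarith
  then have "AE x in M. indicator B x * ?g x = 0"
    using int nn by (subst (asm) integral_nonneg_eq_0_iff_AE) auto
  then show ?thesis by eventually_elim (auto simp: B_def indicator_def split: if_splits)
qed

lemma sets_sigma_rv: "sets (sigma_rv M Z) = {Z -` A \<inter> space M | A. A \<in> sets borel}"
  unfolding sigma_rv_def by (rule sets_vimage_algebra2) auto

lemma subalgebra_sigma_rv: "Z \<in> borel_measurable M \<Longrightarrow> subalgebra M (sigma_rv M Z)"
  unfolding subalgebra_def sets_sigma_rv by (auto simp: sigma_rv_def intro: measurable_sets)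

lemma measurable_sigma_rv: "Z \<in> borel_measurable (sigma_rv M Z)"
  unfolding sigma_rv_def by (rule measurable_vimage_algebra1) auto

lemma measurable_sigma_rv_comp: "f \<in> borel_measurable borel \<Longrightarrow> (\<lambda>\<omega>. f (Z \<omega>)) \<in> borel_measurable (sigma_rv M Z)"
  using measurable_compose[OF measurable_sigma_rv] .

text \<open>The condition E[Y|Z] = Z tested on events of \<open>Z\<close>. In this form it depends
  only on the joint law of \<open>Z\<close> and \<open>Y\<close>, which lets it pass between random
  variables and plans.\<close>

definition mart :: "'a measure \<Rightarrow> ('a \<Rightarrow> real^'n) \<Rightarrow> ('a \<Rightarrow> real^'n) \<Rightarrow> bool" where
  "mart M Z Y \<longleftrightarrow> (\<forall>A\<in>sets borel. \<forall>i. (\<integral>\<omega>. indicator A (Z \<omega>) * Y \<omega> $ i \<partial>M) = (\<integral>\<omega>. indicator A (Z \<omega>) * Z \<omega> $ i \<partial>M))"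

context prob_space begin

lemma L2_integrable:
  fixes Z :: "'a \<Rightarrow> real^'n"
  assumes "L2 M Z"
  shows "integrable M Z" "integrable M (\<lambda>\<omega>. Z \<omega> $ i)"
proof -
  have [measurable]: "Z \<in> borel_measurable M" and sq: "integrable M (\<lambda>\<omega>. (norm (Z \<omega>))\<^sup>2)"
    using assms by (auto simp: L2_def)
  show Z: "integrable M Z"
  proof (rule Bochner_Integration.integrable_bound)
    show "integrable M (\<lambda>\<omega>. 1 + (norm (Z \<omega>))\<^sup>2)" using sq by simp
    have "norm y \<le> 1 + (norm y)\<^sup>2" for y :: "real^'n"
      using zero_le_power2[of "norm y - 1/2"] by (simp add: power2_diff field_simps power2_eq_square)
    then show "AE \<omega> in M. norm (Z \<omega>) \<le> norm (1 + (norm (Z \<omega>))\<^sup>2)" by simp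
  qed simp
  show "integrable M (\<lambda>\<omega>. Z \<omega> $ i)"
    using integrable_inner_right[OF Z, of "axis i 1"] by (simp add: inner_axis')
qed

lemma L2_prod_integrable:
  fixes Z Y :: "'a \<Rightarrow> real^'n"
  assumes "L2 M Z" "L2 M Y" and [measurable]: "f \<in> borel_measurable M"
    and le: "\<And>\<omega>. \<bar>f \<omega>\<bar> \<le> c * norm (Z \<omega>) * norm (Y \<omega>)" and c: "0 \<le> c"
  shows "integrable M (f :: 'a \<Rightarrow> real)"
proof (rule Bochner_Integration.integrable_bound)
  show "integrable M (\<lambda>\<omega>. c * ((norm (Z \<omega>))\<^sup>2 + (norm (Y \<omega>))\<^sup>2))"
    using assms(1,2) by (auto simp: L2_def)
  have "\<bar>f \<omega>\<bar> \<le> c * ((norm (Z \<omega>))\<^sup>2 + (norm (Y \<omega>))\<^sup>2)" for \<omega>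
  proof -
    have "2 * (norm (Z \<omega>) * norm (Y \<omega>)) \<le> (norm (Z \<omega>))\<^sup>2 + (norm (Y \<omega>))\<^sup>2"
      using zero_le_power2[of "norm (Z \<omega>) - norm (Y \<omega>)"] by (simp add: power2_diff)
    moreover have "0 \<le> norm (Z \<omega>) * norm (Y \<omega>)" by simp
    ultimately have "norm (Z \<omega>) * norm (Y \<omega>) \<le> (norm (Z \<omega>))\<^sup>2 + (norm (Y \<omega>))\<^sup>2" by linarith
    then have "c * (norm (Z \<omega>) * norm (Y \<omega>)) \<le> c * ((norm (Z \<omega>))\<^sup>2 + (norm (Y \<omega>))\<^sup>2)" using c by (rule mult_left_mono)
    then show ?thesis using le[of \<omega>] by (simp add: mult.assoc)
  qed
  then show "AE \<omega> in M. norm (f \<omega>) \<le> norm (c * ((norm (Z \<omega>))\<^sup>2 + (norm (Y \<omega>))\<^sup>2))"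
    using c by (intro AE_I2) (auto simp: abs_mult)
qed simp

lemma vcond_exp_charact:
  fixes Y Z :: "'a \<Rightarrow> real^'n"
  assumes F: "subalgebra M F" and Y: "L2 M Y" and Z: "L2 M Z" and ZF: "Z \<in> borel_measurable F"
    and eq: "\<And>A i. A \<in> sets F \<Longrightarrow> (\<integral>\<omega>. indicator A \<omega> * Y \<omega> $ i \<partial>M) = (\<integral>\<omega>. indicator A \<omega> * Z \<omega> $ i \<partial>M)"
  shows "AE \<omega> in M. vcond_exp M F Y \<omega> = Z \<omega>"
proof -
  interpret F: finite_measure_subalgebra M F by unfold_locales (rule F)
  have "AE \<omega> in M. \<forall>i\<in>UNIV. real_cond_exp M F (\<lambda>\<omega>. Y \<omega> $ i) \<omega> = Z \<omega> $ i"
  proof (intro AE_finite_allI)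
    fix i :: 'n
    show "AE \<omega> in M. real_cond_exp M F (\<lambda>\<omega>. Y \<omega> $ i) \<omega> = Z \<omega> $ i"
    proof (rule F.real_cond_exp_charact)
      show "(\<integral>\<omega>\<in>A. Y \<omega> $ i \<partial>M) = (\<integral>\<omega>\<in>A. Z \<omega> $ i \<partial>M)" if "A \<in> sets F" for A
        using eq[OF that, of i] by (simp add: set_lebesgue_integral_def)
      show "(\<lambda>\<omega>. Z \<omega> $ i) \<in> borel_measurable F" using ZF by measurable
    qed (use L2_integrable[OF Y] L2_integrable[OF Z] in auto)
  qed auto
  then show ?thesis by eventually_elim (simp add: vcond_exp_def vec_eq_iff)
qed

lemma vcond_exp_integral:
  fixes Y :: "'a \<Rightarrow> real^'n"
  assumes F: "subalgebra M F" and Y: "L2 M Y" and A: "A \<in> sets F"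
  shows "(\<integral>\<omega>. indicator A \<omega> * Y \<omega> $ i \<partial>M) = (\<integral>\<omega>. indicator A \<omega> * vcond_exp M F Y \<omega> $ i \<partial>M)"
proof -
  interpret F: finite_measure_subalgebra M F by unfold_locales (rule F)
  show ?thesis
    using F.real_cond_exp_intA[OF L2_integrable(2)[OF Y, of i] A] by (simp add: set_lebesgue_integral_def vcond_exp_def)
qed

lemma mart_iff:
  fixes Y Z :: "'a \<Rightarrow> real^'n"
  assumes Y: "L2 M Y" and Z: "L2 M Z"
  shows "mart M Z Y \<longleftrightarrow> (AE \<omega> in M. vcond_exp M (sigma_rv M Z) Y \<omega> = Z \<omega>)"
proof -
  have [measurable]: "Z \<in> borel_measurable M" "Y \<in> borel_measurable M" using Y Z by (auto simp: L2_def)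
  note F = subalgebra_sigma_rv[of Z]
  have ind: "(\<integral>\<omega>. indicator (Z -` A \<inter> space M) \<omega> * f \<omega> \<partial>M) = (\<integral>\<omega>. indicator A (Z \<omega>) * f \<omega> \<partial>M)" for A and f :: "'a \<Rightarrow> real"
    by (intro Bochner_Integration.integral_cong) (auto simp: indicator_def)
  show ?thesis
  proof
    assume m: "mart M Z Y"
    show "AE \<omega> in M. vcond_exp M (sigma_rv M Z) Y \<omega> = Z \<omega>"
    proof (rule vcond_exp_charact[OF F Y Z measurable_sigma_rv])
      show "(\<integral>\<omega>. indicator A \<omega> * Y \<omega> $ i \<partial>M) = (\<integral>\<omega>. indicator A \<omega> * Z \<omega> $ i \<partial>M)" if "A \<in> sets (sigma_rv M Z)" for A i
        using that m unfolding sets_sigma_rv mart_def by (auto simp: ind)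
    qed measurable
  next
    assume v: "AE \<omega> in M. vcond_exp M (sigma_rv M Z) Y \<omega> = Z \<omega>"
    have [measurable]: "vcond_exp M (sigma_rv M Z) Y \<in> borel_measurable M"
    proof -
      have "(\<lambda>\<omega>. real_cond_exp M (sigma_rv M Z) (\<lambda>\<omega>. Y \<omega> $ i) \<omega>) \<in> borel_measurable M" for i
        by (rule measurable_from_subalg[OF F borel_measurable_cond_exp]) measurable
      then show ?thesis unfolding vcond_exp_def by (intro borel_measurable_vec_lambda)
    qed
    show "mart M Z Y" unfolding mart_def
    proof (intro ballI allI)
      fix A :: "(real^'n) set" and i assume A[measurable]: "A \<in> sets borel"
      have "Z -` A \<inter> space M \<in> sets (sigma_rv M Z)" using A by (auto simp: sets_sigma_rv)
      then have "(\<integral>\<omega>. indicator A (Z \<omega>) * Y \<omega> $ i \<partial>M) = (\<integral>\<omega>. indicator A (Z \<omega>) * vcond_exp M (sigma_rv M Z) Y \<omega> $ i \<partial>M)"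
        using vcond_exp_integral[OF F Y, of "Z -` A \<inter> space M" i] by (simp add: ind)
      also have "\<dots> = (\<integral>\<omega>. indicator A (Z \<omega>) * Z \<omega> $ i \<partial>M)"
        by (intro integral_cong_AE) (use v in \<open>auto elim: eventually_mono\<close>)
      finally show "(\<integral>\<omega>. indicator A (Z \<omega>) * Y \<omega> $ i \<partial>M) = (\<integral>\<omega>. indicator A (Z \<omega>) * Z \<omega> $ i \<partial>M)" .
    qed
  qed
qed

end

subsection \<open>The quadratic form of S\<close>

locale S_space =
  fixes S :: "real^'n^'n"
  assumes sym: "transpose S = S" and inv: "invertible S"
begin

abbreviation B :: "real^'n \<Rightarrow> real^'n \<Rightarrow> real" where "B \<equiv> Sform S"

definition q :: "real^'n \<Rightarrow> real" where "q x = B x x / 2"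

text \<open>The affine function tangent to \<open>q\<close> at \<open>z\<close>. The supremum of
  these tangents over G is \<open>psi\<close>.\<close>

definition h :: "real^'n \<Rightarrow> real^'n \<Rightarrow> real" where "h z y = B z y - q z"

lemma B_commute: "B x y = B y x"
  unfolding Sform_def using dot_lmul_matrix[of x S y] transpose_matrix_vector[of S x] sym
  by (simp add: inner_commute)

lemma B_add_left: "B (x + y) z = B x z + B y z"
  by (simp add: Sform_def inner_add_left)

lemma B_add_right: "B z (x + y) = B z x + B z y"
  by (simp add: Sform_def inner_add_right matrix_vector_right_distrib)

lemma B_diff_left: "B (x - y) z = B x z - B y z"
  by (simp add: Sform_def inner_diff_left)

lemma B_diff_right: "B z (x - y) = B z x - B z y"
  by (simp add: Sform_def inner_diff_right matrix_vector_mult_diff_distrib)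

lemma B_scaleR_left: "B (c *\<^sub>R x) z = c * B x z"
  by (simp add: Sform_def)

lemma B_scaleR_right: "B z (c *\<^sub>R x) = c * B z x"
  by (simp add: Sform_def matrix_vector_mult_scaleR)

lemma B_minus_left: "B (- x) z = - B x z"
  using B_scaleR_left[of "-1" x z] by simp

lemma B_minus_right: "B z (- x) = - B z x"
  using B_scaleR_right[of z "-1" x] by simp

lemma B_zero_left [simp]: "B 0 z = 0"
  by (simp add: Sform_def)

lemma B_zero_right [simp]: "B z 0 = 0"
  by (simp add: Sform_def)

lemmas B_simps = B_add_left B_add_right B_diff_left B_diff_right B_scaleR_left B_scaleR_right
  B_minus_left B_minus_right

lemma B_nondegenerate:
  assumes "\<And>y. B x y = 0" shows "x = 0"
proof -
  obtain S' where S': "S ** S' = mat 1" using inv by (auto simp: invertible_def)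
  have "x \<bullet> y = 0" for y
    using assms[of "S' *v y"] S' by (simp add: Sform_def matrix_vector_mul_assoc)
  from this[of x] show ?thesis by simp
qed

text \<open>\<open>q\<close> being quadratic, its gap to the tangent at \<open>z\<close> is
  \<open>q\<close> of the displacement. Maximising \<open>h z y\<close> over \<open>z\<close> is
  thus minimising \<open>q (y - z)\<close>, which links the argmax map to monotonicity.\<close>

lemma h_eq: "h z y = q y - q (y - z)"
  by (simp add: h_def q_def B_simps B_commute[of z y] field_simps)

lemma q_zero [simp]: "q 0 = 0" by (simp add: q_def)

lemma q_minus [simp]: "q (- x) = q x" by (simp add: q_def B_simps)

lemma q_minus_commute: "q (x - y) = q (y - x)"
  using q_minus[of "x - y"] by simp

lemma q_scaleR: "q (c *\<^sub>R x) = c\<^sup>2 * q x"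
  by (simp add: q_def B_simps power2_eq_square)

lemma q_add: "q (x + y) = q x + q y + B x y"
  by (simp add: q_def B_simps B_commute[of y x] field_simps)

lemma q_diff: "q (x - y) = q x + q y - B x y"
  by (simp add: q_def B_simps B_commute[of y x] field_simps)

lemma q_convex_comb: "q ((1 - t) *\<^sub>R x + t *\<^sub>R y) = (1 - t) * q x + t * q y - t * (1 - t) * q (y - x)"
proof -
  have "q ((1 - t) *\<^sub>R x + t *\<^sub>R y) = (1 - t)\<^sup>2 * q x + t\<^sup>2 * q y + (1 - t) * t * B x y"
    by (simp add: q_add q_scaleR B_simps)
  then show ?thesis by (simp add: q_diff B_commute[of y x] power2_eq_square algebra_simps)
qed

lemma h_affine: "h z ((1 - t) *\<^sub>R x + t *\<^sub>R y) = (1 - t) * h z x + t * h z y"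
  by (simp add: h_def B_simps algebra_simps)

lemma h_inner: "h z y = (S *v z) \<bullet> y - q z"
  by (simp add: h_def B_commute[of z y]) (simp add: Sform_def inner_commute)

lemma continuous_on_S_mult [continuous_intros]:
  "continuous_on A f \<Longrightarrow> continuous_on A (\<lambda>x. S *v f x)"
  by (intro bounded_linear.continuous_on[OF matrix_vector_mul_bounded_linear])

lemma continuous_on_B [continuous_intros]:
  "continuous_on A f \<Longrightarrow> continuous_on A g \<Longrightarrow> continuous_on A (\<lambda>x. B (f x) (g x))"
  unfolding Sform_def by (intro continuous_intros)

lemma continuous_on_q [continuous_intros]:
  "continuous_on A f \<Longrightarrow> continuous_on A (\<lambda>x. q (f x))"
  unfolding q_def by (intro continuous_intros) auto

lemma continuous_on_h [continuous_intros]: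
  "continuous_on A f \<Longrightarrow> continuous_on A g \<Longrightarrow> continuous_on A (\<lambda>x. h (f x) (g x))"
  unfolding h_def by (intro continuous_intros)

text \<open>The added 1 makes positivity immediate; \<open>C\<close> appears in denominators
  below.\<close>

definition C :: real where "C = onorm ((*v) S) + 1"

lemma C_pos: "C > 0"
  unfolding C_def using onorm_pos_le[OF matrix_vector_mul_bounded_linear[of S]] by linarith

lemma B_bound: "\<bar>B x y\<bar> \<le> C * norm x * norm y"
proof -
  have "norm (S *v y) \<le> onorm ((*v) S) * norm y"
    by (rule onorm[OF matrix_vector_mul_bounded_linear])
  also have "\<dots> \<le> C * norm y" by (simp add: C_def mult_right_mono)
  finally have "norm (S *v y) \<le> C * norm y" .
  then have "norm x * norm (S *v y) \<le> norm x * (C * norm y)" by (simp add: mult_left_mono)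
  then show ?thesis
    unfolding Sform_def using Cauchy_Schwarz_ineq2[of x "S *v y"] by (simp add: ac_simps)
qed

lemma q_bound: "\<bar>q x\<bar> \<le> C / 2 * (norm x)\<^sup>2"
  using B_bound[of x x] by (simp add: q_def power2_eq_square)

lemma q_diff_bound: "\<bar>q x - q y\<bar> \<le> C / 2 * norm (x - y) * (norm x + norm y)"
proof -
  have "q x - q y = B (x - y) (x + y) / 2"
    by (simp add: q_def B_simps B_commute[of y x])
  then have "\<bar>q x - q y\<bar> \<le> C * norm (x - y) * norm (x + y) / 2"
    using B_bound[of "x - y" "x + y"] by (metis abs_divide abs_numeral divide_right_mono zero_le_numeral)
  also have "\<dots> \<le> C * norm (x - y) * (norm x + norm y) / 2"
    using C_pos norm_triangle_ineq[of x y] by (intro divide_right_mono mult_left_mono) auto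
  finally show ?thesis by simp
qed

subsection \<open>An involution adapted to the form\<close>

text \<open>The last clause says that every vector has a \<open>B\<close>-orthogonal projection to
  \<open>V\<close>. It is carried along because an indefinite form does not project to arbitrary
  subspaces.\<close>

definition splits :: "(real^'n) set \<Rightarrow> bool" where
  "splits V \<longleftrightarrow> subspace V \<and> (\<forall>v\<in>V. v \<noteq> 0 \<longrightarrow> B v v < 0) \<and>
     (\<forall>x. \<exists>v\<in>V. \<forall>w\<in>V. B (x - v) w = 0)"

text \<open>A Gram-Schmidt step: orthogonality of \<open>u\<close> to \<open>V\<close> makes the
  form on the sum diagonal, and projections to the larger space gain the component
  \<open>B (x - v) u / B u u\<close> along \<open>u\<close>.\<close>

lemma splits_extend:
  assumes V: "splits V" and u: "B u u < 0" and orth: "\<And>w. w \<in> V \<Longrightarrow> B u w = 0"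
  shows "\<exists>W. splits W \<and> V \<subset> W"
proof (intro exI conjI)
  let ?W = "{v + t *\<^sub>R u | v t. v \<in> V}"
  have sub: "subspace V" and neg: "\<And>v. v \<in> V \<Longrightarrow> v \<noteq> 0 \<Longrightarrow> B v v < 0"
    and dec: "\<And>x. \<exists>v\<in>V. \<forall>w\<in>V. B (x - v) w = 0"
    using V by (auto simp: splits_def)
  have 1: "B (v + t *\<^sub>R u) (w + r *\<^sub>R u) = B v w + t * r * B u u" if "v \<in> V" "w \<in> V" for v w t r
    using orth[of w] orth[of v] that by (simp add: B_simps B_commute[of v u])
  show "splits ?W" unfolding splits_def
  proof (intro conjI ballI impI allI)
    show "subspace ?W" unfolding subspace_def
    proof (intro conjI ballI allI)
      show "0 \<in> ?W" using subspace_0[OF sub] by (intro CollectI exI[of _ 0]) auto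
      show "x + y \<in> ?W" if "x \<in> ?W" "y \<in> ?W" for x y
      proof -
        obtain v t w r where "x = v + t *\<^sub>R u" "y = w + r *\<^sub>R u" "v \<in> V" "w \<in> V"
          using \<open>x \<in> ?W\<close> \<open>y \<in> ?W\<close> by blast
        then show ?thesis using subspace_add[OF sub]
          by (intro CollectI exI[of _ "v + w"] exI[of _ "t + r"]) (auto simp: algebra_simps)
      qed
      show "c *\<^sub>R x \<in> ?W" if "x \<in> ?W" for x c
      proof -
        obtain v t where "x = v + t *\<^sub>R u" "v \<in> V" using \<open>x \<in> ?W\<close> by blast
        then show ?thesis using subspace_scale[OF sub]
          by (intro CollectI exI[of _ "c *\<^sub>R v"] exI[of _ "c * t"]) (auto simp: algebra_simps)
      qed
    qed
    show "B x x < 0" if "x \<in> ?W" "x \<noteq> 0" for x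
    proof -
      obtain v t where x: "x = v + t *\<^sub>R u" "v \<in> V" using \<open>x \<in> ?W\<close> by blast
      have e: "B x x = B v v + t * t * B u u" using 1 x by simp
      show ?thesis
      proof (cases "v = 0")
        case True
        then have "t \<noteq> 0" using x \<open>x \<noteq> 0\<close> by auto
        then have "t * t > 0" using not_real_square_gt_zero by blast
        then show ?thesis using e True u by (simp add: mult_less_0_iff)
      next
        case False
        then have "B v v < 0" using neg x by blast
        moreover have "t * t * B u u \<le> 0" using u by (simp add: mult_nonneg_nonpos)
        ultimately show ?thesis using e by linarith
      qed
    qed
    show "\<exists>v\<in>?W. \<forall>w\<in>?W. B (x - v) w = 0" for x
    proof -
      obtain v where v: "v \<in> V" "\<And>w. w \<in> V \<Longrightarrow> B (x - v) w = 0" using dec[of x] by blast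
      let ?t = "B (x - v) u / B u u"
      have "B (x - (v + ?t *\<^sub>R u)) (w + r *\<^sub>R u) = 0" if w: "w \<in> V" for w r
      proof -
        have "B (x - (v + ?t *\<^sub>R u)) (w + r *\<^sub>R u) =
            B (x - v) w - ?t * B u w + r * (B (x - v) u - ?t * B u u)"
          by (simp add: B_simps algebra_simps)
        then show ?thesis using v(2)[OF w] orth[OF w] u by simp
      qed
      then show ?thesis using v(1) by (intro bexI[of _ "v + ?t *\<^sub>R u"]) auto
    qed
  qed
  show "V \<subset> ?W"
  proof
    have "v \<in> ?W" if "v \<in> V" for v
      using that by (intro CollectI exI[of _ v] exI[of _ 0]) auto
    then show "V \<subseteq> ?W" by blast
    have "u \<in> ?W" using subspace_0[OF sub] by (intro CollectI exI[of _ 0] exI[of _ 1]) auto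
    moreover have "u \<notin> V" using orth[of u] u by auto
    ultimately show "V \<noteq> ?W" by blast
  qed
qed

text \<open>A maximal negative definite subspace with orthogonal complement replaces the diagonalisation of S;
  J is the reflection in that subspace.\<close>

lemma involution_exists:
  obtains J where "linear J" "\<And>x. J (J x) = x" "\<And>x y. B (J x) y = B x (J y)"
    "\<And>x. x \<noteq> 0 \<Longrightarrow> B (J x) x > 0"
proof -
  have "splits {0}" by (auto simp: splits_def)
  moreover have "\<forall>V. splits V \<longrightarrow> dim V < Suc (DIM(real^'n))"
    using dim_subset_UNIV less_Suc_eq_le by blast
  ultimately obtain V where V: "splits V" and Vmax: "\<And>W. splits W \<Longrightarrow> dim W \<le> dim V"
    using ex_has_greatest_nat[of splits "{0}" dim "Suc (DIM(real^'n))"] by metis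
  have sub: "subspace V" and neg: "\<And>v. v \<in> V \<Longrightarrow> v \<noteq> 0 \<Longrightarrow> B v v < 0"
    and dec: "\<And>x. \<exists>v\<in>V. \<forall>w\<in>V. B (x - v) w = 0"
    using V by (auto simp: splits_def)
  \<comment> \<open>Maximality of the dimension: a vector orthogonal to \<open>V\<close> with
    negative square would extend \<open>V\<close>.\<close>
  have nonneg: "B u u \<ge> 0" if "\<And>w. w \<in> V \<Longrightarrow> B u w = 0" for u
  proof (rule ccontr)
    assume "\<not> ?thesis"
    then have "\<exists>W. splits W \<and> V \<subset> W" using splits_extend[OF V, of u] that by auto
    then obtain W where W: "splits W" "V \<subset> W" by blast
    then have "dim V < dim W"
      using dim_psubset[of V W] by (simp add: splits_def span_eq_iff[THEN iffD2] sub)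
    then show False using Vmax[OF W(1)] by simp
  qed
  obtain P where P: "\<And>x. P x \<in> V" "\<And>x w. w \<in> V \<Longrightarrow> B (x - P x) w = 0"
    using dec by metis
  have Puniq: "P x = v" if v: "v \<in> V" "\<And>w. w \<in> V \<Longrightarrow> B (x - v) w = 0" for x v
  proof -
    have "P x - v \<in> V" using P(1) v(1) sub by (simp add: subspace_diff)
    moreover have "B (P x - v) (P x - v) = B (x - v) (P x - v) - B (x - P x) (P x - v)"
      by (simp add: B_simps)
    ultimately have "B (P x - v) (P x - v) = 0" using v(2) P(2) by simp
    then show ?thesis using neg[of "P x - v"] \<open>P x - v \<in> V\<close> by force
  qed
  have Plin: "linear P"
  proof (rule linearI)
    show "P (x + y) = P x + P y" for x y
    proof (rule Puniq)
      show "P x + P y \<in> V" using P(1) sub by (simp add: subspace_add)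
      show "B (x + y - (P x + P y)) w = 0" if "w \<in> V" for w
      proof -
        have "B (x + y - (P x + P y)) w = B (x - P x) w + B (y - P y) w" by (simp add: B_simps)
        then show ?thesis using P(2) that by simp
      qed
    qed
    show "P (c *\<^sub>R x) = c *\<^sub>R P x" for c x
    proof (rule Puniq)
      show "c *\<^sub>R P x \<in> V" using P(1) sub by (simp add: subspace_scale)
      show "B (c *\<^sub>R x - c *\<^sub>R P x) w = 0" if "w \<in> V" for w
        using P(2)[OF that, of x] by (simp add: scaleR_diff_right[symmetric] B_scaleR_left)
    qed
  qed
  have PP: "P (P x) = P x" for x by (rule Puniq) (auto simp: P)
  have orth: "B (P x) y = B (P x) (P y)" for x y
    using P(2)[OF P(1)[of x], of y] by (simp add: B_simps B_commute)
  define J where "J x = x - 2 *\<^sub>R P x" for x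
  show thesis
  proof
    show "linear J" unfolding J_def
      by (intro linear_compose_sub linear_scale_self Plin linear_compose_scale_right linear_id[unfolded id_def])
    show "J (J x) = x" for x
    proof -
      have "P (J x) = P x - 2 *\<^sub>R P x" by (simp add: J_def linear_diff[OF Plin] linear_scale[OF Plin] PP)
      then show ?thesis by (simp add: J_def[of "J x"]) (simp add: J_def vec_eq_iff)
    qed
    have "B x (P y) = B (P x) (P y)" for x y
      using orth[of y x] by (simp only: B_commute[of x "P y"] B_commute[of "P x" "P y"])
    then show "B (J x) y = B x (J y)" for x y
      using orth[of x y] by (simp add: J_def B_simps)
    show "B (J x) x > 0" if "x \<noteq> 0" for x
    proof -
      define u where "u = x - P x"
      have u: "B u w = 0" if "w \<in> V" for w using P(2)[OF that] by (simp add: u_def)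
      have x: "x = u + P x" by (simp add: u_def)
      have e: "B (J x) x = B u u - B (P x) (P x)"
      proof -
        have "J x = u - P x" by (simp add: J_def u_def scaleR_2)
        then have "B (J x) x = B (u - P x) (u + P x)" using x by simp
        then show ?thesis using u[OF P(1)[of x]] by (simp add: B_simps B_commute[of "P x" u])
      qed
      show ?thesis
      proof (cases "P x = 0")
        case False
        then show ?thesis using e nonneg[OF u] neg[OF P(1)[of x]] by fastforce
      next
        case True
        then have ux: "u = x" by (simp add: u_def)
        have "B x x \<noteq> 0"
        proof
          assume 0: "B x x = 0"
          have "B x v = 0" if v: "\<And>w. w \<in> V \<Longrightarrow> B v w = 0" for v
          proof (rule ccontr)
            assume ne: "B x v \<noteq> 0"
            \<comment> \<open>An isotropic vector of a nonnegative form is orthogonal to everything.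
              Otherwise this \<open>t\<close> makes the square of \<open>t *\<^sub>R x + v\<close>
              equal to -1.\<close>
            define t where "t = - (B v v + 1) / (2 * B x v)"
            have "B (t *\<^sub>R x + v) (t *\<^sub>R x + v) = 2 * t * B x v + B v v"
              using 0 by (simp add: B_simps B_commute[of v x])
            also have "\<dots> = -1" using ne by (simp add: t_def field_simps)
            finally have "B (t *\<^sub>R x + v) (t *\<^sub>R x + v) < 0" by simp
            moreover have "B (t *\<^sub>R x + v) w = 0" if "w \<in> V" for w
              using u v that ux by (simp add: B_simps)
            ultimately show False using nonneg[of "t *\<^sub>R x + v"] by fastforce
          qed
          then have "B x (y - P y) = 0" for y using P(2) by blast
          moreover have "B x (P y) = 0" for y using u[OF P(1)] ux by simp
          ultimately have "B x y = 0" for y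
            by (metis B_diff_right diff_zero)
          then show False using B_nondegenerate \<open>x \<noteq> 0\<close> by blast
        qed
        then show ?thesis using e True nonneg[OF u] ux by fastforce
      qed
    qed
  qed
qed

subsection \<open>Maximal monotone sets below a convex function\<close>

definition dominating :: "(real^'n \<Rightarrow> real) set" where
  "dominating = {\<phi>. convex_on UNIV \<phi> \<and> (\<forall>x. q x \<le> \<phi> x)}"

text \<open>Zorn's lemma downwards. The pointwise infimum of a chain stays convex because nearly
  minimal members at the two endpoints are comparable, so the smaller one serves at both;
  \<open>q\<close> keeps the infimum finite.\<close>

lemma minimal_dominating:
  assumes "\<phi>0 \<in> dominating"
  obtains \<phi> where "\<phi> \<in> dominating" "\<phi> \<le> \<phi>0" "\<And>f. f \<in> dominating \<Longrightarrow> f \<le> \<phi> \<Longrightarrow> f = \<phi>"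
proof -
  let ?A = "{\<phi> \<in> dominating. \<phi> \<le> \<phi>0}"
  let ?P = "\<lambda>f g :: real^'n \<Rightarrow> real. g \<le> f"
  have "\<exists>m\<in>?A. \<forall>a\<in>?A. ?P m a \<longrightarrow> a = m"
  proof (rule predicate_Zorn)
    show "partial_order_on ?A (relation_of ?P ?A)"
      by (rule partial_order_on_relation_ofI) auto
  next
    fix K assume K: "K \<in> Chains (relation_of ?P ?A)"
    then have KA: "K \<subseteq> ?A" and chain: "\<And>f g. f \<in> K \<Longrightarrow> g \<in> K \<Longrightarrow> f \<le> g \<or> g \<le> f"
      by (auto simp: Chains_def relation_of_def)
    show "\<exists>u\<in>?A. \<forall>a\<in>K. ?P a u"
    proof (cases "K = {}")
      case True
      then show ?thesis using assms by auto
    next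
      case False
      define u where "u x = (INF f\<in>K. f x)" for x
      have bdd: "bdd_below ((\<lambda>f. f x) ` K)" for x
        using KA by (intro bdd_belowI2[of _ "q x"]) (auto simp: dominating_def)
      have le: "u x \<le> f x" if "f \<in> K" for f x
        unfolding u_def by (rule cINF_lower[OF bdd that])
      have "convex_on UNIV u"
      proof (intro convex_onI)
        fix t :: real and x y :: "real^'n"
        assume t: "0 < t" "t < 1"
        show "u ((1 - t) *\<^sub>R x + t *\<^sub>R y) \<le> (1 - t) * u x + t * u y"
        proof (rule field_le_epsilon)
          fix e :: real assume "0 < e"
          have "\<exists>f\<in>K. f x < u x + e" for x
            using cINF_less_iff[OF False bdd[of x], of "u x + e"] \<open>0 < e\<close> by (simp add: u_def)
          then obtain f g where fg: "f \<in> K" "f x < u x + e" "g \<in> K" "g y < u y + e"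
            by blast
          define k where "k = (if f \<le> g then f else g)"
          have k: "k \<in> K" "k \<le> f" "k \<le> g" using fg chain[of f g] by (auto simp: k_def)
          have kc: "convex_on UNIV k" using KA k(1) by (auto simp: dominating_def)
          have "u ((1 - t) *\<^sub>R x + t *\<^sub>R y) \<le> k ((1 - t) *\<^sub>R x + t *\<^sub>R y)" by (rule le[OF k(1)])
          also have "\<dots> \<le> (1 - t) * k x + t * k y"
            using convex_onD[OF kc, of t x y] t by simp
          also have "\<dots> \<le> (1 - t) * (u x + e) + t * (u y + e)"
            using t k(2,3) fg(2,4) by (intro add_mono mult_left_mono) (auto simp: le_fun_def intro: order_trans less_imp_le)
          also have "\<dots> = (1 - t) * u x + t * u y + e" by (simp add: algebra_simps)
          finally show "u ((1 - t) *\<^sub>R x + t *\<^sub>R y) \<le> (1 - t) * u x + t * u y + e" .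
        qed
      qed auto
      moreover have "q x \<le> u x" for x
        unfolding u_def using False KA by (intro cINF_greatest) (auto simp: dominating_def)
      moreover have "u \<le> \<phi>0"
      proof -
        obtain f where "f \<in> K" using False by blast
        then have "f \<le> \<phi>0" "u \<le> f" using le[of f] KA by (auto simp: le_fun_def)
        then show ?thesis by (rule order_trans[rotated])
      qed
      ultimately have "u \<in> ?A" by (auto simp: dominating_def)
      then show ?thesis using le by (intro bexI[of _ u]) (simp_all add: le_fun_def)
    qed
  qed
  then obtain m where m: "m \<in> ?A" "\<forall>a\<in>?A. a \<le> m \<longrightarrow> a = m" by blast
  show thesis
  proof
    show "m \<in> dominating" "m \<le> \<phi>0" using m by auto
    show "f = m" if "f \<in> dominating" "f \<le> m" for f
    proof -
      have "f \<in> ?A" using m(1) that order_trans[OF that(2), of \<phi>0] by blast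
      then show ?thesis using m(2) that(2) by blast
    qed
  qed
qed

text \<open>Convexifying \<phi> together with the point (z, q z) stays above q, so minimality lets
  \<phi> drop to q z.\<close>

lemma minimal_touches:
  assumes \<phi>: "\<phi> \<in> dominating" and min: "\<And>f. f \<in> dominating \<Longrightarrow> f \<le> \<phi> \<Longrightarrow> f = \<phi>"
    and hz: "\<And>y. h z y \<le> \<phi> y"
  shows "\<phi> z = q z"
proof -
  have cv: "convex_on UNIV \<phi>" and ge: "\<And>x. q x \<le> \<phi> x" using \<phi> by (auto simp: dominating_def)
  \<comment> \<open>Height at \<open>w\<close> of the segment joining the added point over
    \<open>z\<close> to the graph of \<open>\<phi>\<close> over \<open>y\<close>, where
    \<open>w = (1 - s) *\<^sub>R z + s *\<^sub>R y\<close>. The infimum over \<open>s\<close> is the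
    convexification; \<open>s = 1\<close> returns \<open>\<phi> w\<close>.\<close>
  define F where "F w s = s * \<phi> (z + (1 / s) *\<^sub>R (w - z)) + (1 - s) * q z" for w s
  define I where "I = {s::real. 0 < s \<and> s \<le> 1}"
  define f where "f w = (INF s\<in>I. F w s)" for w
  have I1: "1 \<in> I" by (simp add: I_def)
  have Fq: "q w \<le> F w s" if s: "s \<in> I" for w s
  proof -
    define y where "y = z + (1 / s) *\<^sub>R (w - z)"
    have s01: "0 < s" "s \<le> 1" using s by (auto simp: I_def)
    have w: "w = (1 - s) *\<^sub>R z + s *\<^sub>R y" using s01 by (simp add: y_def algebra_simps)
    have "q w = (1 - s) * q z + s * q y - s * (1 - s) * q (y - z)"
      by (simp only: w q_convex_comb)
    \<comment> \<open>Two lower bounds for \<open>\<phi> y\<close> are mixed: the tangent bound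
      \<open>q y - q (y - z)\<close> with weight \<open>1 - s\<close> and \<open>q y\<close> with
      weight \<open>s\<close>.\<close>
    moreover have "s * (q y - (1 - s) * q (y - z)) \<le> s * \<phi> y"
    proof (rule mult_left_mono)
      have "q y - q (y - z) \<le> \<phi> y" using hz[of y] by (simp add: h_eq)
      moreover have "q y \<le> \<phi> y" by (rule ge)
      ultimately have "(1 - s) * (q y - q (y - z)) + s * q y \<le> (1 - s) * \<phi> y + s * \<phi> y"
        using s01 by (intro add_mono mult_left_mono) auto
      then show "q y - (1 - s) * q (y - z) \<le> \<phi> y" by (simp add: algebra_simps)
    qed (use s01 in auto)
    moreover have "F w s = s * \<phi> y + (1 - s) * q z" by (simp add: F_def y_def)
    moreover have "s * (q y - (1 - s) * q (y - z)) = s * q y - s * (1 - s) * q (y - z)"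
      by (simp add: algebra_simps)
    ultimately show ?thesis by linarith
  qed
  have bdd: "bdd_below (F w ` I)" for w
    using Fq by (intro bdd_belowI2[of _ "q w"]) auto
  have fF: "f w \<le> F w s" if "s \<in> I" for w s
    unfolding f_def by (rule cINF_lower[OF bdd that])
  have "convex_on UNIV f"
  proof (intro convex_onI)
    fix t :: real and x y :: "real^'n"
    assume t: "0 < t" "t < 1"
    show "f ((1 - t) *\<^sub>R x + t *\<^sub>R y) \<le> (1 - t) * f x + t * f y"
    proof (rule field_le_epsilon)
      fix e :: real assume "0 < e"
      have ne: "I \<noteq> {}" using I1 by auto
      have "\<exists>s\<in>I. F x s < f x + e" for x
        using cINF_less_iff[OF ne bdd[of x], of "f x + e"] \<open>0 < e\<close> by (simp add: f_def)
      then obtain a b where ab: "a \<in> I" "F x a < f x + e" "b \<in> I" "F y b < f y + e"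
        by blast
      define s where "s = (1 - t) * a + t * b"
      have a: "0 < a" "a \<le> 1" and b: "0 < b" "b \<le> 1" using ab by (auto simp: I_def)
      have s0: "0 < s" using a b t by (simp add: s_def add_pos_pos)
      have "s \<le> (1 - t) * 1 + t * 1" unfolding s_def
        using a b t by (intro add_mono mult_left_mono) auto
      then have s: "s \<in> I" using s0 by (simp add: I_def)
      let ?w = "(1 - t) *\<^sub>R x + t *\<^sub>R y"
      let ?u = "z + (1 / a) *\<^sub>R (x - z)" and ?v = "z + (1 / b) *\<^sub>R (y - z)"
      \<comment> \<open>The two chords have endpoints \<open>?u\<close> and \<open>?v\<close> with
        parameters \<open>a\<close> and \<open>b\<close>; this weight makes the mixture of the
        endpoints lie on the ray from \<open>z\<close> through \<open>?w\<close>.\<close>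
      define r where "r = t * b / s"
      have r: "0 \<le> r" "r \<le> 1" "1 - r = (1 - t) * a / s" using s0 a b t
        by (auto simp: r_def s_def field_simps)
      have eq: "z + (1 / s) *\<^sub>R (?w - z) = (1 - r) *\<^sub>R ?u + r *\<^sub>R ?v"
      proof -
        have "(1 - r) *\<^sub>R ?u + r *\<^sub>R ?v = z + ((1 - r) / a) *\<^sub>R (x - z) + (r / b) *\<^sub>R (y - z)"
          by (simp add: algebra_simps)
        also have "(1 - r) / a = (1 - t) / s" using r(3) a by simp
        also have "r / b = t / s" using b by (simp add: r_def)
        also have "z + ((1 - t) / s) *\<^sub>R (x - z) + (t / s) *\<^sub>R (y - z)
            = z + (1 / s) *\<^sub>R ((1 - t) *\<^sub>R (x - z) + t *\<^sub>R (y - z))"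
          by (simp add: scaleR_add_right)
        also have "(1 - t) *\<^sub>R (x - z) + t *\<^sub>R (y - z) = ?w - z" by (simp add: algebra_simps)
        finally show ?thesis by simp
      qed
      have "\<phi> (z + (1 / s) *\<^sub>R (?w - z)) \<le> (1 - r) * \<phi> ?u + r * \<phi> ?v"
        unfolding eq using convex_onD[OF cv, of r ?u ?v] r by simp
      then have "s * \<phi> (z + (1 / s) *\<^sub>R (?w - z)) \<le> s * ((1 - r) * \<phi> ?u + r * \<phi> ?v)"
        using s0 by simp
      also have "\<dots> = (s * (1 - r)) * \<phi> ?u + (s * r) * \<phi> ?v" by (simp add: algebra_simps)
      also have "s * (1 - r) = (1 - t) * a" using r(3) s0 by simp
      also have "s * r = t * b" using s0 by (simp add: r_def)
      finally have "F ?w s \<le> (1 - t) * F x a + t * F y b"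
        by (simp add: F_def s_def algebra_simps)
      also have "\<dots> \<le> (1 - t) * (f x + e) + t * (f y + e)"
        using ab t by (intro add_mono mult_left_mono) auto
      finally show "f ?w \<le> (1 - t) * f x + t * f y + e"
        using fF[OF s, of ?w] by (simp add: algebra_simps)
    qed
  qed auto
  moreover have "q w \<le> f w" for w
    unfolding f_def using I1 Fq by (intro cINF_greatest) auto
  ultimately have "f \<in> dominating" by (simp add: dominating_def)
  moreover have "f \<le> \<phi>"
  proof (rule le_funI)
    show "f w \<le> \<phi> w" for w using fF[OF I1, of w] by (simp add: F_def)
  qed
  ultimately have "f = \<phi>" by (rule min)
  moreover have "f z \<le> q z"
  proof (rule field_le_epsilon)
    fix e :: real assume e: "0 < e"
    \<comment> \<open>At \<open>w = z\<close> every segment has height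
      \<open>s * \<phi> z + (1 - s) * q z\<close>, which tends to \<open>q z\<close> as
      \<open>s\<close> tends to 0.\<close>
    define s where "s = min 1 (e / (\<phi> z - q z + 1))"
    have p: "\<phi> z - q z + 1 > 0" using ge[of z] by simp
    have s: "s \<in> I" using e p by (simp add: s_def I_def)
    have "s * (\<phi> z - q z) \<le> s * (\<phi> z - q z + 1)" using s by (simp add: I_def)
    also have "\<dots> \<le> e / (\<phi> z - q z + 1) * (\<phi> z - q z + 1)"
      using p by (intro mult_right_mono) (auto simp: s_def)
    also have "\<dots> = e" using p by simp
    finally have "F z s \<le> q z + e" by (simp add: F_def algebra_simps)
    then show "f z \<le> q z + e" using fF[OF s, of z] by simp
  qed
  ultimately show ?thesis using ge[of z] by simp
qed

text \<open>Compare \<open>q\<close> and \<open>\<phi>\<close> at a point of the segment from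
  \<open>z\<close> to \<open>y\<close>, a fraction \<open>t\<close> along it, and divide by
  \<open>t\<close>. As \<open>t\<close> tends to 0 the correction \<open>q (y - z)\<close> survives
  with coefficient 1, and \<open>q y - q (y - z)\<close> is the tangent at \<open>z\<close>.\<close>

lemma touching_supports:
  assumes \<phi>: "\<phi> \<in> dominating" and z: "\<phi> z = q z"
  shows "h z y \<le> \<phi> y"
proof -
  have cv: "convex_on UNIV \<phi>" and ge: "\<And>x. q x \<le> \<phi> x" using \<phi> by (auto simp: dominating_def)
  have "q y - q (y - z) - \<phi> y \<le> e" if e: "0 < e" for e :: real
  proof -
    define t where "t = min 1 (e / (\<bar>q (y - z)\<bar> + 1))"
    have t: "0 < t" "t \<le> 1" using e by (auto simp: t_def)
    have "q ((1 - t) *\<^sub>R z + t *\<^sub>R y) \<le> (1 - t) * \<phi> z + t * \<phi> y"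
      by (rule order_trans[OF ge]) (use convex_onD[OF cv, of t z y] t in simp)
    then have "(1 - t) * q z + t * q y - t * (1 - t) * q (y - z) \<le> (1 - t) * q z + t * \<phi> y"
      by (simp only: q_convex_comb z)
    then have "t * (q y - (1 - t) * q (y - z)) \<le> t * \<phi> y"
      by (simp add: algebra_simps)
    then have "q y - (1 - t) * q (y - z) \<le> \<phi> y" using t by simp
    moreover have "t * (- q (y - z)) \<le> e"
    proof -
      have "t * (- q (y - z)) \<le> t * (\<bar>q (y - z)\<bar> + 1)" using t by (intro mult_left_mono) auto
      also have "\<dots> \<le> e / (\<bar>q (y - z)\<bar> + 1) * (\<bar>q (y - z)\<bar> + 1)"
        by (intro mult_right_mono) (auto simp: t_def)
      also have "\<dots> = e" by (simp add: add_nonneg_pos less_imp_neq)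
      finally show ?thesis .
    qed
    ultimately show ?thesis by (simp add: algebra_simps)
  qed
  then have "q y - q (y - z) - \<phi> y \<le> 0" using field_le_epsilon[of _ 0] by force
  then show ?thesis by (simp add: h_eq)
qed

text \<open>This is what makes the contact set maximal. The added form \<open>A\<close> makes the
  minimisation coercive, and its symmetry under \<open>J\<close> makes the defect at the minimiser a
  nonnegative square: minimality of \<open>\<phi>\<close> bounds that defect from above by 0, so it
  vanishes and the minimiser is a contact point at which \<open>q (y - z)\<close> equals
  \<open>- A (y - z) / 2\<close>.\<close>

lemma minimal_contact_point:
  assumes \<phi>: "\<phi> \<in> dominating" and min: "\<And>f. f \<in> dominating \<Longrightarrow> f \<le> \<phi> \<Longrightarrow> f = \<phi>"
    and z: "\<phi> z \<noteq> q z"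
  obtains y where "\<phi> y = q y" "q (y - z) < 0"
proof -
  have cv: "convex_on UNIV \<phi>" and ge: "\<And>x. q x \<le> \<phi> x" using \<phi> by (auto simp: dominating_def)
  have cont: "continuous_on UNIV \<phi>" using cv by (simp add: convex_on_continuous)
  obtain J where J: "linear J" "\<And>x. J (J x) = x" "\<And>x y. B (J x) y = B x (J y)"
    "\<And>x. x \<noteq> 0 \<Longrightarrow> B (J x) x > 0" by (rule involution_exists) blast
  have contJ: "continuous_on UNIV J" using J(1) linear_continuous_on linear_conv_bounded_linear by blast
  have J0 [simp]: "J 0 = 0" by (rule linear_0[OF J(1)])
  define A where "A u = B (J u) u" for u
  have contA: "continuous_on UNIV A" unfolding A_def by (intro continuous_intros contJ)
  have Ascale: "A (c *\<^sub>R u) = c\<^sup>2 * A u" for c u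
    by (simp add: A_def linear_scale[OF J(1)] B_simps power2_eq_square)
  obtain a where a: "0 < a" "\<And>u. a * (norm u)\<^sup>2 \<le> A u"
  proof -
    have "compact (sphere 0 1 :: (real^'n) set)" by simp
    moreover have "sphere 0 1 \<noteq> ({} :: (real^'n) set)" by simp
    ultimately obtain u0 where u0: "u0 \<in> sphere 0 1" "\<And>u. u \<in> sphere 0 1 \<Longrightarrow> A u0 \<le> A u"
      using continuous_attains_inf[of "sphere 0 1" A] continuous_on_subset[OF contA] by blast
    show thesis
    proof
      show "0 < A u0" unfolding A_def using u0(1) J(4)[of u0] by force
      show "A u0 * (norm u)\<^sup>2 \<le> A u" for u
      proof (cases "u = 0")
        case True then show ?thesis by (simp add: A_def)
      next
        case False
        then have "A u0 \<le> A ((1 / norm u) *\<^sub>R u)" by (intro u0(2)) simp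
        then show ?thesis using False by (simp add: Ascale field_simps power2_eq_square)
      qed
    qed
  qed
  define \<theta> where "\<theta> y = \<phi> y - h z y + A (y - z) / 2" for y
  have contA': "continuous_on UNIV (\<lambda>y. A (y - z))"
    by (rule continuous_on_compose2[OF contA]) (auto intro!: continuous_intros)
  have cont\<theta>: "continuous_on UNIV \<theta>" unfolding \<theta>_def by (intro continuous_intros cont contA') auto
  obtain K where K: "\<And>y. \<phi> y \<ge> - K * (1 + norm y)" using convex_linear_growth[OF cv] by blast
  obtain y0 where y0: "\<And>y. \<theta> y0 \<le> \<theta> y"
  proof -
    define b where "b = \<bar>K\<bar> + C * norm z"
    define c where "c = \<bar>K\<bar> * (1 + norm z) + C * norm z * norm z - q z"
    have b0: "b \<ge> 0" using C_pos by (simp add: b_def)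
    have low: "\<theta> y \<ge> - b * norm (y - z) - c + a / 2 * (norm (y - z))\<^sup>2" for y
    proof -
      have ny: "norm y \<le> norm (y - z) + norm z" using norm_triangle_sub[of y z] by simp
      have "K * (1 + norm y) \<le> \<bar>K\<bar> * (1 + norm y)" by (intro mult_right_mono) auto
      also have "\<dots> \<le> \<bar>K\<bar> * (1 + (norm (y - z) + norm z))" using ny by (intro mult_left_mono) auto
      finally have "- (\<bar>K\<bar> * (1 + (norm (y - z) + norm z))) \<le> \<phi> y" using K[of y] by simp
      moreover have "B z y \<le> C * norm z * (norm (y - z) + norm z)"
        using B_bound[of z y] ny C_pos
        by (smt (verit) mult_left_mono mult_nonneg_nonneg norm_ge_zero)
      moreover have "a / 2 * (norm (y - z))\<^sup>2 \<le> A (y - z) / 2" using a(2)[of "y - z"] by simp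
      ultimately show ?thesis by (simp add: \<theta>_def h_def b_def c_def algebra_simps)
    qed
    \<comment> \<open>Beyond this radius the quadratic term \<open>a / 2\<close> beats the linear
      coefficient \<open>b\<close> and both constants; having \<open>r\<close> at least 1 lets the
      constants be absorbed into the linear term.\<close>
    define r where "r = 2 / a * (b + \<bar>c\<bar> + \<bar>\<theta> z\<bar>) + 1"
    have r: "r \<ge> 1" using a b0 by (simp add: r_def)
    have out: "\<theta> z \<le> \<theta> y" if "norm (y - z) \<ge> r" for y
    proof -
      let ?n = "norm (y - z)"
      have n1: "?n \<ge> 1" using that r by simp
      have "b + \<bar>c\<bar> + \<bar>\<theta> z\<bar> \<le> a / 2 * ?n"
      proof -
        have "2 / a * (b + \<bar>c\<bar> + \<bar>\<theta> z\<bar>) \<le> ?n" using that by (simp add: r_def)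
        then show ?thesis using a by (simp add: field_simps)
      qed
      then have "(b + \<bar>c\<bar> + \<bar>\<theta> z\<bar>) * ?n \<le> a / 2 * ?n * ?n" by (intro mult_right_mono) auto
      moreover have "(\<bar>c\<bar> + \<bar>\<theta> z\<bar>) * 1 \<le> (\<bar>c\<bar> + \<bar>\<theta> z\<bar>) * ?n" using n1 by (intro mult_left_mono) auto
      ultimately have "\<bar>c\<bar> + \<bar>\<theta> z\<bar> \<le> a / 2 * ?n\<^sup>2 - b * ?n"
        by (simp add: power2_eq_square algebra_simps)
      then show ?thesis using low[of y] by linarith
    qed
    have "compact (cball z r)" "cball z r \<noteq> {}" using r by auto
    then obtain y0 where y0: "y0 \<in> cball z r" "\<And>y. y \<in> cball z r \<Longrightarrow> \<theta> y0 \<le> \<theta> y"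
      using continuous_attains_inf[of "cball z r" \<theta>] continuous_on_subset[OF cont\<theta>] by blast
    show thesis
    proof
      show "\<theta> y0 \<le> \<theta> y" for y
      proof (cases "y \<in> cball z r")
        case False
        then have "\<theta> z \<le> \<theta> y" by (intro out) (simp add: dist_norm norm_minus_commute)
        moreover have "\<theta> y0 \<le> \<theta> z" using r by (intro y0(2)) simp
        ultimately show ?thesis by simp
      qed (rule y0(2))
    qed
  qed
  define u where "u = y0 - z"
  \<comment> \<open>First-order condition at the minimiser: \<open>h z\<close> has slope
    \<open>z\<close> and \<open>A (y - z) / 2\<close> has slope \<open>J u\<close>, both read
    through \<open>B\<close>, so \<open>p\<close> is a subgradient of \<open>\<phi>\<close> at
    \<open>y0\<close>.\<close>
  define p where "p = z - J u"
  have A_add: "A (u + v) = A u + A v + 2 * B (J u) v" for u v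
    by (simp add: A_def linear_add[OF J(1)] B_simps J(3) B_commute[of v "J u"] B_commute[of "J v" u])
  have sub: "\<phi> y0 + B p (y - y0) \<le> \<phi> y" for y
  proof -
    have "B p (y - y0) + \<phi> y0 - \<phi> y \<le> e" if e: "0 < e" for e :: real
    proof -
      define t where "t = min 1 (e / (\<bar>A (y - y0)\<bar> + 1))"
      have t: "0 < t" "t \<le> 1" using e by (auto simp: t_def)
      define yt where "yt = (1 - t) *\<^sub>R y0 + t *\<^sub>R y"
      have yz: "yt - z = u + t *\<^sub>R (y - y0)" by (simp add: u_def yt_def algebra_simps)
      have "\<theta> y0 \<le> \<theta> yt" by (rule y0)
      moreover have "\<phi> yt \<le> (1 - t) * \<phi> y0 + t * \<phi> y"
        unfolding yt_def using convex_onD[OF cv, of t y0 y] t by simp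
      moreover have "h z yt = (1 - t) * h z y0 + t * h z y" unfolding yt_def by (rule h_affine)
      moreover have "A (yt - z) = A u + t\<^sup>2 * A (y - y0) + (t * B (J u) (y - y0) + t * B (J u) (y - y0))"
        by (simp only: yz A_add Ascale B_scaleR_right mult_2)
      moreover have "t * ((\<phi> y - h z y) + (t * A (y - y0) / 2 + B (J u) (y - y0))) - t * (\<phi> y0 - h z y0)
        = ((1 - t) * \<phi> y0 + t * \<phi> y) - ((1 - t) * h z y0 + t * h z y)
          + (A u + t\<^sup>2 * A (y - y0) + (t * B (J u) (y - y0) + t * B (J u) (y - y0))) / 2
          - (\<phi> y0 - h z y0 + A u / 2)"
        by (simp add: field_simps power2_eq_square)
      moreover have "\<theta> y0 = \<phi> y0 - h z y0 + A u / 2" by (simp add: \<theta>_def u_def)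
      ultimately have "t * (\<phi> y0 - h z y0) \<le> t * ((\<phi> y - h z y) + (t * A (y - y0) / 2 + B (J u) (y - y0)))"
        by (simp only: \<theta>_def)
      then have "\<phi> y0 - h z y0 \<le> (\<phi> y - h z y) + (t * A (y - y0) / 2 + B (J u) (y - y0))"
        using t by (simp only: mult_le_cancel_left_pos)
      moreover have "t * A (y - y0) / 2 \<le> e"
      proof -
        have "t * A (y - y0) \<le> t * (\<bar>A (y - y0)\<bar> + 1)" using t by (intro mult_left_mono) auto
        also have "\<dots> \<le> e / (\<bar>A (y - y0)\<bar> + 1) * (\<bar>A (y - y0)\<bar> + 1)"
          by (intro mult_right_mono) (auto simp: t_def)
        also have "\<dots> = e" by (simp add: add_nonneg_pos less_imp_neq)
        finally show ?thesis using e by simp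
      qed
      ultimately show ?thesis by (simp add: h_def p_def B_simps)
    qed
    then have "B p (y - y0) + \<phi> y0 - \<phi> y \<le> 0" using field_le_epsilon[of _ 0] by force
    then show ?thesis by simp
  qed
  \<comment> \<open>If the supporting affine function at \<open>y0\<close> lay strictly above the
    tangent \<open>h p\<close>, then \<open>h p\<close> would lie below \<open>\<phi>\<close>;
    minimality would force contact at \<open>p\<close>, and the support inequality at
    \<open>p\<close> would contradict the assumption.\<close>
  have "B p y0 - \<phi> y0 \<ge> q p"
  proof (rule ccontr)
    assume c: "\<not> ?thesis"
    have "h p y \<le> \<phi> y" for y using sub[of y] c by (simp add: h_def B_simps)
    then have "\<phi> p = q p" using minimal_touches[OF \<phi> min, of p] by blast
    then show False using sub[of p] c by (simp add: B_simps q_def)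
  qed
  moreover have qp: "q (y0 - p) = q y0 + q p - B p y0" by (simp add: q_diff B_commute[of y0 p])
  \<comment> \<open>Since \<open>y0 - p = u + J u\<close> and \<open>J\<close> preserves
    \<open>q\<close>, this defect equals half of \<open>A (u + J u)\<close>, hence is nonnegative;
    the previous inequality says that \<open>\<phi> y0\<close> plus the defect is at most
    \<open>q y0\<close>.\<close>
  moreover have "q (y0 - p) = B u u + B (J u) u"
  proof -
    have "y0 - p = u + J u" by (simp add: p_def u_def)
    moreover have "q (J u) = q u" by (simp add: q_def J(2,3))
    ultimately show ?thesis by (simp only: q_add) (simp add: q_def B_commute[of u "J u"])
  qed
  moreover have "A (u + J u) \<ge> 0"
    using J(4)[of "u + J u"] by (cases "u + J u = 0") (auto simp: A_def simp del: add_eq_0_iff)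
  moreover have "A (u + J u) = 2 * (B u u + B (J u) u)"
    using J(3)[of u "J u"] by (simp add: A_def linear_add[OF J(1)] J(2) B_simps B_commute[of u "J u"])
  ultimately have le: "\<phi> y0 + (B u u + B (J u) u) \<le> q y0" and nn: "B u u + B (J u) u \<ge> 0"
    by simp_all
  have eq: "\<phi> y0 = q y0" "B u u = - A u" using ge[of y0] le nn by (auto simp: A_def)
  show thesis
  proof
    show "\<phi> y0 = q y0" by (rule eq)
    have "u \<noteq> 0" using z eq(1) by (auto simp: u_def)
    then show "q (y0 - z) < 0" using eq(2) J(4)[of u] by (simp add: q_def u_def[symmetric] A_def)
  qed
qed

lemma psi_eq: "psi S G y = (SUP x\<in>G. ereal (h x y))"
  by (simp add: psi_def h_def q_def)

text \<open>\<open>H\<close> is the contact set of a minimal convex function below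
  \<open>\<phi>\<close>. Tangents at contact points lie below that function, which gives both the
  monotonicity of \<open>H\<close> and the bound for \<open>psi\<close>.\<close>

theorem maximal_monotone_below:
  assumes "convex_on UNIV \<phi>" "\<And>x. q x \<le> \<phi> x"
  obtains H where "H \<in> max_S_monotone S" "\<And>y. psi S H y \<le> ereal (\<phi> y)"
proof -
  have "\<phi> \<in> dominating" using assms by (simp add: dominating_def)
  then obtain f where f: "f \<in> dominating" "f \<le> \<phi>" "\<And>g. g \<in> dominating \<Longrightarrow> g \<le> f \<Longrightarrow> g = f"
    using minimal_dominating by blast
  define H where "H = {x. f x = q x}"
  have mono: "q (x - y) \<ge> 0" if "x \<in> H" "y \<in> H" for x y
    using touching_supports[OF f(1), of y x] that by (simp add: H_def h_eq)
  show thesis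
  proof
    show "H \<in> max_S_monotone S" unfolding max_S_monotone_def
    proof (intro CollectI conjI notI)
      show "S_monotone S H" using mono by (simp add: S_monotone_def q_def)
      assume "\<exists>K. H \<subset> K \<and> S_monotone S K"
      then obtain K z where K: "H \<subset> K" "S_monotone S K" "z \<in> K" "z \<notin> H" by blast
      then obtain y where "y \<in> H" "q (y - z) < 0"
        using minimal_contact_point[OF f(1,3), of z] by (auto simp: H_def)
      then show False using K by (force simp: S_monotone_def q_def)
    qed
    show "psi S H y \<le> ereal (\<phi> y)" for y
      unfolding psi_eq using touching_supports[OF f(1)] f(2)
      by (intro SUP_least) (auto simp: H_def le_fun_def intro: order_trans)
  qed
qed

subsection \<open>Maximal monotone sets and their argmax maps\<close>

lemma max_S_monotone_mono:
  assumes "G \<in> max_S_monotone S" "x \<in> G" "y \<in> G"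
  shows "0 \<le> q (x - y)"
  using assms by (auto simp: max_S_monotone_def S_monotone_def q_def)

lemma max_S_monotone_memI:
  assumes G: "G \<in> max_S_monotone S" and x: "\<And>y. y \<in> G \<Longrightarrow> 0 \<le> q (x - y)"
  shows "x \<in> G"
proof (rule ccontr)
  assume "x \<notin> G"
  have "S_monotone S (insert x G)" unfolding S_monotone_def
  proof (intro ballI)
    fix a b assume ab: "a \<in> insert x G" "b \<in> insert x G"
    have "0 \<le> q (a - b)"
      using ab x[of a] x[of b] max_S_monotone_mono[OF G, of a b] q_minus_commute[of a b] by (elim insertE) auto
    then show "0 \<le> B (a - b) (a - b)" by (simp add: q_def)
  qed
  then show False using G \<open>x \<notin> G\<close> by (auto simp: max_S_monotone_def)
qed

text \<open>Through \<open>h_eq\<close> this says that the supremum of the tangents over G is at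
  least \<open>q\<close> at every point, not only on G.\<close>

lemma max_S_monotone_nonpos:
  assumes G: "G \<in> max_S_monotone S"
  obtains z where "z \<in> G" "q (x - z) \<le> 0"
proof (cases "x \<in> G")
  case True
  then show ?thesis by (intro that[of x]) auto
next
  case False
  then obtain z where "z \<in> G" "q (x - z) < 0"
    using max_S_monotone_memI[OF G, of x] by force
  then show ?thesis by (intro that) auto
qed

lemma max_S_monotone_closed:
  assumes G: "G \<in> max_S_monotone S"
  shows "closed G"
proof -
  have "G = (\<Inter>y\<in>G. {x. 0 \<le> q (x - y)})"
    using max_S_monotone_mono[OF G] max_S_monotone_memI[OF G] by auto
  moreover have "closed (\<Inter>y\<in>G. {x. 0 \<le> q (x - y)})"
    by (intro closed_INT ballI closed_Collect_le continuous_intros)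
  ultimately show ?thesis by simp
qed

lemma max_S_monotone_nonempty: "G \<in> max_S_monotone S \<Longrightarrow> G \<noteq> {}"
  using max_S_monotone_nonpos by blast

section \<open>Near maximisers and measurability of the sets hit by the argmax map\<close>

definition approx :: "(real^'n) set \<Rightarrow> real \<Rightarrow> real^'n \<Rightarrow> real^'n \<Rightarrow> bool" where
  "approx G s z y \<longleftrightarrow> z \<in> G \<and> (\<forall>x\<in>G. h x y \<le> h z y + s)"

lemma PG_approx: "z \<in> PG S G y \<longleftrightarrow> approx G 0 z y"
  by (auto simp: PG_def approx_def h_def q_def)

lemma approx_mono: "approx G s z y \<Longrightarrow> s \<le> t \<Longrightarrow> approx G t z y"
  by (force simp: approx_def)

lemma PG_subset: "PG S G y \<subseteq> G"
  by (auto simp: PG_def)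

lemma approx_closed2:
  fixes f g :: "'b::topological_space \<Rightarrow> real^'n"
  assumes "closed G" and that: "continuous_on UNIV f" "continuous_on UNIV g"
  shows "closed {p. approx G s (f p) (g p)}"
proof -
  have "{p. approx G s (f p) (g p)} = f -` G \<inter> (\<Inter>x\<in>G. {p. h x (g p) \<le> h (f p) (g p) + s})"
    by (auto simp: approx_def)
  moreover have "closed \<dots>"
    using that by (intro closed_Int closed_vimage assms closed_INT ballI closed_Collect_le continuous_intros)
  ultimately show ?thesis by simp
qed

lemma PG_closed: "closed G \<Longrightarrow> closed (PG S G y)"
  using approx_closed2[of G "\<lambda>z. z" "\<lambda>_. y" 0] by (simp add: PG_approx[symmetric])

text \<open>Pairs serve two purposes: on a diagonal they express that a near maximiser lies in a
  given set, and off it that two near maximisers have a prescribed relation, such as the one that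
  defines \<open>Sigma1\<close>.\<close>

definition hits2 :: "(real^'n) set \<Rightarrow> ((real^'n) \<times> (real^'n)) set \<Rightarrow> real \<Rightarrow> (real^'n) set" where
  "hits2 G K s = {y. \<exists>p\<in>K. approx G s (fst p) y \<and> approx G s (snd p) y}"

lemma hits2_closed:
  assumes "closed G" "compact K"
  shows "closed (hits2 G K s)"
proof -
  have "closed {p :: ((real^'n) \<times> (real^'n)) \<times> (real^'n). approx G s (fst (fst p)) (snd p) \<and> approx G s (snd (fst p)) (snd p)}"
    unfolding Collect_conj_eq by (intro closed_Int approx_closed2 assms continuous_intros)
  then have "closed {y. \<exists>x. x \<in> K \<and> (x, y) \<in> {p. approx G s (fst (fst p)) (snd p) \<and> approx G s (snd (fst p)) (snd p)}}"
    by (rule closed_compact_projection[OF assms(2)])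
  then show ?thesis by (simp add: hits2_def Bex_def)
qed

lemma hits2_mono: "s \<le> t \<Longrightarrow> hits2 G K s \<subseteq> hits2 G K t"
  by (force simp: hits2_def intro: approx_mono)

text \<open>The witnesses for slack 1/(n+1) form nested nonempty compact sets, so one pair witnesses
  all of them and hence slack 0.\<close>

lemma hits2_Inter:
  assumes "closed G" "compact K"
  shows "(\<Inter>n. hits2 G K (1 / real (Suc n))) = hits2 G K 0"
proof
  show "hits2 G K 0 \<subseteq> (\<Inter>n. hits2 G K (1 / real (Suc n)))" using hits2_mono by (intro INT_greatest) simp
  show "(\<Inter>n. hits2 G K (1 / real (Suc n))) \<subseteq> hits2 G K 0"
  proof
    fix y assume y: "y \<in> (\<Inter>n. hits2 G K (1 / real (Suc n)))"
    define F where "F n = {p\<in>K. approx G (1 / real (Suc n)) (fst p) y \<and> approx G (1 / real (Suc n)) (snd p) y}" for n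
    have "compact (F n)" for n
    proof -
      have "F n = K \<inter> ({p. approx G (1 / real (Suc n)) (fst p) y} \<inter> {p. approx G (1 / real (Suc n)) (snd p) y})"
        by (auto simp: F_def)
      also have "compact \<dots>"
        by (intro compact_Int_closed assms closed_Int approx_closed2 continuous_intros)
      finally show ?thesis .
    qed
    moreover have "F n \<noteq> {}" for n using y unfolding F_def hits2_def by blast
    moreover have "F n \<subseteq> F m" if "m \<le> n" for m n
    proof -
      have "1 / real (Suc n) \<le> 1 / real (Suc m)" using that by (simp add: frac_le)
      then show ?thesis unfolding F_def using approx_mono by blast
    qed
    ultimately have "\<Inter>(range F) \<noteq> {}" by (intro compact_nest) auto
    then obtain p where p: "\<And>n. p \<in> F n" by auto
    have lim: "h x y \<le> h z y + 0" if "\<And>n. h x y \<le> h z y + 1 / real (Suc n)" for x z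
    proof (rule field_le_epsilon)
      fix e :: real assume "0 < e"
      then obtain n where "1 / real (Suc n) < e" using nat_approx_posE by blast
      then show "h x y \<le> h z y + 0 + e" using that[of n] by simp
    qed
    have "p \<in> K" using p by (auto simp: F_def)
    moreover have "approx G 0 (fst p) y" using p lim unfolding F_def approx_def by blast
    moreover have "approx G 0 (snd p) y" using p lim unfolding F_def approx_def by blast
    ultimately show "y \<in> hits2 G K 0" by (auto simp: hits2_def)
  qed
qed

lemma hits_closed:
  assumes "closed G" "compact K"
  shows "closed {y. PG S G y \<inter> K \<noteq> {}}"
proof -
  have "compact ((\<lambda>z. (z, z)) ` K)"
    by (intro compact_continuous_image assms continuous_intros)
  moreover have "{y. PG S G y \<inter> K \<noteq> {}} = hits2 G ((\<lambda>z. (z, z)) ` K) 0"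
    by (auto simp: hits2_def PG_approx)
  ultimately show ?thesis using hits2_closed[OF assms(1)] by simp
qed

lemma hits_open_Union:
  assumes "open U"
  obtains K :: "nat \<Rightarrow> (real^'n) set" where "\<And>n. compact (K n)" "\<And>n. K n \<subseteq> U"
    "{y. PG S G y \<inter> U \<noteq> {}} = (\<Union>n. {y. PG S G y \<inter> K n \<noteq> {}})"
proof (rule open_Union_compact_subsets[OF assms])
  fix K :: "nat \<Rightarrow> (real^'n) set"
  assume K: "\<And>n. compact (K n)" "\<And>n. K n \<subseteq> U" and U: "\<Union>(range K) = U"
  have "{y. PG S G y \<inter> U \<noteq> {}} = (\<Union>n. {y. PG S G y \<inter> K n \<noteq> {}})"
    unfolding U[symmetric] by auto
  then show thesis by (rule that[OF K])
qed

lemma space_sigma_PG [simp]: "space (sigma_PG S G) = UNIV"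
  by (simp add: sigma_PG_def)

lemma sets_sigma_PG: "sets (sigma_PG S G) = sigma_sets UNIV {{y. PG S G y \<inter> U \<noteq> {}} | U. open U}"
  by (simp add: sigma_PG_def)

lemma hit_in_sigma_PG: "open U \<Longrightarrow> {y. PG S G y \<inter> U \<noteq> {}} \<in> sets (sigma_PG S G)"
  unfolding sets_sigma_PG by (intro sigma_sets.Basic) auto

lemma sigma_PG_subset_borel:
  assumes "closed G"
  shows "sets (sigma_PG S G) \<subseteq> sets borel"
proof -
  have "{y. PG S G y \<inter> U \<noteq> {}} \<in> sets borel" if U: "open U" for U
  proof -
    obtain K :: "nat \<Rightarrow> (real^'n) set" where K: "\<And>n. compact (K n)"
      "{y. PG S G y \<inter> U \<noteq> {}} = (\<Union>n. {y. PG S G y \<inter> K n \<noteq> {}})"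
      by (rule hits_open_Union[OF U, of G]) blast
    show ?thesis unfolding K(2) using hits_closed[OF assms K(1)] by (intro sets.countable_UN) auto
  qed
  then show ?thesis unfolding sets_sigma_PG
    using sets.sigma_sets_subset[of "{{y. PG S G y \<inter> U \<noteq> {}} | U. open U}" "borel :: (real^'n) measure"] by auto
qed

lemma sigma_PG_saturated:
  assumes "A \<in> sets (sigma_PG S G)" "PG S G y = PG S G z"
  shows "y \<in> A \<longleftrightarrow> z \<in> A"
  using assms(1) unfolding sets_sigma_PG
  by (induction rule: sigma_sets.induct) (use assms(2) in auto)

lemma Sigma1_iff:
  "y \<in> Sigma1 S G \<longleftrightarrow> (\<exists>a\<in>PG S G y. \<exists>b\<in>PG S G y. 0 < q (a - b))"
proof -
  have "y \<in> Sigma_sing S G" if "a \<in> PG S G y" "b \<in> PG S G y" "0 < q (a - b)" for a b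
  proof -
    have "a \<noteq> b" using that(3) by auto
    then show ?thesis using that by (auto simp: Sigma_sing_def)
  qed
  then show ?thesis unfolding Sigma1_def by (auto simp: q_def)
qed

lemma PG_isotropic:
  assumes G: "G \<in> max_S_monotone S" and "y \<notin> Sigma1 S G" "a \<in> PG S G y" "b \<in> PG S G y"
  shows "q (a - b) = 0"
  using assms max_S_monotone_mono[OF G, of a b] PG_subset[of G y] by (force simp: Sigma1_iff)

text \<open>Along an isotropic segment \<open>q (c - z)\<close> is affine in \<open>c\<close>, as
  the correction term of \<open>q_convex_comb\<close> vanishes. Monotone relation to G and the value
  at \<open>y\<close> therefore both pass from the endpoints to the segment; the former gives
  membership by maximality.\<close>

lemma PG_convex:
  assumes G: "G \<in> max_S_monotone S" and y: "y \<notin> Sigma1 S G"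
  shows "convex (PG S G y)"
  unfolding convex_alt
proof (intro ballI allI impI)
  fix a b and t :: real
  assume ab: "a \<in> PG S G y" "b \<in> PG S G y" and t: "0 \<le> t \<and> t \<le> 1"
  let ?c = "(1 - t) *\<^sub>R a + t *\<^sub>R b"
  have iso: "q (b - a) = 0" by (rule PG_isotropic[OF G y ab(2,1)])
  have aG: "a \<in> G" "b \<in> G" using ab PG_subset by auto
  have qc: "q (?c - z) = (1 - t) * q (a - z) + t * q (b - z)" for z
  proof -
    have "?c - z = (1 - t) *\<^sub>R (a - z) + t *\<^sub>R (b - z)" by (simp add: algebra_simps)
    then show ?thesis using q_convex_comb[of t "a - z" "b - z"] iso by simp
  qed
  have "?c \<in> G"
    using qc t max_S_monotone_mono[OF G] aG by (intro max_S_monotone_memI[OF G]) auto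
  moreover have "h x y \<le> h ?c y" if "x \<in> G" for x
  proof -
    have "h x y \<le> h a y" "h x y \<le> h b y" using ab that by (auto simp: PG_approx approx_def)
    then have "(1 - t) * h x y + t * h x y \<le> (1 - t) * h a y + t * h b y"
      using t by (intro add_mono mult_left_mono) auto
    moreover have "h ?c y = (1 - t) * h a y + t * h b y"
    proof -
      have e: "h z y = q y - q (z - y)" for z using q_minus_commute[of y z] by (simp add: h_eq)
      show ?thesis by (simp only: e qc) (simp add: algebra_simps)
    qed
    ultimately show ?thesis by (simp add: algebra_simps)
  qed
  ultimately show "?c \<in> PG S G y" by (auto simp: PG_approx approx_def)
qed

text \<open>Each point off G is strictly non-monotone against some point of G. Compactness of the
  set of bounded points at distance at least \<open>\<delta>\<close> makes the violation
  uniform.\<close>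

lemma far_from_G:
  assumes G: "G \<in> max_S_monotone S" and \<delta>: "0 < \<delta>"
  obtains c where "0 < c" "\<And>x. norm x \<le> R \<Longrightarrow> \<delta> \<le> infdist x G \<Longrightarrow> \<exists>z\<in>G. q (x - z) \<le> - c"
proof -
  let ?K = "cball 0 R \<inter> {x. \<delta> \<le> infdist x G}"
  let ?U = "\<lambda>p. {x. q (x - fst p) < - snd p}"
  have ne: "G \<noteq> {}" by (rule max_S_monotone_nonempty[OF G])
  have K: "compact ?K"
    by (intro compact_Int_closed compact_cball closed_Collect_le continuous_intros)
  have op: "open (?U p)" for p :: "(real^'n) \<times> real" by (intro open_Collect_less continuous_intros)
  have cov: "?K \<subseteq> (\<Union>p\<in>G \<times> {0<..}. ?U p)"
  proof
    fix x assume x: "x \<in> ?K"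
    have "x \<notin> G" using x \<delta> by auto
    then obtain z where z: "z \<in> G" "q (x - z) < 0"
      using max_S_monotone_memI[OF G, of x] by force
    \<comment> \<open>Half of the violation at \<open>x\<close> is recorded, so that the strict
      inequality still holds on a neighbourhood of \<open>x\<close>.\<close>
    then have "x \<in> ?U (z, - q (x - z) / 2)" by simp
    then show "x \<in> (\<Union>p\<in>G \<times> {0<..}. ?U p)" using z by (intro UN_I[of "(z, - q (x - z) / 2)"]) auto
  qed
  obtain P where P: "P \<subseteq> G \<times> {0<..}" "finite P" "?K \<subseteq> (\<Union>p\<in>P. ?U p)"
    by (rule compactE_image[OF K _ cov]) (use op in auto)
  define c where "c = Min (insert 1 (snd ` P))"
  show thesis
  proof
    show "0 < c" unfolding c_def using P(1,2) by (subst Min_gr_iff) auto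
    show "\<exists>z\<in>G. q (x - z) \<le> - c" if "norm x \<le> R" "\<delta> \<le> infdist x G" for x
    proof -
      have "x \<in> ?K" using that by simp
      then obtain p where p: "p \<in> P" "q (x - fst p) < - snd p" using P(3) by blast
      then have "c \<le> snd p" unfolding c_def using P(2) by (intro Min_le) auto
      then show ?thesis using p P(1) by (intro bexI[of _ "fst p"]) auto
    qed
  qed
qed

lemma sigma_PG_measurable_saturated:
  fixes \<xi> :: "real^'n \<Rightarrow> real"
  assumes \<xi>: "\<xi> \<in> borel_measurable (sigma_PG S G)" and eq: "PG S G y = PG S G z"
  shows "\<xi> y = \<xi> z"
proof -
  have "\<xi> -` {\<xi> y} \<inter> space (sigma_PG S G) \<in> sets (sigma_PG S G)"
    by (rule measurable_sets[OF \<xi>]) simp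
  then have "y \<in> \<xi> -` {\<xi> y} \<inter> space (sigma_PG S G) \<longleftrightarrow> z \<in> \<xi> -` {\<xi> y} \<inter> space (sigma_PG S G)"
    by (rule sigma_PG_saturated[OF _ eq])
  then show ?thesis by simp
qed

lemma psi_meas [measurable]: "psi S G \<in> borel_measurable borel"
proof (rule borel_measurableI_greater)
  fix a
  have "{y. a < psi S G y} = (\<Union>x\<in>G. {y. a < ereal (h x y)})"
    by (auto simp: psi_eq less_SUP_iff)
  moreover have "open (\<Union>x\<in>G. {y. a < ereal (h x y)})"
    by (intro open_UN ballI open_Collect_less continuous_intros)
  ultimately show "{y\<in>space borel. a < psi S G y} \<in> sets borel" by simp
qed

lemma psi_ge: "x \<in> G \<Longrightarrow> ereal (h x y) \<le> psi S G y"
  unfolding psi_eq by (rule SUP_upper)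

lemma psi_real:
  assumes "psi S G y \<noteq> \<infinity>" "G \<noteq> {}"
  shows "psi S G y = ereal (real_of_ereal (psi S G y))"
proof -
  obtain x where "x \<in> G" using assms(2) by blast
  then have "psi S G y \<noteq> - \<infinity>" using psi_ge[of x G y] by auto
  then show ?thesis using assms(1) by (cases "psi S G y") auto
qed

end

subsection \<open>Nearly optimal finite martingale decompositions\<close>

locale transport = S_space S + prob_space M for S :: "real^'n^'n" and M :: "'a measure" +
  fixes Y :: "'a \<Rightarrow> real^'n"
  assumes L2_Y: "L2 M Y"
begin

lemma Y_meas [measurable]: "Y \<in> borel_measurable M"
  and Y_sq: "integrable M (\<lambda>\<omega>. (norm (Y \<omega>))\<^sup>2)"
  using L2_Y by (auto simp: L2_def)

lemma Y_int: "integrable M Y" and Y_norm: "integrable M (\<lambda>\<omega>. norm (Y \<omega>))"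
  using L2_integrable(1)[OF L2_Y] by (auto intro: integrable_norm)

lemma h_int: "integrable M (\<lambda>\<omega>. h z (Y \<omega>))"
  unfolding h_inner
  by (intro Bochner_Integration.integrable_diff integrable_const integrable_inner_right Y_int)

text \<open>A weight family is the conditional law given \<omega> of a random label i < N; it replaces an
  enlargement of the probability space.\<close>

definition weights :: "nat \<Rightarrow> (nat \<Rightarrow> 'a \<Rightarrow> real) set" where
  "weights N = {w. (\<forall>i<N. w i \<in> borel_measurable M \<and> (\<forall>\<omega>. 0 \<le> w i \<omega>)) \<and> (\<forall>\<omega>. (\<Sum>i<N. w i \<omega>) = 1)}"

lemma weightsD:
  assumes "w \<in> weights N" "i < N"
  shows "w i \<in> borel_measurable M" "0 \<le> w i \<omega>" "w i \<omega> \<le> 1"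
proof -
  show "w i \<in> borel_measurable M" "0 \<le> w i \<omega>" using assms by (auto simp: weights_def)
  have "w i \<omega> \<le> (\<Sum>i<N. w i \<omega>)" using assms by (intro member_le_sum) (auto simp: weights_def)
  then show "w i \<omega> \<le> 1" using assms by (simp add: weights_def)
qed

lemma weights_sum: "w \<in> weights N \<Longrightarrow> (\<Sum>i<N. w i \<omega>) = 1"
  by (simp add: weights_def)

lemma weights_int:
  fixes f :: "'a \<Rightarrow> 'b::{banach, second_countable_topology}"
  assumes w: "w \<in> weights N" "i < N" and f: "integrable M f"
  shows "integrable M (\<lambda>\<omega>. w i \<omega> *\<^sub>R f \<omega>)"
proof (rule Bochner_Integration.integrable_bound[OF f])
  have [measurable]: "w i \<in> borel_measurable M" "f \<in> borel_measurable M"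
    using weightsD(1)[OF w] f by auto
  show "(\<lambda>\<omega>. w i \<omega> *\<^sub>R f \<omega>) \<in> borel_measurable M" by measurable
  show "AE \<omega> in M. norm (w i \<omega> *\<^sub>R f \<omega>) \<le> norm (f \<omega>)"
    using weightsD(2,3)[OF w] by (intro AE_I2) (auto intro: mult_left_le_one_le)
qed

lemmas weights_int_real = weights_int[where 'b = real, simplified]

definition mass :: "(nat \<Rightarrow> 'a \<Rightarrow> real) \<Rightarrow> nat \<Rightarrow> real" where
  "mass w i = (\<integral>\<omega>. w i \<omega> \<partial>M)"

definition moment :: "(nat \<Rightarrow> 'a \<Rightarrow> real) \<Rightarrow> nat \<Rightarrow> real^'n" where
  "moment w i = (\<integral>\<omega>. w i \<omega> *\<^sub>R Y \<omega> \<partial>M)"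

lemma weights_integrable: "w \<in> weights N \<Longrightarrow> i < N \<Longrightarrow> integrable M (w i)"
  using weights_int_real[of w N i "\<lambda>_. 1"] by simp

lemma mass_nonneg: "w \<in> weights N \<Longrightarrow> i < N \<Longrightarrow> 0 \<le> mass w i"
  unfolding mass_def by (intro Bochner_Integration.integral_nonneg) (auto dest: weightsD)

lemma weights_sum_integral:
  assumes w: "w \<in> weights N" and f: "integrable M f"
  shows "(\<Sum>i<N. \<integral>\<omega>. w i \<omega> * f \<omega> \<partial>M) = (\<integral>\<omega>. f \<omega> \<partial>M)"
proof -
  have "(\<Sum>i<N. \<integral>\<omega>. w i \<omega> * f \<omega> \<partial>M) = (\<integral>\<omega>. (\<Sum>i<N. w i \<omega> * f \<omega>) \<partial>M)"
    using weights_int_real[OF w _ f] by (subst Bochner_Integration.integral_sum) auto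
  also have "\<dots> = (\<integral>\<omega>. f \<omega> \<partial>M)"
    by (simp add: sum_distrib_right[symmetric] weights_sum[OF w])
  finally show ?thesis .
qed

lemma mass_sum: "w \<in> weights N \<Longrightarrow> (\<Sum>i<N. mass w i) = 1"
  using weights_sum_integral[of w N "\<lambda>_. 1"] by (simp add: mass_def prob_space)

lemma mass_le_1: "w \<in> weights N \<Longrightarrow> i < N \<Longrightarrow> mass w i \<le> 1"
  using mass_sum[of w N] member_le_sum[of i "{..<N}" "mass w"] mass_nonneg[of w N] by auto

lemma norm_moment:
  assumes w: "w \<in> weights N" "i < N"
  shows "norm (moment w i) \<le> (\<integral>\<omega>. w i \<omega> * norm (Y \<omega>) \<partial>M)"
  unfolding moment_def
  by (rule order_trans[OF integral_norm_bound]) (use weightsD(2)[OF w] in simp)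

text \<open>The label is the least index attaining the maximum, which makes the choice measurable;
  the weights are the corresponding indicators.\<close>

lemma argmax_weights:
  assumes N: "0 < N" and a[measurable]: "\<And>i. i < N \<Longrightarrow> a i \<in> borel_measurable M"
  obtains w where "w \<in> weights N" "\<And>\<omega> j. j < N \<Longrightarrow> a j \<omega> \<le> (\<Sum>i<N. w i \<omega> * a i \<omega>)"
proof -
  define P where "P i \<omega> \<longleftrightarrow> i < N \<and> (\<forall>j\<in>{..<N}. a j \<omega> \<le> a i \<omega>)" for i \<omega>
  define k where "k \<omega> = (LEAST i. P i \<omega>)" for \<omega>
  have ex: "\<exists>i. P i \<omega>" for \<omega>
  proof -
    have "Max ((\<lambda>i. a i \<omega>) ` {..<N}) \<in> (\<lambda>i. a i \<omega>) ` {..<N}" using N by (intro Max_in) auto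
    then obtain i where "i < N" "Max ((\<lambda>i. a i \<omega>) ` {..<N}) = a i \<omega>" by auto
    then have "P i \<omega>" unfolding P_def by (metis Max_ge finite_imageI finite_lessThan imageI)
    then show ?thesis ..
  qed
  have Pk: "P (k \<omega>) \<omega>" for \<omega> unfolding k_def using ex by (metis LeastI)
  have [measurable]: "Measurable.pred M (P i)" for i
    unfolding P_def by (cases "i < N") (simp_all, measurable)
  have [measurable]: "k \<in> M \<rightarrow>\<^sub>M count_space UNIV" unfolding k_def by measurable
  define w where "w i \<omega> = (if k \<omega> = i then 1 else 0 :: real)" for i \<omega>
  have kN: "k \<omega> < N" for \<omega> using Pk by (simp add: P_def)
  show thesis
  proof
    show "w \<in> weights N" unfolding weights_def
    proof (intro CollectI conjI allI impI)
      show "w i \<in> borel_measurable M" for i unfolding w_def by measurable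
      show "0 \<le> w i \<omega>" for i \<omega> by (simp add: w_def)
      show "(\<Sum>i<N. w i \<omega>) = 1" for \<omega> unfolding w_def using kN[of \<omega>] by simp
    qed
    show "a j \<omega> \<le> (\<Sum>i<N. w i \<omega> * a i \<omega>)" if "j < N" for j \<omega>
    proof -
      have "(\<Sum>i<N. w i \<omega> * a i \<omega>) = (\<Sum>i<N. if k \<omega> = i then a i \<omega> else 0)"
        by (intro sum.cong) (auto simp: w_def)
      also have "\<dots> = a (k \<omega>) \<omega>" using kN[of \<omega>] by simp
      finally show ?thesis using Pk[of \<omega>] that by (simp add: P_def)
    qed
  qed
qed

text \<open>Every convex function above q dominates psi of some maximal monotone set, so this is all that is
  needed of dual optimality.\<close>

definition dual_bound :: "real \<Rightarrow> bool" where
  "dual_bound D \<longleftrightarrow> (\<forall>\<phi>. convex_on UNIV \<phi> \<longrightarrow> (\<forall>x. q x \<le> \<phi> x) \<longrightarrow>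
     integrable M (\<lambda>\<omega>. \<phi> (Y \<omega>)) \<longrightarrow> D \<le> (\<integral>\<omega>. \<phi> (Y \<omega>) \<partial>M))"

lemma moment_pair:
  assumes w: "w \<in> weights N" "i < N"
  shows "(\<integral>\<omega>. w i \<omega> * (c + k \<bullet> (Y \<omega> - x)) \<partial>M) = mass w i * c + k \<bullet> (moment w i - mass w i *\<^sub>R x)"
proof -
  note i = weights_int[OF w Y_int] weights_integrable[OF w]
  have "(\<integral>\<omega>. w i \<omega> * (c + k \<bullet> (Y \<omega> - x)) \<partial>M) = (\<integral>\<omega>. w i \<omega> * (c - k \<bullet> x) + k \<bullet> (w i \<omega> *\<^sub>R Y \<omega>) \<partial>M)"
    by (intro Bochner_Integration.integral_cong) (auto simp: inner_diff_right algebra_simps)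
  also have "\<dots> = (\<integral>\<omega>. w i \<omega> * (c - k \<bullet> x) \<partial>M) + (\<integral>\<omega>. k \<bullet> (w i \<omega> *\<^sub>R Y \<omega>) \<partial>M)"
    using i by (intro Bochner_Integration.integral_add integrable_inner_right) auto
  also have "(\<integral>\<omega>. k \<bullet> (w i \<omega> *\<^sub>R Y \<omega>) \<partial>M) = k \<bullet> moment w i"
    unfolding moment_def by (rule integral_inner_right) (rule i)
  also have "(\<integral>\<omega>. w i \<omega> * (c - k \<bullet> x) \<partial>M) = mass w i * (c - k \<bullet> x)"
    by (simp add: mass_def)
  finally show ?thesis by (simp add: inner_diff_right algebra_simps)
qed

text \<open>The maximum of the affine functions through the points (x_i, q x_i) with slopes k_i is,
  after a small lift and a quadratic correction far out, a convex majorant of \<open>q\<close>, so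
  its expectation is at least \<open>D\<close>. The label attaining the maximum turns this
  expectation into the stated sums. The net is fixed before \<open>k\<close>, as the minimax
  argument requires.\<close>

lemma dual_response:
  assumes D: "dual_bound D" and L: "0 \<le> L" and \<epsilon>: "0 < \<epsilon>"
  obtains N and x :: "nat \<Rightarrow> real^'n" where "0 < N"
    "\<And>k. (\<forall>i<N. norm (k i) \<le> L * (1 + norm (x i))) \<Longrightarrow>
      \<exists>w\<in>weights N. D - \<epsilon> \<le> (\<Sum>i<N. mass w i * q (x i)) + (\<Sum>i<N. k i \<bullet> (moment w i - mass w i *\<^sub>R x i))"
proof -
  \<comment> \<open>Bounds the excess of the quadratic \<open>b\<close> over the maximum
    \<open>F\<close>, since \<open>F\<close> is at least \<open>- L * norm y\<close> by the member
    at the origin; \<open>\<rho>\<close> makes its tail contribution less than half of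
    \<open>\<epsilon>\<close>.\<close>
  define T where "T \<omega> = 2 * C * (norm (Y \<omega>))\<^sup>2 + L * norm (Y \<omega>)" for \<omega>
  have T: "integrable M T" "\<And>\<omega>. 0 \<le> T \<omega>"
    using Y_sq Y_norm C_pos L by (auto simp: T_def[abs_def])
  obtain \<rho> where \<rho>: "0 < \<rho>" "(\<integral>\<omega>. (if norm (Y \<omega>) > \<rho> then T \<omega> else 0) \<partial>M) < \<epsilon> / 2"
    using tail_small[OF Y_meas T, of "\<epsilon> / 2"] \<epsilon> by auto
  \<comment> \<open>The factor 2 separates two regions: \<open>b\<close> must exceed
    \<open>q\<close> outside the ball of radius \<open>R\<close> and stay below \<open>q\<close>
    inside the ball of radius \<open>\<rho>\<close>.\<close>
  define R where "R = 2 * \<rho>"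
  \<comment> \<open>On a net cell of radius \<open>\<eta>\<close> the function \<open>q\<close>
    varies by at most \<open>C * R * \<eta>\<close> and the slope contributes at most
    \<open>L * (1 + R) * \<eta>\<close>; the summand 1 keeps the denominator positive.\<close>
  define den where "den = C * R + L + L * R + 1"
  have den: "den > 0" using C_pos L \<rho>(1) by (auto simp: den_def R_def intro!: add_nonneg_pos)
  define \<eta> where "\<eta> = \<epsilon> / 2 / den"
  have \<eta>: "\<eta> > 0" using \<epsilon> den by (simp add: \<eta>_def)
  have R: "0 < R" using \<rho> by (simp add: R_def)
  obtain N and x :: "nat \<Rightarrow> real^'n" where N: "0 < N" "x 0 = 0" "\<And>i. i < N \<Longrightarrow> norm (x i) \<le> R"
    "\<And>z. norm z \<le> R \<Longrightarrow> \<exists>i<N. norm (z - x i) < \<eta>"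
    using finite_net[OF \<eta> less_imp_le[OF R]] by blast
  show thesis
  proof (rule that[OF N(1)])
    fix k :: "nat \<Rightarrow> real^'n" assume k: "\<forall>i<N. norm (k i) \<le> L * (1 + norm (x i))"
    define a where "a i y = q (x i) + k i \<bullet> (y - x i)" for i y
    define F where "F y = Max ((\<lambda>i. (q (x i) - k i \<bullet> x i) + k i \<bullet> y) ` {..<N})" for y
    have aF: "a i y \<le> F y" if "i < N" for i y
    proof -
      have "a i y = (q (x i) - k i \<bullet> x i) + k i \<bullet> y" by (simp add: a_def inner_diff_right)
      then show ?thesis unfolding F_def using that by (intro Max_ge) auto
    qed
    define b where "b y = (2 * C) * (norm y)\<^sup>2 + (- (C * R\<^sup>2))" for y :: "real^'n"
    define \<phi> where "\<phi> y = max (F y + \<epsilon> / 2) (b y)" for y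
    have contF: "convex_on UNIV F" unfolding F_def by (rule convex_on_Max_affine[OF N(1)])
    have convb: "convex_on UNIV b" unfolding b_def
      using C_pos by (intro convex_on_add[OF convex_on_cmul[OF _ convex_on_norm_sq]] convex_on_const[THEN iffD2, OF convex_UNIV]) auto
    have conv: "convex_on UNIV \<phi>" unfolding \<phi>_def
      by (intro convex_on_sup convb convex_on_add[OF contF] convex_on_const[THEN iffD2, OF convex_UNIV])
    have qF: "q z \<le> F z + \<epsilon> / 2" if z: "norm z \<le> R" for z
    proof -
      obtain i where i: "i < N" "norm (z - x i) < \<eta>" using N(4)[OF z] by blast
      have "q z - q (x i) \<le> C / 2 * norm (z - x i) * (norm z + norm (x i))"
        using q_diff_bound[of z "x i"] by linarith
      also have "\<dots> \<le> C / 2 * \<eta> * (R + R)"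
        using i C_pos z N(3)[OF i(1)] \<eta> by (intro mult_mono add_mono) auto
      finally have 1: "q z - q (x i) \<le> C * R * \<eta>" by (simp add: algebra_simps)
      have "- (k i \<bullet> (z - x i)) \<le> norm (k i) * norm (z - x i)"
        using Cauchy_Schwarz_ineq2[of "k i" "z - x i"] by linarith
      also have "\<dots> \<le> (L * (1 + R)) * \<eta>"
      proof (rule mult_mono)
        have "L * (1 + norm (x i)) \<le> L * (1 + R)" using N(3)[OF i(1)] L by (intro mult_left_mono) auto
        then show "norm (k i) \<le> L * (1 + R)" using k i(1) by (meson order_trans)
      qed (use i L R in auto)
      finally have "q z - a i z \<le> (C * R + L + L * R) * \<eta>" using 1 by (simp add: a_def algebra_simps)
      also have "\<dots> \<le> den * \<eta>" using \<eta> by (intro mult_right_mono) (auto simp: den_def)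
      also have "\<dots> = \<epsilon> / 2" using den by (simp add: \<eta>_def)
      finally show ?thesis using aF[OF i(1), of z] by simp
    qed
    have q\<phi>: "q z \<le> \<phi> z" for z
    proof (cases "norm z \<le> R")
      case True
      then show ?thesis using qF by (simp add: \<phi>_def le_max_iff_disj)
    next
      case False
      then have "R\<^sup>2 \<le> (norm z)\<^sup>2" using R by (intro power_mono) auto
      then have "C * R\<^sup>2 \<le> C * (norm z)\<^sup>2" using C_pos by simp
      moreover have "0 \<le> C * (norm z)\<^sup>2" using C_pos by simp
      moreover have "q z \<le> C * (norm z)\<^sup>2 / 2" using q_bound[of z] by simp
      ultimately have "q z \<le> b z" by (simp add: b_def)
      then show ?thesis by (simp add: \<phi>_def)
    qed
    define ay where "ay i \<omega> = a i (Y \<omega>)" for i \<omega>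
    have ay_int: "integrable M (ay i)" for i
      unfolding ay_def a_def using Y_int by (intro Bochner_Integration.integrable_add integrable_const integrable_inner_right Bochner_Integration.integrable_diff) auto
    have [measurable]: "ay i \<in> borel_measurable M" for i using ay_int by simp
    obtain w where w: "w \<in> weights N" "\<And>\<omega> j. j < N \<Longrightarrow> ay j \<omega> \<le> (\<Sum>i<N. w i \<omega> * ay i \<omega>)"
      using argmax_weights[OF N(1), of ay] by auto
    define m where "m \<omega> = (\<Sum>i<N. w i \<omega> * ay i \<omega>)" for \<omega>
    have m_int: "integrable M m" unfolding m_def
      using weights_int_real[OF w(1) _ ay_int] by (intro Bochner_Integration.integrable_sum) auto
    have Fm: "F (Y \<omega>) \<le> m \<omega>" for \<omega>
    proof -
      have "(q (x i) - k i \<bullet> x i) + k i \<bullet> Y \<omega> \<le> m \<omega>" if "i < N" for i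
        using w(2)[OF that, of \<omega>] by (simp add: ay_def a_def inner_diff_right m_def)
      then show ?thesis unfolding F_def using N(1) by (intro Max.boundedI) auto
    qed
    define t where "t \<omega> = (if norm (Y \<omega>) > \<rho> then T \<omega> else 0)" for \<omega>
    have [measurable]: "T \<in> borel_measurable M" using T by simp
    have [measurable]: "t \<in> borel_measurable M" unfolding t_def[abs_def] by measurable
    have t_int: "integrable M t"
      by (rule Bochner_Integration.integrable_bound[OF T(1)]) (auto simp: t_def)
    have up: "\<phi> (Y \<omega>) \<le> m \<omega> + \<epsilon> / 2 + t \<omega>" for \<omega>
    proof -
      let ?y = "Y \<omega>"
      have t0: "0 \<le> t \<omega>" using T(2) by (simp add: t_def)
      have "b ?y \<le> F ?y + \<epsilon> / 2 + t \<omega>"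
      proof (cases "norm ?y \<le> \<rho>")
        case True
        then have "(norm ?y)\<^sup>2 \<le> \<rho>\<^sup>2" by (intro power_mono) auto
        then have "C * (norm ?y)\<^sup>2 \<le> C * \<rho>\<^sup>2" using C_pos by simp
        moreover have "- C * (norm ?y)\<^sup>2 / 2 \<le> q ?y" using q_bound[of ?y] by simp
        moreover have "0 \<le> C * (norm ?y)\<^sup>2" using C_pos by simp
        ultimately have "b ?y \<le> q ?y" by (simp add: b_def R_def power_mult_distrib)
        also have "q ?y \<le> F ?y + \<epsilon> / 2" using True \<rho> by (intro qF) (simp add: R_def)
        finally show ?thesis using t0 by linarith
      next
        case False
        have "- (L * norm ?y) \<le> a 0 ?y"
        proof -
          have "norm (k 0) * norm ?y \<le> L * norm ?y"
            using k N(1,2) by (intro mult_right_mono) force+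
          then show ?thesis using Cauchy_Schwarz_ineq2[of "k 0" ?y] by (simp add: a_def N(2))
        qed
        also have "\<dots> \<le> F ?y" by (rule aF[OF N(1)])
        finally have "- (L * norm ?y) \<le> F ?y" .
        moreover have "b ?y \<le> 2 * C * (norm ?y)\<^sup>2" using C_pos by (simp add: b_def)
        ultimately show ?thesis using False \<epsilon> by (simp add: t_def T_def)
      qed
      then show ?thesis using Fm[of \<omega>] t0 by (simp add: \<phi>_def)
    qed
    have cont\<phi>: "\<phi> \<in> borel_measurable borel"
      using conv by (intro borel_measurable_continuous_onI) (simp add: convex_on_continuous)
    have \<phi>_int: "integrable M (\<lambda>\<omega>. \<phi> (Y \<omega>))"
    proof (rule Bochner_Integration.integrable_bound)
      show "integrable M (\<lambda>\<omega>. \<bar>m \<omega> + \<epsilon> / 2 + t \<omega>\<bar> + C / 2 * (norm (Y \<omega>))\<^sup>2)"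
        using m_int t_int Y_sq by (intro Bochner_Integration.integrable_add Bochner_Integration.integrable_abs) auto
      show "(\<lambda>\<omega>. \<phi> (Y \<omega>)) \<in> borel_measurable M" using cont\<phi> by measurable
      show "AE \<omega> in M. norm (\<phi> (Y \<omega>)) \<le> norm (\<bar>m \<omega> + \<epsilon> / 2 + t \<omega>\<bar> + C / 2 * (norm (Y \<omega>))\<^sup>2)"
      proof (intro AE_I2)
        fix \<omega>
        have "- (C / 2 * (norm (Y \<omega>))\<^sup>2) \<le> \<phi> (Y \<omega>)" using q\<phi>[of "Y \<omega>"] q_bound[of "Y \<omega>"] by linarith
        moreover have "0 \<le> C / 2 * (norm (Y \<omega>))\<^sup>2" using C_pos by simp
        ultimately show "norm (\<phi> (Y \<omega>)) \<le> norm (\<bar>m \<omega> + \<epsilon> / 2 + t \<omega>\<bar> + C / 2 * (norm (Y \<omega>))\<^sup>2)"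
          using up[of \<omega>] unfolding real_norm_def by linarith
      qed
    qed
    have "D \<le> (\<integral>\<omega>. \<phi> (Y \<omega>) \<partial>M)" using D conv q\<phi> \<phi>_int by (simp add: dual_bound_def)
    also have "\<dots> \<le> (\<integral>\<omega>. m \<omega> + \<epsilon> / 2 + t \<omega> \<partial>M)"
      using up \<phi>_int m_int t_int by (intro Bochner_Integration.integral_mono) auto
    also have "\<dots> = (\<integral>\<omega>. m \<omega> \<partial>M) + \<epsilon> / 2 + (\<integral>\<omega>. t \<omega> \<partial>M)"
      using m_int t_int by (simp add: prob_space)
    also have "(\<integral>\<omega>. t \<omega> \<partial>M) < \<epsilon> / 2" using \<rho>(2) by (simp add: t_def)
    also have "(\<integral>\<omega>. m \<omega> \<partial>M) = (\<Sum>i<N. \<integral>\<omega>. w i \<omega> * ay i \<omega> \<partial>M)"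
      unfolding m_def using weights_int_real[OF w(1) _ ay_int] by (subst Bochner_Integration.integral_sum) auto
    also have "\<dots> = (\<Sum>i<N. mass w i * q (x i) + k i \<bullet> (moment w i - mass w i *\<^sub>R x i))"
      unfolding ay_def a_def using moment_pair[OF w(1)] by (intro sum.cong) auto
    finally show "\<exists>w\<in>weights N. D - \<epsilon> \<le> (\<Sum>i<N. mass w i * q (x i)) + (\<Sum>i<N. k i \<bullet> (moment w i - mass w i *\<^sub>R x i))"
      using w(1) by (intro bexI[of _ w]) (auto simp: sum.distrib)
  qed
qed

lemma weights_convex:
  assumes w: "w \<in> weights N" "w' \<in> weights N" and t: "0 < t" "t < 1"
  shows "(\<lambda>i \<omega>. (1 - t) * w i \<omega> + t * w' i \<omega>) \<in> weights N"
  unfolding weights_def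
proof (intro CollectI conjI allI impI)
  fix i assume i: "i < N"
  have [measurable]: "w i \<in> borel_measurable M" "w' i \<in> borel_measurable M"
    using weightsD(1) w i by auto
  show "(\<lambda>\<omega>. (1 - t) * w i \<omega> + t * w' i \<omega>) \<in> borel_measurable M" by measurable
  show "0 \<le> (1 - t) * w i \<omega> + t * w' i \<omega>" for \<omega> using weightsD(2) w i t by auto
next
  show "(\<Sum>i<N. (1 - t) * w i \<omega> + t * w' i \<omega>) = 1" for \<omega>
    by (simp add: sum.distrib sum_distrib_left[symmetric] weights_sum[OF w(1)] weights_sum[OF w(2)])
qed

lemma mass_convex:
  assumes w: "w \<in> weights N" "w' \<in> weights N" and i: "i < N"
  shows "mass (\<lambda>i \<omega>. (1 - t) * w i \<omega> + t * w' i \<omega>) i = (1 - t) * mass w i + t * mass w' i"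
  unfolding mass_def using weights_integrable[OF w(1) i] weights_integrable[OF w(2) i]
  by (subst Bochner_Integration.integral_add) auto

lemma moment_convex:
  assumes w: "w \<in> weights N" "w' \<in> weights N" and i: "i < N"
  shows "moment (\<lambda>i \<omega>. (1 - t) * w i \<omega> + t * w' i \<omega>) i = (1 - t) *\<^sub>R moment w i + t *\<^sub>R moment w' i"
proof -
  have "moment (\<lambda>i \<omega>. (1 - t) * w i \<omega> + t * w' i \<omega>) i
      = (\<integral>\<omega>. (1 - t) *\<^sub>R (w i \<omega> *\<^sub>R Y \<omega>) + t *\<^sub>R (w' i \<omega> *\<^sub>R Y \<omega>) \<partial>M)"
    unfolding moment_def by (simp add: scaleR_add_left)
  also have "\<dots> = (1 - t) *\<^sub>R moment w i + t *\<^sub>R moment w' i"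
    unfolding moment_def
    using weights_int[OF w(1) i Y_int] weights_int[OF w(2) i Y_int]
    by (simp del: scaleR_scaleR)
  finally show ?thesis .
qed

lemma moment_zero:
  assumes w: "w \<in> weights N" "i < N" and "mass w i = 0"
  shows "moment w i = 0"
proof -
  have "AE \<omega> in M. w i \<omega> = 0"
    using assms weights_integrable[OF w] weightsD(2)[OF w]
    by (subst integral_nonneg_eq_0_iff_AE[symmetric]) (auto simp: mass_def)
  then have "moment w i = (\<integral>\<omega>. 0 \<partial>M)" unfolding moment_def
    using weightsD(1)[OF w] by (intro integral_cong_AE) auto
  then show ?thesis by simp
qed

text \<open>Jensen's inequality within one label, obtained by expanding the nonnegative weighted
  integral of the squared distance from \<open>Y\<close> to \<open>x\<close>.\<close>

lemma moment_variance:
  assumes w: "w \<in> weights N" "i < N" and x: "moment w i = mass w i *\<^sub>R x"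
  shows "mass w i * (norm x)\<^sup>2 \<le> (\<integral>\<omega>. w i \<omega> * (norm (Y \<omega>))\<^sup>2 \<partial>M)"
proof -
  note [simp] = weights_int_real[OF w Y_sq] weights_int[OF w Y_int] weights_integrable[OF w]
  have e: "w i \<omega> * (norm (Y \<omega> - x))\<^sup>2 = w i \<omega> * (norm (Y \<omega>))\<^sup>2 - (2 *\<^sub>R x) \<bullet> (w i \<omega> *\<^sub>R Y \<omega>) + w i \<omega> * (norm x)\<^sup>2" for \<omega>
    unfolding power2_norm_eq_inner
    by (simp add: inner_diff_left inner_diff_right inner_commute[of x "Y \<omega>"] algebra_simps)
  have "0 \<le> (\<integral>\<omega>. w i \<omega> * (norm (Y \<omega> - x))\<^sup>2 \<partial>M)"
    using weightsD(2)[OF w] by (intro Bochner_Integration.integral_nonneg) auto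
  also have "\<dots> = (\<integral>\<omega>. w i \<omega> * (norm (Y \<omega>))\<^sup>2 - (2 *\<^sub>R x) \<bullet> (w i \<omega> *\<^sub>R Y \<omega>) \<partial>M) + (\<integral>\<omega>. w i \<omega> * (norm x)\<^sup>2 \<partial>M)"
    unfolding e by (intro Bochner_Integration.integral_add Bochner_Integration.integrable_diff integrable_inner_right) auto
  also have "(\<integral>\<omega>. w i \<omega> * (norm (Y \<omega>))\<^sup>2 - (2 *\<^sub>R x) \<bullet> (w i \<omega> *\<^sub>R Y \<omega>) \<partial>M)
      = (\<integral>\<omega>. w i \<omega> * (norm (Y \<omega>))\<^sup>2 \<partial>M) - (\<integral>\<omega>. (2 *\<^sub>R x) \<bullet> (w i \<omega> *\<^sub>R Y \<omega>) \<partial>M)"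
    by (intro Bochner_Integration.integral_diff integrable_inner_right) auto
  also have "(\<integral>\<omega>. (2 *\<^sub>R x) \<bullet> (w i \<omega> *\<^sub>R Y \<omega>) \<partial>M) = (2 *\<^sub>R x) \<bullet> moment w i"
    unfolding moment_def by (rule integral_inner_right) simp
  also have "(\<integral>\<omega>. w i \<omega> * (norm x)\<^sup>2 \<partial>M) = mass w i * (norm x)\<^sup>2" by (simp add: mass_def)
  finally show ?thesis unfolding x by (simp add: power2_norm_eq_inner mult.commute)
qed

text \<open>Moving a point to the barycentre of its mass costs little: short moves are paid for by the
  penalty, and the total mass that moves far is so small that uniform integrability takes over.\<close>

lemma barycentre_cost:
  assumes w: "w \<in> weights N" "i < N" and T: "0 \<le> T" and L: "L \<ge> 3 * C / 2 + C * T\<^sup>2"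
    and z: "moment w i = mass w i *\<^sub>R z" "0 < mass w i"
  shows "mass w i * q x - L * (1 + norm x) * norm (moment w i - mass w i *\<^sub>R x)
      - C / 2 * (\<integral>\<omega>. w i \<omega> * (if norm (Y \<omega>) > T then (norm (Y \<omega>))\<^sup>2 else 0) \<partial>M) \<le> mass w i * q z"
proof -
  let ?m = "mass w i"
  let ?t = "\<lambda>\<omega>. if norm (Y \<omega>) > T then (norm (Y \<omega>))\<^sup>2 else 0"
  define I where "I = (\<integral>\<omega>. w i \<omega> * ?t \<omega> \<partial>M)"
  have t_int: "integrable M ?t"
    by (rule Bochner_Integration.integrable_bound[OF Y_sq]) auto
  have I0: "0 \<le> I" unfolding I_def
    using weightsD(2)[OF w] by (intro Bochner_Integration.integral_nonneg) auto
  define d where "d = norm (z - x)"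
  have d0: "0 \<le> d" by (simp add: d_def)
  have CT: "0 \<le> C * T\<^sup>2" using C_pos by simp
  have g: "norm (moment w i - ?m *\<^sub>R x) = ?m * d"
    using z by (simp add: d_def scaleR_diff_right[symmetric])
  have nx: "0 \<le> norm x" by simp
  have nz: "norm z \<le> norm x + d" using norm_triangle_sub[of z x] by (simp add: d_def)
  show ?thesis
  \<comment> \<open>Short moves use the part \<open>3 * C / 2\<close> of \<open>L\<close>. For
    longer ones the penalty also exceeds \<open>C * T\<^sup>2\<close> times the mass, which pays for
    the second moment of the bounded part of \<open>Y\<close>; the unbounded part is the tail
    integral.\<close>
  proof (cases "d \<le> 1 + norm x")
    case True
    have "q x - q z \<le> C / 2 * d * (norm z + norm x)"
      using q_diff_bound[of z x] unfolding d_def by linarith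
    also have "\<dots> \<le> C / 2 * d * (3 * (1 + norm x))"
      using C_pos d0 nz True nx by (intro mult_left_mono) auto
    also have "\<dots> = (3 * C / 2) * ((1 + norm x) * d)" by simp
    also have "\<dots> \<le> L * ((1 + norm x) * d)"
      using L CT d0 by (intro mult_right_mono) auto
    finally have "?m * (q x - q z) \<le> ?m * (L * ((1 + norm x) * d))" using z(2) by simp
    moreover have "0 \<le> C / 2 * I" using I0 C_pos by simp
    ultimately show ?thesis unfolding g I_def[symmetric] by (simp add: algebra_simps)
  next
    case False
    have "?m * (norm z)\<^sup>2 \<le> (\<integral>\<omega>. w i \<omega> * (norm (Y \<omega>))\<^sup>2 \<partial>M)" by (rule moment_variance[OF w z(1)])
    also have "\<dots> \<le> (\<integral>\<omega>. w i \<omega> * (T\<^sup>2 + ?t \<omega>) \<partial>M)"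
    proof (intro Bochner_Integration.integral_mono weights_int_real[OF w] Y_sq Bochner_Integration.integrable_add t_int mult_left_mono weightsD(2)[OF w])
      show "(norm (Y \<omega>))\<^sup>2 \<le> T\<^sup>2 + ?t \<omega>" for \<omega>
        using power_mono[of "norm (Y \<omega>)" T 2] by auto
    qed simp
    also have "\<dots> = (\<integral>\<omega>. w i \<omega> * T\<^sup>2 + w i \<omega> * ?t \<omega> \<partial>M)" by (simp add: distrib_left)
    also have "\<dots> = ?m * T\<^sup>2 + I"
      using weights_integrable[OF w] weights_int_real[OF w t_int] by (subst Bochner_Integration.integral_add) (auto simp: mass_def I_def)
    finally have "C / 2 * (?m * (norm z)\<^sup>2) \<le> C / 2 * (?m * T\<^sup>2 + I)"
      using C_pos by (intro mult_left_mono) auto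
    moreover have "?m * (- (C / 2 * (norm z)\<^sup>2)) \<le> ?m * q z"
      using q_bound[of z] z(2) by (intro mult_left_mono) auto
    ultimately have 1: "- (C / 2 * (?m * T\<^sup>2 + I)) \<le> ?m * q z" by (simp add: algebra_simps)
    have p: "1 + norm x \<le> (1 + norm x) * d"
    proof -
      have "(1 + norm x) * 1 \<le> (1 + norm x) * d" using False nx by (intro mult_left_mono) linarith+
      then show ?thesis by simp
    qed
    have "q x \<le> C / 2 * (norm x * norm x)" using q_bound[of x] by (simp add: power2_eq_square)
    also have "\<dots> \<le> C / 2 * ((1 + norm x) * d)"
      using C_pos False by (intro mult_left_mono mult_mono) auto
    finally have 2: "q x \<le> C / 2 * ((1 + norm x) * d)" .
    have "1 \<le> (1 + norm x) * d" using p nx by linarith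
    from mult_left_mono[OF this CT]
    have "C / 2 * T\<^sup>2 \<le> C * T\<^sup>2 * ((1 + norm x) * d)" using CT by simp
    then have "q x + C / 2 * T\<^sup>2 \<le> (C / 2 + C * T\<^sup>2) * ((1 + norm x) * d)"
      using 2 by (simp only: distrib_right)
    also have "\<dots> \<le> L * ((1 + norm x) * d)"
      using L C_pos d0 by (intro mult_right_mono) auto
    finally have "?m * (q x + C / 2 * T\<^sup>2) \<le> ?m * (L * ((1 + norm x) * d))" using z(2) by simp
    then show ?thesis using 1 unfolding g I_def[symmetric] by (simp add: algebra_simps)
  qed
qed

text \<open>The penalty weights in the minimax step are those of \<open>barycentre_cost\<close>, so
  replacing net points by true barycentres is already paid for. One third of
  \<open>\<epsilon>\<close> goes to each of the dual response, the minimax step and the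
  tail.\<close>

theorem near_optimal_decomposition:
  assumes D: "dual_bound D" and \<epsilon>: "0 < \<epsilon>"
  shows "\<exists>N w x. w \<in> weights N \<and> (\<forall>i<N. moment w i = mass w i *\<^sub>R x i) \<and>
    D - \<epsilon> \<le> (\<Sum>i<N. mass w i * q (x i))"
proof -
  \<comment> \<open>The tail enters with factor \<open>C / 2\<close>, which turns this bound into
    one third of \<open>\<epsilon>\<close>.\<close>
  have \<epsilon>': "2 * \<epsilon> / (3 * C) > 0" "\<epsilon> / 3 > 0" using \<epsilon> C_pos by auto
  obtain T where T: "0 < T" "(\<integral>\<omega>. (if norm (Y \<omega>) > T then (norm (Y \<omega>))\<^sup>2 else 0) \<partial>M) < 2 * \<epsilon> / (3 * C)"
    using tail_small[OF Y_meas Y_sq _ \<epsilon>'(1)] by auto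
  let ?t = "\<lambda>\<omega>. if norm (Y \<omega>) > T then (norm (Y \<omega>))\<^sup>2 else 0"
  have t_int: "integrable M ?t" by (rule Bochner_Integration.integrable_bound[OF Y_sq]) auto
  define L where "L = 3 * C / 2 + C * T\<^sup>2"
  have L: "0 \<le> L" using C_pos by (simp add: L_def)
  obtain N and x :: "nat \<Rightarrow> real^'n" where N: "0 < N"
    "\<And>k. (\<forall>i<N. norm (k i) \<le> L * (1 + norm (x i))) \<Longrightarrow>
      \<exists>w\<in>weights N. D - \<epsilon> / 3 \<le> (\<Sum>i<N. mass w i * q (x i)) + (\<Sum>i<N. k i \<bullet> (moment w i - mass w i *\<^sub>R x i))"
    using dual_response[OF D L \<epsilon>'(2)] by blast
  define K where "K = (\<Sum>i<N. \<bar>q (x i)\<bar>) + (\<integral>\<omega>. norm (Y \<omega>) \<partial>M) + (\<Sum>i<N. norm (x i))"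
  have K: "0 \<le> (\<Sum>i<N. \<bar>q (x i)\<bar>)" "0 \<le> (\<integral>\<omega>. norm (Y \<omega>) \<partial>M)" "0 \<le> (\<Sum>i<N. norm (x i))"
    by (auto intro: sum_nonneg)
  have "\<exists>w\<in>weights N. D - \<epsilon> / 3 - \<epsilon> / 3 \<le> (\<Sum>i<N. mass w i * q (x i))
      - (\<Sum>i<N. L * (1 + norm (x i)) * norm (moment w i - mass w i *\<^sub>R x i))"
  proof (rule approximate_minimax[where W = "weights N" and a = "\<lambda>w. \<Sum>i<N. mass w i * q (x i)"
        and g = "\<lambda>w i. moment w i - mass w i *\<^sub>R x i" and L = "\<lambda>i. L * (1 + norm (x i))" and K = K])
    show "weights N \<noteq> {}" using argmax_weights[OF N(1), of "\<lambda>_ _. 0"] by auto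
    show "\<exists>w''\<in>weights N. (\<Sum>i<N. mass w'' i * q (x i)) = (1 - t) * (\<Sum>i<N. mass w i * q (x i)) + t * (\<Sum>i<N. mass w' i * q (x i)) \<and>
        (\<forall>i<N. moment w'' i - mass w'' i *\<^sub>R x i = (1 - t) *\<^sub>R (moment w i - mass w i *\<^sub>R x i) + t *\<^sub>R (moment w' i - mass w' i *\<^sub>R x i))"
      if w: "w \<in> weights N" "w' \<in> weights N" and t: "0 < t" "t < 1" for w w' t
    proof (intro bexI[OF _ weights_convex[OF w t]] conjI allI impI)
      show "(\<Sum>i<N. mass (\<lambda>i \<omega>. (1 - t) * w i \<omega> + t * w' i \<omega>) i * q (x i))
          = (1 - t) * (\<Sum>i<N. mass w i * q (x i)) + t * (\<Sum>i<N. mass w' i * q (x i))"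
        unfolding sum_distrib_left sum.distrib[symmetric]
        by (intro sum.cong refl, subst mass_convex[OF w]) (auto simp: algebra_simps)
      show "moment (\<lambda>i \<omega>. (1 - t) * w i \<omega> + t * w' i \<omega>) i - mass (\<lambda>i \<omega>. (1 - t) * w i \<omega> + t * w' i \<omega>) i *\<^sub>R x i
        = (1 - t) *\<^sub>R (moment w i - mass w i *\<^sub>R x i) + t *\<^sub>R (moment w' i - mass w' i *\<^sub>R x i)" if "i < N" for i
        unfolding mass_convex[OF w that] moment_convex[OF w that] by (simp add: algebra_simps)
    qed
    show "(\<Sum>i<N. mass w i * q (x i)) \<le> K" if w: "w \<in> weights N" for w
    proof -
      have "mass w i * q (x i) \<le> \<bar>q (x i)\<bar>" if "i < N" for i
      proof -
        have "mass w i * q (x i) \<le> mass w i * \<bar>q (x i)\<bar>"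
          using mass_nonneg[OF w that] by (intro mult_left_mono) auto
        also have "\<dots> \<le> 1 * \<bar>q (x i)\<bar>" using mass_le_1[OF w that] by (intro mult_right_mono) auto
        finally show ?thesis by simp
      qed
      then have "(\<Sum>i<N. mass w i * q (x i)) \<le> (\<Sum>i<N. \<bar>q (x i)\<bar>)" by (intro sum_mono) auto
      then show ?thesis using K unfolding K_def by linarith
    qed
    show "norm (moment w i - mass w i *\<^sub>R x i) \<le> K" if w: "w \<in> weights N" "i < N" for w i
    proof -
      have "norm (moment w i - mass w i *\<^sub>R x i) \<le> norm (moment w i) + mass w i * norm (x i)"
        using norm_triangle_ineq4[of "moment w i" "mass w i *\<^sub>R x i"] mass_nonneg[OF w] by simp
      also have "mass w i * norm (x i) \<le> 1 * norm (x i)"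
        using mass_le_1[OF w] by (intro mult_right_mono) auto
      also have "1 * norm (x i) \<le> (\<Sum>i<N. norm (x i))" using w(2) member_le_sum[of i "{..<N}" "\<lambda>i. norm (x i)"] by simp
      also have "norm (moment w i) \<le> (\<integral>\<omega>. norm (Y \<omega>) \<partial>M)"
      proof -
        have "(\<integral>\<omega>. w i \<omega> * norm (Y \<omega>) \<partial>M) \<le> (\<integral>\<omega>. norm (Y \<omega>) \<partial>M)"
          using weightsD[OF w] weights_int_real[OF w Y_norm] Y_norm
          by (intro Bochner_Integration.integral_mono) (auto intro: mult_left_le_one_le)
        then show ?thesis using norm_moment[OF w] by linarith
      qed
      finally show ?thesis using K unfolding K_def by linarith
    qed
    show "0 \<le> L * (1 + norm (x i))" for i using L by (simp add: add_nonneg_nonneg)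
    show "0 < \<epsilon> / 3" by (rule \<epsilon>'(2))
  qed (rule N(2))
  then obtain w where w: "w \<in> weights N" and w2: "D - \<epsilon> / 3 - \<epsilon> / 3 \<le> (\<Sum>i<N. mass w i * q (x i))
      - (\<Sum>i<N. L * (1 + norm (x i)) * norm (moment w i - mass w i *\<^sub>R x i))" by blast
  \<comment> \<open>A label of mass zero also has zero moment, so any point satisfies the barycentre
    equation there.\<close>
  define z where "z i = (if mass w i = 0 then x i else (1 / mass w i) *\<^sub>R moment w i)" for i
  have z: "moment w i = mass w i *\<^sub>R z i" if "i < N" for i
    using moment_zero[OF w that] by (simp add: z_def)
  have "mass w i * q (x i) - L * (1 + norm (x i)) * norm (moment w i - mass w i *\<^sub>R x i)
      - C / 2 * (\<integral>\<omega>. w i \<omega> * ?t \<omega> \<partial>M) \<le> mass w i * q (z i)" if i: "i < N" for i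
  proof (cases "mass w i = 0")
    case True
    have "0 \<le> C / 2 * (\<integral>\<omega>. w i \<omega> * ?t \<omega> \<partial>M)"
      using C_pos weightsD(2)[OF w i] by (intro mult_nonneg_nonneg Bochner_Integration.integral_nonneg) auto
    then show ?thesis using True moment_zero[OF w i] by simp
  next
    case False
    then have "0 < mass w i" using mass_nonneg[OF w i] by simp
    then show ?thesis using T(1) by (intro barycentre_cost[OF w i _ _ z[OF i]]) (auto simp: L_def)
  qed
  then have "(\<Sum>i<N. mass w i * q (x i) - L * (1 + norm (x i)) * norm (moment w i - mass w i *\<^sub>R x i)
      - C / 2 * (\<integral>\<omega>. w i \<omega> * ?t \<omega> \<partial>M)) \<le> (\<Sum>i<N. mass w i * q (z i))"
    by (intro sum_mono) auto
  moreover have "(\<Sum>i<N. C / 2 * (\<integral>\<omega>. w i \<omega> * ?t \<omega> \<partial>M)) \<le> \<epsilon> / 3"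
  proof -
    have "(\<Sum>i<N. C / 2 * (\<integral>\<omega>. w i \<omega> * ?t \<omega> \<partial>M)) = C / 2 * (\<integral>\<omega>. ?t \<omega> \<partial>M)"
      by (simp only: sum_distrib_left[symmetric] weights_sum_integral[OF w t_int])
    also have "\<dots> \<le> C / 2 * (2 * \<epsilon> / (3 * C))" using T(2) C_pos by (intro mult_left_mono) auto
    also have "\<dots> = \<epsilon> / 3" using C_pos by simp
    finally show ?thesis .
  qed
  ultimately have "D - \<epsilon> \<le> (\<Sum>i<N. mass w i * q (z i))"
    using w2 by (simp only: sum_subtractf)
  then show ?thesis using w z by blast
qed

section \<open>Expectation and probability under the joint law of sample point and label\<close>

definition EQ :: "nat \<Rightarrow> (nat \<Rightarrow> 'a \<Rightarrow> real) \<Rightarrow> (nat \<Rightarrow> 'a \<Rightarrow> real) \<Rightarrow> real" where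
  "EQ N w f = (\<Sum>i<N. \<integral>\<omega>. w i \<omega> * f i \<omega> \<partial>M)"

lemma EQ_mono:
  assumes w: "w \<in> weights N" and f: "\<And>i. i < N \<Longrightarrow> integrable M (f i)" and g: "\<And>i. i < N \<Longrightarrow> integrable M (g i)"
    and le: "\<And>i. i < N \<Longrightarrow> AE \<omega> in M. f i \<omega> \<le> g i \<omega>"
  shows "EQ N w f \<le> EQ N w g"
  unfolding EQ_def
proof (intro sum_mono)
  fix i assume "i \<in> {..<N}"
  then have i: "i < N" by simp
  show "(\<integral>\<omega>. w i \<omega> * f i \<omega> \<partial>M) \<le> (\<integral>\<omega>. w i \<omega> * g i \<omega> \<partial>M)"
  proof (intro integral_mono_AE weights_int_real[OF w i] f g i)
    show "AE \<omega> in M. w i \<omega> * f i \<omega> \<le> w i \<omega> * g i \<omega>"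
      using le[OF i] by eventually_elim (use weightsD(2)[OF w i] in \<open>auto intro: mult_left_mono\<close>)
  qed
qed

lemma EQ_add:
  assumes w: "w \<in> weights N" and f: "\<And>i. i < N \<Longrightarrow> integrable M (f i)" and g: "\<And>i. i < N \<Longrightarrow> integrable M (g i)"
  shows "EQ N w (\<lambda>i \<omega>. f i \<omega> + g i \<omega>) = EQ N w f + EQ N w g"
  unfolding EQ_def sum.distrib[symmetric]
proof (intro sum.cong refl)
  fix i assume "i \<in> {..<N}"
  then have i: "i < N" by simp
  show "(\<integral>\<omega>. w i \<omega> * (f i \<omega> + g i \<omega>) \<partial>M) = (\<integral>\<omega>. w i \<omega> * f i \<omega> \<partial>M) + (\<integral>\<omega>. w i \<omega> * g i \<omega> \<partial>M)"
    unfolding distrib_left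
    by (intro Bochner_Integration.integral_add weights_int_real[OF w i] f g i)
qed

lemma EQ_cmult: "EQ N w (\<lambda>i \<omega>. c * f i \<omega>) = c * EQ N w f"
  unfolding EQ_def by (simp add: mult.left_commute[of _ c] sum_distrib_left)

lemma EQ_index: "EQ N w (\<lambda>i \<omega>. c i) = (\<Sum>i<N. mass w i * c i)"
  unfolding EQ_def mass_def by simp

lemma EQ_fun: "w \<in> weights N \<Longrightarrow> integrable M f \<Longrightarrow> EQ N w (\<lambda>i. f) = (\<integral>\<omega>. f \<omega> \<partial>M)"
  unfolding EQ_def by (rule weights_sum_integral)

definition QP :: "nat \<Rightarrow> (nat \<Rightarrow> 'a \<Rightarrow> real) \<Rightarrow> (nat \<Rightarrow> 'a \<Rightarrow> bool) \<Rightarrow> real" where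
  "QP N w E = EQ N w (\<lambda>i \<omega>. if E i \<omega> then 1 else 0)"

lemma indicator_int:
  assumes [measurable]: "Measurable.pred M E"
  shows "integrable M (\<lambda>\<omega>. if E \<omega> then 1 else 0 :: real)"
  by (rule Bochner_Integration.integrable_bound[of _ "\<lambda>_. 1 :: real"]) auto

lemma QP_mono:
  assumes w: "w \<in> weights N" and E: "\<And>i. i < N \<Longrightarrow> Measurable.pred M (E i)" "\<And>i. i < N \<Longrightarrow> Measurable.pred M (F i)"
    and le: "\<And>i. i < N \<Longrightarrow> AE \<omega> in M. E i \<omega> \<longrightarrow> F i \<omega>"
  shows "QP N w E \<le> QP N w F"
  unfolding QP_def
proof (intro EQ_mono[OF w] indicator_int E)
  show "AE \<omega> in M. (if E i \<omega> then 1 else 0 :: real) \<le> (if F i \<omega> then 1 else 0)" if "i < N" for i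
    using le[OF that] by eventually_elim auto
qed

lemma QP_disj:
  assumes w: "w \<in> weights N" and E: "\<And>i. i < N \<Longrightarrow> Measurable.pred M (E i)" "\<And>i. i < N \<Longrightarrow> Measurable.pred M (F i)"
  shows "QP N w (\<lambda>i \<omega>. E i \<omega> \<or> F i \<omega>) \<le> QP N w E + QP N w F"
proof -
  have "QP N w (\<lambda>i \<omega>. E i \<omega> \<or> F i \<omega>) \<le> EQ N w (\<lambda>i \<omega>. (if E i \<omega> then 1 else 0) + (if F i \<omega> then 1 else 0))"
    unfolding QP_def
  proof (intro EQ_mono[OF w] indicator_int Bochner_Integration.integrable_add E)
    fix i assume i: "i < N"
    note [measurable] = E[OF i]
    show "Measurable.pred M (\<lambda>\<omega>. E i \<omega> \<or> F i \<omega>)" by measurable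
  qed auto
  also have "\<dots> = QP N w E + QP N w F"
    unfolding QP_def by (intro EQ_add[OF w] indicator_int E)
  finally show ?thesis .
qed

lemma QP_le_sum:
  assumes w: "w \<in> weights N" and E: "\<And>i. i < N \<Longrightarrow> Measurable.pred M (E i)"
    "\<And>i. i < N \<Longrightarrow> Measurable.pred M (F i)" "\<And>i. i < N \<Longrightarrow> Measurable.pred M (H i)"
    and le: "\<And>i. i < N \<Longrightarrow> AE \<omega> in M. E i \<omega> \<longrightarrow> F i \<omega> \<or> H i \<omega>"
    and b: "QP N w F \<le> a" "QP N w H \<le> b"
  shows "QP N w E \<le> a + b"
proof -
  have "QP N w E \<le> QP N w (\<lambda>i \<omega>. F i \<omega> \<or> H i \<omega>)"
  proof (intro QP_mono[OF w] E le)
    fix i assume i: "i < N"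
    note [measurable] = E[OF i]
    show "Measurable.pred M (\<lambda>\<omega>. F i \<omega> \<or> H i \<omega>)" by measurable
  qed
  then show ?thesis using QP_disj[of w N F H, OF w E(2,3)] b by linarith
qed

lemma QP_fun:
  assumes w: "w \<in> weights N" and [measurable]: "Measurable.pred M P"
  shows "QP N w (\<lambda>i. P) = prob {\<omega>\<in>space M. P \<omega>}"
proof -
  have "QP N w (\<lambda>i. P) = (\<integral>\<omega>. indicator {\<omega>\<in>space M. P \<omega>} \<omega> \<partial>M)"
    unfolding QP_def EQ_fun[OF w indicator_int[OF assms(2)]]
    by (intro Bochner_Integration.integral_cong) auto
  then show ?thesis by simp
qed

lemma QP_index: "QP N w (\<lambda>i \<omega>. P i) = (\<Sum>i<N. if P i then mass w i else 0)"
  unfolding QP_def EQ_index by (intro sum.cong) auto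

end

subsection \<open>Decompositions and the argmax map of a maximal monotone set\<close>

text \<open>\<open>\<Psi>\<close> is an integrable real version of \<open>psi\<close> at
  \<open>Y\<close>. Describing it as an almost sure least upper bound keeps extended reals out of
  the integrals.\<close>

locale potential = transport S M Y for S :: "real^'n^'n" and M :: "'a measure" and Y :: "'a \<Rightarrow> real^'n" +
  fixes G :: "(real^'n) set" and \<Psi> :: "'a \<Rightarrow> real"
  assumes G: "G \<in> max_S_monotone S"
    and \<Psi>_int: "integrable M \<Psi>"
    and \<Psi>_ub: "AE \<omega> in M. \<forall>x\<in>G. h x (Y \<omega>) \<le> \<Psi> \<omega>"
    and \<Psi>_lub: "AE \<omega> in M. \<forall>t. (\<forall>x\<in>G. h x (Y \<omega>) \<le> t) \<longrightarrow> \<Psi> \<omega> \<le> t"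
begin

lemmas G_closed = max_S_monotone_closed[OF G]

abbreviation D :: real where "D \<equiv> \<integral>\<omega>. \<Psi> \<omega> \<partial>M"

definition decomp :: "real \<Rightarrow> nat \<Rightarrow> (nat \<Rightarrow> 'a \<Rightarrow> real) \<Rightarrow> (nat \<Rightarrow> real^'n) \<Rightarrow> bool" where
  "decomp \<epsilon> N w x \<longleftrightarrow> w \<in> weights N \<and> (\<forall>i<N. moment w i = mass w i *\<^sub>R x i) \<and>
    D - \<epsilon> \<le> (\<Sum>i<N. mass w i * q (x i))"

lemma decompD:
  assumes "decomp \<epsilon> N w x"
  shows "w \<in> weights N" "i < N \<Longrightarrow> moment w i = mass w i *\<^sub>R x i"
    "D - \<epsilon> \<le> (\<Sum>i<N. mass w i * q (x i))"
  using assms by (auto simp: decomp_def)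

lemma decomp_mono: "decomp \<epsilon> N w x \<Longrightarrow> \<epsilon> \<le> \<epsilon>' \<Longrightarrow> decomp \<epsilon>' N w x"
  by (auto simp: decomp_def)

lemma h_moment:
  assumes d: "decomp \<epsilon> N w x" and i: "i < N"
  shows "(\<integral>\<omega>. w i \<omega> * h z (Y \<omega>) \<partial>M) = mass w i * h z (x i)"
proof -
  have hz: "h z y = h z (x i) + (S *v z) \<bullet> (y - x i)" for y
    by (simp add: h_inner inner_diff_right)
  have "(\<integral>\<omega>. w i \<omega> * h z (Y \<omega>) \<partial>M) = (\<integral>\<omega>. w i \<omega> * (h z (x i) + (S *v z) \<bullet> (Y \<omega> - x i)) \<partial>M)"
    by (subst hz) simp
  also have "\<dots> = mass w i * h z (x i) + (S *v z) \<bullet> (moment w i - mass w i *\<^sub>R x i)"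
    by (rule moment_pair[OF decompD(1)[OF d] i])
  finally show ?thesis using decompD(2)[OF d i] by simp
qed

text \<open>All gaps are nonnegative, so a sum over some labels is bounded by the full sum. On the
  remaining labels a point of G with nonpositive \<open>q\<close> towards the barycentre is
  inserted; their \<open>q\<close>-terms only lower the bound.\<close>

lemma deficit_le:
  assumes d: "decomp \<epsilon> N w x" and I: "I \<subseteq> {..<N}" and z: "\<And>i. i \<in> I \<Longrightarrow> z i \<in> G"
  shows "(\<Sum>i\<in>I. \<integral>\<omega>. w i \<omega> * (\<Psi> \<omega> - h (z i) (Y \<omega>)) \<partial>M) \<le> \<epsilon> + (\<Sum>i\<in>I. mass w i * q (x i - z i))"
proof -
  note w = decompD(1)[OF d]
  have "\<exists>v\<in>G. q (x i - v) \<le> 0" for i using max_S_monotone_nonpos[OF G, of "x i"] by blast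
  then obtain v where v: "\<And>i. v i \<in> G" "\<And>i. q (x i - v i) \<le> 0" by metis
  define u where "u i = (if i \<in> I then z i else v i)" for i
  have uG: "u i \<in> G" for i using z v by (simp add: u_def)
  have int: "integrable M (\<lambda>\<omega>. \<Psi> \<omega> - h (u i) (Y \<omega>))" for i
    by (intro Bochner_Integration.integrable_diff \<Psi>_int h_int)
  have nn: "0 \<le> (\<integral>\<omega>. w i \<omega> * (\<Psi> \<omega> - h (u i) (Y \<omega>)) \<partial>M)" if i: "i < N" for i
  proof (rule integral_nonneg_AE)
    show "AE \<omega> in M. 0 \<le> w i \<omega> * (\<Psi> \<omega> - h (u i) (Y \<omega>))"
      using \<Psi>_ub by eventually_elim (use weightsD(2)[OF w i] uG in auto)
  qed
  have "(\<Sum>i\<in>I. \<integral>\<omega>. w i \<omega> * (\<Psi> \<omega> - h (z i) (Y \<omega>)) \<partial>M) = (\<Sum>i\<in>I. \<integral>\<omega>. w i \<omega> * (\<Psi> \<omega> - h (u i) (Y \<omega>)) \<partial>M)"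
    by (intro sum.cong) (auto simp: u_def)
  also have "\<dots> \<le> (\<Sum>i<N. \<integral>\<omega>. w i \<omega> * (\<Psi> \<omega> - h (u i) (Y \<omega>)) \<partial>M)"
    using I nn by (intro sum_mono2) auto
  also have "\<dots> = (\<Sum>i<N. (\<integral>\<omega>. w i \<omega> * \<Psi> \<omega> \<partial>M) - mass w i * h (u i) (x i))"
  proof (intro sum.cong refl)
    fix i assume "i \<in> {..<N}"
    then have i: "i < N" by simp
    show "(\<integral>\<omega>. w i \<omega> * (\<Psi> \<omega> - h (u i) (Y \<omega>)) \<partial>M) = (\<integral>\<omega>. w i \<omega> * \<Psi> \<omega> \<partial>M) - mass w i * h (u i) (x i)"
      unfolding right_diff_distrib h_moment[OF d i, symmetric]
      by (intro Bochner_Integration.integral_diff weights_int_real[OF w i] \<Psi>_int h_int)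
  qed
  also have "\<dots> = D - (\<Sum>i<N. mass w i * q (x i)) + (\<Sum>i<N. mass w i * q (x i - u i))"
    by (simp add: sum_subtractf weights_sum_integral[OF w \<Psi>_int] h_eq right_diff_distrib)
  also have "(\<Sum>i<N. mass w i * q (x i - u i)) \<le> (\<Sum>i\<in>I. mass w i * q (x i - u i))"
  proof -
    have "(\<Sum>i<N. mass w i * q (x i - u i)) = (\<Sum>i\<in>I. mass w i * q (x i - u i)) + (\<Sum>i\<in>{..<N} - I. mass w i * q (x i - u i))"
      using sum.subset_diff[OF I, of "\<lambda>i. mass w i * q (x i - u i)"] by simp
    moreover have "(\<Sum>i\<in>{..<N} - I. mass w i * q (x i - u i)) \<le> 0"
      using v mass_nonneg[OF w] by (intro sum_nonpos) (auto simp: u_def intro!: mult_nonneg_nonpos)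
    ultimately show ?thesis by linarith
  qed
  also have "(\<Sum>i\<in>I. mass w i * q (x i - u i)) = (\<Sum>i\<in>I. mass w i * q (x i - z i))"
    by (intro sum.cong) (auto simp: u_def)
  finally show ?thesis using decompD(3)[OF d] by linarith
qed

lemma approx_pred [measurable]: "Measurable.pred M (\<lambda>\<omega>. approx G s z (Y \<omega>))"
proof -
  have "closed {y. approx G s z y}"
    using approx_closed2[OF G_closed, of "\<lambda>_. z" "\<lambda>y. y" s] by auto
  then have [measurable]: "{y. approx G s z y} \<in> sets borel" by simp
  have "Measurable.pred M (\<lambda>\<omega>. Y \<omega> \<in> {y. approx G s z y})" by measurable
  then show ?thesis by simp
qed

text \<open>Markov's inequality: where \<open>z i\<close> fails to be maximal up to
  \<open>s\<close>, the gap exceeds \<open>s\<close>.\<close>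

lemma deficit_prob_le:
  assumes d: "decomp \<epsilon> N w x" and s: "0 < s" and I: "I \<subseteq> {..<N}" and z: "\<And>i. i \<in> I \<Longrightarrow> z i \<in> G"
  shows "s * QP N w (\<lambda>i \<omega>. i \<in> I \<and> \<not> approx G s (z i) (Y \<omega>)) \<le> \<epsilon> + (\<Sum>i\<in>I. mass w i * q (x i - z i))"
proof -
  note w = decompD(1)[OF d]
  have "s * QP N w (\<lambda>i \<omega>. i \<in> I \<and> \<not> approx G s (z i) (Y \<omega>))
    = EQ N w (\<lambda>i \<omega>. s * (if i \<in> I \<and> \<not> approx G s (z i) (Y \<omega>) then 1 else 0))"
    unfolding QP_def EQ_cmult ..
  also have "\<dots> \<le> EQ N w (\<lambda>i \<omega>. if i \<in> I then \<Psi> \<omega> - h (z i) (Y \<omega>) else 0)"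
  proof (intro EQ_mono[OF w])
    fix i
    show "integrable M (\<lambda>\<omega>. s * (if i \<in> I \<and> \<not> approx G s (z i) (Y \<omega>) then 1 else 0))"
      by (intro integrable_mult_right indicator_int) measurable
    show "integrable M (\<lambda>\<omega>. if i \<in> I then \<Psi> \<omega> - h (z i) (Y \<omega>) else 0)"
      by (cases "i \<in> I") (auto intro!: Bochner_Integration.integrable_diff \<Psi>_int h_int)
    show "AE \<omega> in M. s * (if i \<in> I \<and> \<not> approx G s (z i) (Y \<omega>) then 1 else 0) \<le> (if i \<in> I then \<Psi> \<omega> - h (z i) (Y \<omega>) else 0)"
      using \<Psi>_ub
    proof eventually_elim
      case (elim \<omega>)
      show ?case
      proof (cases "i \<in> I \<and> \<not> approx G s (z i) (Y \<omega>)")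
        case True
        then obtain x where "x \<in> G" "h (z i) (Y \<omega>) + s < h x (Y \<omega>)" using z by (auto simp: approx_def not_le)
        then show ?thesis using True elim by fastforce
      qed (use elim z in auto)
    qed
  qed
  also have "\<dots> = (\<Sum>i\<in>I. \<integral>\<omega>. w i \<omega> * (\<Psi> \<omega> - h (z i) (Y \<omega>)) \<partial>M)"
  proof -
    have "EQ N w (\<lambda>i \<omega>. if i \<in> I then \<Psi> \<omega> - h (z i) (Y \<omega>) else 0)
      = (\<Sum>i<N. if i \<in> I then \<integral>\<omega>. w i \<omega> * (\<Psi> \<omega> - h (z i) (Y \<omega>)) \<partial>M else 0)"
      unfolding EQ_def by (intro sum.cong) auto
    also have "\<dots> = (\<Sum>i\<in>{..<N} \<inter> I. \<integral>\<omega>. w i \<omega> * (\<Psi> \<omega> - h (z i) (Y \<omega>)) \<partial>M)"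
      by (simp add: sum.inter_restrict)
    finally show ?thesis using I by (simp add: Int_absorb1)
  qed
  also have "\<dots> \<le> \<epsilon> + (\<Sum>i\<in>I. mass w i * q (x i - z i))" by (rule deficit_le[OF d I z])
  finally show ?thesis .
qed

lemma second_moment_le:
  assumes d: "decomp \<epsilon> N w x"
  shows "(\<Sum>i<N. mass w i * (norm (x i))\<^sup>2) \<le> (\<integral>\<omega>. (norm (Y \<omega>))\<^sup>2 \<partial>M)"
proof -
  note w = decompD(1)[OF d]
  have "(\<Sum>i<N. mass w i * (norm (x i))\<^sup>2) \<le> (\<Sum>i<N. \<integral>\<omega>. w i \<omega> * (norm (Y \<omega>))\<^sup>2 \<partial>M)"
    using moment_variance[OF w _ decompD(2)[OF d]] by (intro sum_mono) auto
  then show ?thesis by (simp add: weights_sum_integral[OF w Y_sq])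
qed

text \<open>Three losses of one third of \<open>\<kappa>\<close>: barycentres outside a ball, by
  second moments; those inside it but away from G, by \<open>far_from_G\<close> and the deficit
  bound; and failures of near maximality of nearby points \<open>z i\<close> of G. The radius
  depends on \<open>\<kappa>\<close> alone, because later \<open>\<delta>\<close> and
  \<open>s\<close> are chosen from compact sets inside that ball.\<close>

lemma near_argmax:
  assumes \<kappa>: "0 < \<kappa>"
  shows "\<exists>R>0. \<forall>\<delta> s. 0 < \<delta> \<longrightarrow> 0 < s \<longrightarrow> (\<exists>\<epsilon>>0. \<forall>N w x. decomp \<epsilon> N w x \<longrightarrow>
    (\<exists>z I. (\<forall>i\<in>I. z i \<in> G \<and> norm (z i) \<le> R \<and> norm (x i - z i) \<le> \<delta>) \<and>
      QP N w (\<lambda>i \<omega>. i \<notin> I \<or> \<not> approx G s (z i) (Y \<omega>)) \<le> \<kappa>))"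
proof -
  define V where "V = (\<integral>\<omega>. (norm (Y \<omega>))\<^sup>2 \<partial>M)"
  have V: "0 \<le> V" by (simp add: V_def)
  \<comment> \<open>Chebyshev: with this radius the labels whose barycentre lies outside the ball
    have mass at most one third of \<open>\<kappa>\<close>.\<close>
  define R0 where "R0 = sqrt (3 * (V + 1) / \<kappa>)"
  have R0: "0 < R0" "V / R0\<^sup>2 \<le> \<kappa> / 3"
  proof -
    show "0 < R0" using V \<kappa> by (simp add: R0_def)
    have "R0\<^sup>2 = 3 * (V + 1) / \<kappa>" using V \<kappa> by (simp add: R0_def)
    then have "V \<le> \<kappa> / 3 * R0\<^sup>2" using \<kappa> by simp
    then show "V / R0\<^sup>2 \<le> \<kappa> / 3" using \<open>0 < R0\<close> by (simp add: pos_divide_le_eq)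
  qed
  show ?thesis
  proof (rule exI[of _ "R0 + 1"], intro conjI allI impI)
    show "0 < R0 + 1" using R0 by simp
    fix \<delta> s :: real assume \<delta>: "0 < \<delta>" and s: "0 < s"
    \<comment> \<open>Besides \<open>\<delta>\<close> and 1, the last entry makes
      \<open>q (x i - z i)\<close> at most \<open>s * \<kappa> / 6\<close>, half of what Markov's
      inequality may cost.\<close>
    define \<eta> where "\<eta> = Min {\<delta>, 1, s * \<kappa> / (3 * C)}"
    have \<eta>: "0 < \<eta>" "\<eta> \<le> \<delta>" "\<eta> \<le> 1" "\<eta> \<le> s * \<kappa> / (3 * C)" using \<delta> s \<kappa> C_pos by (auto simp: \<eta>_def)
    have \<eta>C: "C / 2 * \<eta>\<^sup>2 \<le> s * \<kappa> / 6"
    proof -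
      have "\<eta> * \<eta> \<le> s * \<kappa> / (3 * C) * 1" using \<eta> s \<kappa> C_pos by (intro mult_mono) auto
      then have "C / 2 * \<eta>\<^sup>2 \<le> C / 2 * (s * \<kappa> / (3 * C))" using C_pos by (intro mult_left_mono) (auto simp: power2_eq_square)
      also have "\<dots> = s * \<kappa> / 6" using C_pos by simp
      finally show ?thesis .
    qed
    obtain c where c: "0 < c" "\<And>x. norm x \<le> R0 \<Longrightarrow> \<eta> \<le> infdist x G \<Longrightarrow> \<exists>z\<in>G. q (x - z) \<le> - c"
      using far_from_G[OF G \<eta>(1), of R0] by blast
    \<comment> \<open>The first entry bounds the mass of labels violating monotonicity by at least
      \<open>c\<close>; the second is the other half of the Markov budget.\<close>
    define \<epsilon> where "\<epsilon> = min (c * \<kappa> / 3) (s * \<kappa> / 6)"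
    have \<epsilon>: "0 < \<epsilon>" "\<epsilon> \<le> c * \<kappa> / 3" "\<epsilon> \<le> s * \<kappa> / 6" using c \<kappa> s by (auto simp: \<epsilon>_def)
    show "\<exists>\<epsilon>>0. \<forall>N w x. decomp \<epsilon> N w x \<longrightarrow>
      (\<exists>z I. (\<forall>i\<in>I. z i \<in> G \<and> norm (z i) \<le> R0 + 1 \<and> norm (x i - z i) \<le> \<delta>) \<and>
      QP N w (\<lambda>i \<omega>. i \<notin> I \<or> \<not> approx G s (z i) (Y \<omega>)) \<le> \<kappa>)"
    proof (intro exI[of _ \<epsilon>] conjI \<epsilon>(1) allI impI)
      fix N w x assume d: "decomp \<epsilon> N w x"
      note w = decompD(1)[OF d]
      define I where "I = {i. i < N \<and> norm (x i) \<le> R0 \<and> infdist (x i) G < \<eta>}"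
      define F where "F = {i. i < N \<and> norm (x i) \<le> R0 \<and> \<eta> \<le> infdist (x i) G}"
      have "\<exists>z\<in>G. norm (x i - z) < \<eta>" if "i \<in> I" for i
      proof -
        have "infdist (x i) G < \<eta>" using that by (simp add: I_def)
        then have "\<exists>z\<in>G. dist (x i) z < \<eta>"
          using max_S_monotone_nonempty[OF G] by (simp add: infdist_notempty cINF_less_iff)
        then show ?thesis by (simp add: dist_norm)
      qed
      then obtain z where z: "\<And>i. i \<in> I \<Longrightarrow> z i \<in> G \<and> norm (x i - z i) < \<eta>" by metis
      have "\<exists>v\<in>G. q (x i - v) \<le> - c" if "i \<in> F" for i using c(2) that by (simp add: F_def)
      then obtain v where v: "\<And>i. i \<in> F \<Longrightarrow> v i \<in> G \<and> q (x i - v i) \<le> - c" by metis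
      have IN: "I \<subseteq> {..<N}" "F \<subseteq> {..<N}" by (auto simp: I_def F_def)
      have finI: "finite I" "finite F" using IN finite_subset by blast+
      have far: "(\<Sum>i\<in>F. mass w i) \<le> \<kappa> / 3"
      proof -
        have "0 \<le> (\<Sum>i\<in>F. \<integral>\<omega>. w i \<omega> * (\<Psi> \<omega> - h (v i) (Y \<omega>)) \<partial>M)"
        proof (intro sum_nonneg integral_nonneg_AE)
          fix i assume i: "i \<in> F"
          then have iN: "i < N" by (simp add: F_def)
          show "AE \<omega> in M. 0 \<le> w i \<omega> * (\<Psi> \<omega> - h (v i) (Y \<omega>))"
            using \<Psi>_ub by eventually_elim (use weightsD(2)[OF w iN] v[OF i] in auto)
        qed
        also have "\<dots> \<le> \<epsilon> + (\<Sum>i\<in>F. mass w i * q (x i - v i))" using v by (intro deficit_le[OF d IN(2)]) auto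
        also have "(\<Sum>i\<in>F. mass w i * q (x i - v i)) \<le> (\<Sum>i\<in>F. mass w i * (- c))"
          using v mass_nonneg[OF w] by (intro sum_mono mult_left_mono) (auto simp: F_def)
        also have "\<dots> = - (c * (\<Sum>i\<in>F. mass w i))" by (simp add: sum_distrib_left sum_negf mult.commute)
        finally have "c * (\<Sum>i\<in>F. mass w i) \<le> c * (\<kappa> / 3)" using \<epsilon>(2) by simp
        then show ?thesis using c(1) by (simp only: mult_le_cancel_left_pos)
      qed
      have out: "(\<Sum>i<N. if R0 < norm (x i) then mass w i else 0) \<le> \<kappa> / 3"
      proof -
        have "(\<Sum>i<N. if R0 < norm (x i) then mass w i else 0) \<le> (\<Sum>i<N. mass w i * (norm (x i))\<^sup>2 / R0\<^sup>2)"
        proof (intro sum_mono)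
          fix i assume "i \<in> {..<N}"
          then have m: "0 \<le> mass w i" using mass_nonneg[OF w] by simp
          show "(if R0 < norm (x i) then mass w i else 0) \<le> mass w i * (norm (x i))\<^sup>2 / R0\<^sup>2"
          proof (cases "R0 < norm (x i)")
            case True
            then have "R0\<^sup>2 \<le> (norm (x i))\<^sup>2" using R0(1) by (intro power_mono) auto
            then have "mass w i * R0\<^sup>2 \<le> mass w i * (norm (x i))\<^sup>2" using m by (intro mult_left_mono)
            then show ?thesis using True R0(1) by (simp add: field_simps)
          qed (use m in simp)
        qed
        also have "\<dots> = (\<Sum>i<N. mass w i * (norm (x i))\<^sup>2) / R0\<^sup>2" by (simp add: sum_divide_distrib)
        also have "\<dots> \<le> V / R0\<^sup>2" using second_moment_le[OF d] by (intro divide_right_mono) (auto simp: V_def)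
        finally show ?thesis using R0(2) by linarith
      qed
      have "QP N w (\<lambda>i \<omega>. i \<notin> I) \<le> \<kappa> / 3 + \<kappa> / 3"
      proof (rule QP_le_sum[OF w, where F = "\<lambda>i \<omega>. R0 < norm (x i)" and H = "\<lambda>i \<omega>. i \<in> F"])
        show "QP N w (\<lambda>i \<omega>. R0 < norm (x i)) \<le> \<kappa> / 3" using out by (simp add: QP_index)
        have "QP N w (\<lambda>i \<omega>. i \<in> F) = (\<Sum>i\<in>{..<N} \<inter> F. mass w i)"
          unfolding QP_index by (simp add: sum.inter_restrict)
        then show "QP N w (\<lambda>i \<omega>. i \<in> F) \<le> \<kappa> / 3" using far IN(2) by (simp add: Int_absorb1)
      qed (auto simp: I_def F_def)
      moreover have "QP N w (\<lambda>i \<omega>. i \<in> I \<and> \<not> approx G s (z i) (Y \<omega>)) \<le> \<kappa> / 3"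
      proof -
        have "s * QP N w (\<lambda>i \<omega>. i \<in> I \<and> \<not> approx G s (z i) (Y \<omega>)) \<le> \<epsilon> + (\<Sum>i\<in>I. mass w i * q (x i - z i))"
          using z by (intro deficit_prob_le[OF d s IN(1)]) auto
        also have "(\<Sum>i\<in>I. mass w i * q (x i - z i)) \<le> (\<Sum>i\<in>I. mass w i * (s * \<kappa> / 6))"
        proof (intro sum_mono mult_left_mono)
          fix i assume i: "i \<in> I"
          have "q (x i - z i) \<le> C / 2 * (norm (x i - z i))\<^sup>2" using q_bound[of "x i - z i"] by linarith
          also have "\<dots> \<le> C / 2 * \<eta>\<^sup>2" using z[OF i] C_pos by (intro mult_left_mono power_mono) auto
          finally show "q (x i - z i) \<le> s * \<kappa> / 6" using \<eta>C by linarith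
          show "0 \<le> mass w i" using mass_nonneg[OF w] i by (simp add: I_def)
        qed
        also have "\<dots> = (\<Sum>i\<in>I. mass w i) * (s * \<kappa> / 6)" by (simp add: sum_distrib_right)
        also have "\<dots> \<le> 1 * (s * \<kappa> / 6)"
        proof (rule mult_right_mono)
          have "(\<Sum>i\<in>I. mass w i) \<le> (\<Sum>i<N. mass w i)"
            using IN mass_nonneg[OF w] by (intro sum_mono2) auto
          then show "(\<Sum>i\<in>I. mass w i) \<le> 1" using mass_sum[OF w] by simp
        qed (use s \<kappa> in simp)
        finally have "s * QP N w (\<lambda>i \<omega>. i \<in> I \<and> \<not> approx G s (z i) (Y \<omega>)) \<le> s * (\<kappa> / 3)"
          using \<epsilon>(3) by simp
        then show ?thesis using s by (simp only: mult_le_cancel_left_pos)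
      qed
      ultimately have "QP N w (\<lambda>i \<omega>. i \<notin> I \<or> \<not> approx G s (z i) (Y \<omega>)) \<le> (\<kappa> / 3 + \<kappa> / 3) + \<kappa> / 3"
        by (intro QP_le_sum[OF w, where F = "\<lambda>i \<omega>. i \<notin> I" and H = "\<lambda>i \<omega>. i \<in> I \<and> \<not> approx G s (z i) (Y \<omega>)"
              and a = "\<kappa> / 3 + \<kappa> / 3" and b = "\<kappa> / 3"]) auto
      moreover have "z i \<in> G \<and> norm (z i) \<le> R0 + 1 \<and> norm (x i - z i) \<le> \<delta>" if "i \<in> I" for i
      proof -
        have "norm (z i) \<le> norm (x i) + norm (x i - z i)" using norm_triangle_sub[of "z i" "x i"] by (simp add: norm_minus_commute)
        then show ?thesis using z[OF that] that \<eta> by (auto simp: I_def)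
      qed
      ultimately show "\<exists>z I. (\<forall>i\<in>I. z i \<in> G \<and> norm (z i) \<le> R0 + 1 \<and> norm (x i - z i) \<le> \<delta>) \<and>
        QP N w (\<lambda>i \<omega>. i \<notin> I \<or> \<not> approx G s (z i) (Y \<omega>)) \<le> \<kappa>"
        by (intro exI[of _ z] exI[of _ I]) auto
    qed
  qed
qed

lemma hits2_pred [measurable]:
  assumes "compact K"
  shows "Measurable.pred M (\<lambda>\<omega>. Y \<omega> \<in> hits2 G K s)"
proof -
  have [measurable]: "hits2 G K s \<in> sets borel" using hits2_closed[OF G_closed assms] by simp
  show ?thesis by measurable
qed

text \<open>Continuity of probability along \<open>hits2_Inter\<close>: outside a small event, a
  near maximising pair in \<open>K\<close> exists only if an exact one does.\<close>

lemma hits2_small: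
  assumes K: "compact K" and \<kappa>: "0 < \<kappa>"
  obtains s where "0 < s" "prob {\<omega>\<in>space M. Y \<omega> \<in> hits2 G K s \<and> Y \<omega> \<notin> hits2 G K 0} \<le> \<kappa>"
proof -
  define E where "E n = {\<omega>\<in>space M. Y \<omega> \<in> hits2 G K (1 / real (Suc n)) \<and> Y \<omega> \<notin> hits2 G K 0}" for n
  have [measurable]: "E n \<in> sets M" for n
    unfolding E_def using hits2_pred[OF K, of "1 / real (Suc n)"] hits2_pred[OF K, of 0] by measurable
  have "decseq E" unfolding decseq_def E_def
  proof (intro allI impI)
    fix m n :: nat assume "m \<le> n"
    then have "hits2 G K (1 / real (Suc n)) \<subseteq> hits2 G K (1 / real (Suc m))"
      by (intro hits2_mono) (simp add: frac_le)
    then show "{\<omega>\<in>space M. Y \<omega> \<in> hits2 G K (1 / real (Suc n)) \<and> Y \<omega> \<notin> hits2 G K 0}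
      \<subseteq> {\<omega>\<in>space M. Y \<omega> \<in> hits2 G K (1 / real (Suc m)) \<and> Y \<omega> \<notin> hits2 G K 0}" by blast
  qed
  then have "(\<lambda>n. prob (E n)) \<longlonglongrightarrow> prob (\<Inter>n. E n)"
    by (intro finite_Lim_measure_decseq) auto
  moreover have "(\<Inter>n. E n) = {}" using hits2_Inter[OF G_closed K] unfolding E_def by blast
  ultimately have "eventually (\<lambda>n. prob (E n) < \<kappa>) sequentially"
    using \<kappa> by (intro order_tendstoD(2)[of _ 0]) auto
  then obtain n where "prob (E n) < \<kappa>" by (auto simp: eventually_sequentially)
  then show thesis by (intro that[of "1 / real (Suc n)"]) (auto simp: E_def)
qed

text \<open>Under a nearly optimal decomposition, Y in A is nearly an event about the label alone; then
  nearly nothing is lost in averaging over the label on that event.\<close>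

definition almost_label_event :: "(real^'n) set \<Rightarrow> bool" where
  "almost_label_event A \<longleftrightarrow> A \<in> sets borel \<and> (\<forall>\<delta>>0. \<exists>\<epsilon>>0. \<forall>N w x. decomp \<epsilon> N w x \<longrightarrow>
     (\<exists>J. QP N w (\<lambda>i \<omega>. (Y \<omega> \<in> A) \<noteq> (i \<in> J)) \<le> \<delta>))"

lemma almost_label_event_meas: "almost_label_event A \<Longrightarrow> Measurable.pred M (\<lambda>\<omega>. Y \<omega> \<in> A)"
proof -
  assume "almost_label_event A"
  then have [measurable]: "A \<in> sets borel" by (simp add: almost_label_event_def)
  show ?thesis by measurable
qed

lemma almost_label_eventD:
  "almost_label_event A \<Longrightarrow> 0 < \<delta> \<Longrightarrow> \<exists>\<epsilon>>0. \<forall>N w x. decomp \<epsilon> N w x \<longrightarrow>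
     (\<exists>J. QP N w (\<lambda>i \<omega>. (Y \<omega> \<in> A) \<noteq> (i \<in> J)) \<le> \<delta>)"
  by (simp add: almost_label_event_def)

lemma almost_label_event_empty: "almost_label_event {}"
  unfolding almost_label_event_def
  by (intro conjI allI impI exI[of _ 1] exI[of _ "{}"]) (auto simp: QP_def EQ_def)

lemma almost_label_event_Compl:
  assumes A: "almost_label_event A"
  shows "almost_label_event (UNIV - A)"
  unfolding almost_label_event_def
proof (intro conjI allI impI)
  show "UNIV - A \<in> sets borel" using A by (auto simp: almost_label_event_def)
  fix \<delta> :: real assume "0 < \<delta>"
  then obtain \<epsilon> where \<epsilon>: "0 < \<epsilon>" "\<And>N w x. decomp \<epsilon> N w x \<Longrightarrow> \<exists>J. QP N w (\<lambda>i \<omega>. (Y \<omega> \<in> A) \<noteq> (i \<in> J)) \<le> \<delta>"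
    using A unfolding almost_label_event_def by blast
  show "\<exists>\<epsilon>>0. \<forall>N w x. decomp \<epsilon> N w x \<longrightarrow> (\<exists>J. QP N w (\<lambda>i \<omega>. (Y \<omega> \<in> UNIV - A) \<noteq> (i \<in> J)) \<le> \<delta>)"
  proof (intro exI[of _ \<epsilon>] conjI \<epsilon>(1) allI impI)
    fix N w x assume "decomp \<epsilon> N w x"
    then obtain J where J: "QP N w (\<lambda>i \<omega>. (Y \<omega> \<in> A) \<noteq> (i \<in> J)) \<le> \<delta>" using \<epsilon>(2) by blast
    have "(\<lambda>i \<omega>. (Y \<omega> \<in> UNIV - A) \<noteq> (i \<in> - J)) = (\<lambda>i \<omega>. (Y \<omega> \<in> A) \<noteq> (i \<in> J))"
      by auto
    then show "\<exists>J. QP N w (\<lambda>i \<omega>. (Y \<omega> \<in> UNIV - A) \<noteq> (i \<in> J)) \<le> \<delta>"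
      using J by (intro exI[of _ "- J"]) simp
  qed
qed

lemma almost_label_event_Un:
  assumes A: "almost_label_event A" and A': "almost_label_event A'"
  shows "almost_label_event (A \<union> A')"
  unfolding almost_label_event_def
proof (intro conjI allI impI)
  show "A \<union> A' \<in> sets borel" using A A' by (auto simp: almost_label_event_def)
  fix \<delta> :: real assume "0 < \<delta>"
  then have \<delta>: "0 < \<delta> / 2" by simp
  obtain \<epsilon>1 where \<epsilon>1: "0 < \<epsilon>1" "\<forall>N w x. decomp \<epsilon>1 N w x \<longrightarrow> (\<exists>J. QP N w (\<lambda>i \<omega>. (Y \<omega> \<in> A) \<noteq> (i \<in> J)) \<le> \<delta> / 2)"
    using almost_label_eventD[OF A \<delta>] by (elim exE conjE)
  obtain \<epsilon>2 where \<epsilon>2: "0 < \<epsilon>2" "\<forall>N w x. decomp \<epsilon>2 N w x \<longrightarrow> (\<exists>J. QP N w (\<lambda>i \<omega>. (Y \<omega> \<in> A') \<noteq> (i \<in> J)) \<le> \<delta> / 2)"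
    using almost_label_eventD[OF A' \<delta>] by (elim exE conjE)
  define \<epsilon> where "\<epsilon> = min \<epsilon>1 \<epsilon>2"
  show "\<exists>\<epsilon>>0. \<forall>N w x. decomp \<epsilon> N w x \<longrightarrow> (\<exists>J. QP N w (\<lambda>i \<omega>. (Y \<omega> \<in> A \<union> A') \<noteq> (i \<in> J)) \<le> \<delta>)"
  proof (intro exI[of _ \<epsilon>] conjI allI impI)
    show "0 < \<epsilon>" using \<epsilon>1 \<epsilon>2 by (simp add: \<epsilon>_def)
    fix N w x assume d: "decomp \<epsilon> N w x"
    have "decomp \<epsilon>1 N w x" "decomp \<epsilon>2 N w x" using d decomp_mono by (auto simp: \<epsilon>_def)
    then obtain J1 J2 where J: "QP N w (\<lambda>i \<omega>. (Y \<omega> \<in> A) \<noteq> (i \<in> J1)) \<le> \<delta> / 2"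
      "QP N w (\<lambda>i \<omega>. (Y \<omega> \<in> A') \<noteq> (i \<in> J2)) \<le> \<delta> / 2"
      using \<epsilon>1(2) \<epsilon>2(2) by blast
    note [measurable] = almost_label_event_meas[OF A] almost_label_event_meas[OF A']
    have "QP N w (\<lambda>i \<omega>. (Y \<omega> \<in> A \<union> A') \<noteq> (i \<in> J1 \<union> J2)) \<le> \<delta> / 2 + \<delta> / 2"
    proof (rule QP_le_sum[OF decompD(1)[OF d] _ _ _ _ J])
      show "Measurable.pred M (\<lambda>\<omega>. (Y \<omega> \<in> A \<union> A') \<noteq> (i \<in> J1 \<union> J2))" for i
        unfolding Un_iff by measurable
    qed (measurable, auto)
    then show "\<exists>J. QP N w (\<lambda>i \<omega>. (Y \<omega> \<in> A \<union> A') \<noteq> (i \<in> J)) \<le> \<delta>"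
      by (intro exI[of _ "J1 \<union> J2"]) simp
  qed
qed

text \<open>By continuity of probability a finite union differs from the whole one on an event of
  small probability, so its label set can be used.\<close>

lemma almost_label_event_UN:
  assumes A: "\<And>n :: nat. almost_label_event (A n)"
  shows "almost_label_event (\<Union>n. A n)"
  unfolding almost_label_event_def
proof (intro conjI allI impI)
  have [measurable]: "A n \<in> sets borel" for n using A by (auto simp: almost_label_event_def)
  show "(\<Union>n. A n) \<in> sets borel" by measurable
  fix \<delta> :: real assume \<delta>: "0 < \<delta>"
  define U where "U n = (\<Union>k\<le>n. A k)" for n
  have U: "almost_label_event (U n)" for n
  proof (induction n)
    case 0 then show ?case using A[of 0] by (simp add: U_def)
  next
    case (Suc n)
    have "U (Suc n) = U n \<union> A (Suc n)" by (auto simp: U_def atMost_Suc)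
    then show ?case using almost_label_event_Un[OF Suc A] by simp
  qed
  note [measurable] = almost_label_event_meas[OF U] almost_label_event_meas[OF A]
  have [measurable]: "Measurable.pred M (\<lambda>\<omega>. Y \<omega> \<in> (\<Union>n. A n))" unfolding UN_iff by measurable
  have UU: "(\<Union>n. U n) = (\<Union>n. A n)" by (auto simp: U_def)
  define E where "E n = {\<omega>\<in>space M. Y \<omega> \<in> (\<Union>n. A n) \<and> Y \<omega> \<notin> U n}" for n
  have [measurable]: "E n \<in> sets M" for n unfolding E_def by measurable
  have "decseq E" by (auto simp: decseq_def E_def U_def)
  then have "(\<lambda>n. prob (E n)) \<longlonglongrightarrow> prob (\<Inter>n. E n)"
    by (intro finite_Lim_measure_decseq) auto
  moreover have "(\<Inter>n. E n) = {}" unfolding E_def using UU by blast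
  ultimately have "eventually (\<lambda>n. prob (E n) < \<delta> / 2) sequentially"
    using \<delta> by (intro order_tendstoD(2)[of _ 0]) auto
  then obtain n where n: "prob (E n) < \<delta> / 2" by (auto simp: eventually_sequentially)
  have \<delta>2: "0 < \<delta> / 2" using \<delta> by simp
  obtain \<epsilon> where \<epsilon>: "0 < \<epsilon>" "\<forall>N w x. decomp \<epsilon> N w x \<longrightarrow> (\<exists>J. QP N w (\<lambda>i \<omega>. (Y \<omega> \<in> U n) \<noteq> (i \<in> J)) \<le> \<delta> / 2)"
    using almost_label_eventD[OF U[of n] \<delta>2] by (elim exE conjE)
  show "\<exists>\<epsilon>>0. \<forall>N w x. decomp \<epsilon> N w x \<longrightarrow> (\<exists>J. QP N w (\<lambda>i \<omega>. (Y \<omega> \<in> (\<Union>n. A n)) \<noteq> (i \<in> J)) \<le> \<delta>)"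
  proof (intro exI[of _ \<epsilon>] conjI \<epsilon>(1) allI impI)
    fix N w x assume d: "decomp \<epsilon> N w x"
    then obtain J where J: "QP N w (\<lambda>i \<omega>. (Y \<omega> \<in> U n) \<noteq> (i \<in> J)) \<le> \<delta> / 2" using \<epsilon>(2) by blast
    have "QP N w (\<lambda>i \<omega>. (Y \<omega> \<in> (\<Union>n. A n)) \<noteq> (i \<in> J)) \<le> \<delta> / 2 + \<delta> / 2"
    proof (rule QP_le_sum[OF decompD(1)[OF d] _ _ _ _ J])
      show "QP N w (\<lambda>i \<omega>. Y \<omega> \<in> (\<Union>n. A n) \<and> Y \<omega> \<notin> U n) \<le> \<delta> / 2"
        using n by (subst QP_fun[OF decompD(1)[OF d]]) (auto simp: E_def)
      show "AE \<omega> in M. (Y \<omega> \<in> (\<Union>n. A n)) \<noteq> (i \<in> J) \<longrightarrow> (Y \<omega> \<in> U n) \<noteq> (i \<in> J) \<or> (Y \<omega> \<in> (\<Union>n. A n) \<and> Y \<omega> \<notin> U n)" for i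
        unfolding UU[symmetric] by (intro AE_I2) blast
    qed measurable
    then show "\<exists>J. QP N w (\<lambda>i \<omega>. (Y \<omega> \<in> (\<Union>n. A n)) \<noteq> (i \<in> J)) \<le> \<delta>" by (intro exI[of _ J]) simp
  qed
qed

end

locale dual_optimum = potential S M Y G \<Psi> for S :: "real^'n^'n" and M :: "'a measure"
    and Y :: "'a \<Rightarrow> real^'n" and G :: "(real^'n) set" and \<Psi> :: "'a \<Rightarrow> real" +
  assumes opt: "dual_bound (\<integral>\<omega>. \<Psi> \<omega> \<partial>M)"
    and Sigma1_null: "AE \<omega> in M. Y \<omega> \<notin> Sigma1 S G"
begin

lemma decomp_exists:
  assumes "0 < \<epsilon>"
  obtains N w x where "decomp \<epsilon> N w x"
  using near_optimal_decomposition[OF opt assms] unfolding decomp_def by blast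

text \<open>The labels selected are those with \<open>q (x i - z)\<close> small for some
  \<open>z\<close> in \<open>K\<close> and G. For a selected label, the deficit bound makes that
  \<open>z\<close> nearly maximal, so P(Y) meets \<open>K\<close> up to a small event. If P(Y) meets
  \<open>K\<close> at \<open>u\<close> but the label is not selected, then \<open>u\<close> and a
  point of G near \<open>x i\<close> are near maximisers whose difference has \<open>q\<close>
  bounded below; exact pairs of that kind put \<open>Y\<close> in \<open>Sigma1\<close>.\<close>

lemma almost_label_event_hits_compact:
  assumes K: "compact K"
  shows "almost_label_event {y. PG S G y \<inter> K \<noteq> {}}" (is "almost_label_event ?A")
  unfolding almost_label_event_def
proof (intro conjI allI impI)
  have clA: "closed ?A" by (rule hits_closed[OF G_closed K])
  then show "?A \<in> sets borel" by simp
  have [measurable]: "Measurable.pred M (\<lambda>\<omega>. Y \<omega> \<in> ?A)"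
  proof -
    have [measurable]: "?A \<in> sets borel" using clA by simp
    show ?thesis by measurable
  qed
  fix \<delta> :: real assume \<delta>: "0 < \<delta>"
  have \<delta>4: "0 < \<delta> / 4" using \<delta> by simp
  define K' where "K' = K \<inter> G"
  have K': "compact K'" unfolding K'_def by (intro compact_Int_closed K G_closed)
  define K1 where "K1 = (\<lambda>z. (z, z)) ` K'"
  have K1: "compact K1" unfolding K1_def by (intro compact_continuous_image K' continuous_intros)
  have A1: "hits2 G K1 0 = ?A"
    unfolding hits2_def PG_approx[symmetric] K1_def K'_def using PG_subset[of G] by fastforce
  obtain s1 where s1: "0 < s1" "prob {\<omega>\<in>space M. Y \<omega> \<in> hits2 G K1 s1 \<and> Y \<omega> \<notin> hits2 G K1 0} \<le> \<delta> / 4"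
    using hits2_small[OF K1, of "\<delta> / 4"] \<delta> by auto
  \<comment> \<open>The threshold defining the label set; decomposition error plus threshold is at
    most \<open>2 * \<rho>\<close>, that is \<open>s1 * (\<delta> / 4)\<close>.\<close>
  define \<rho> where "\<rho> = s1 * \<delta> / 8"
  have \<rho>: "0 < \<rho>" using s1 \<delta> by (simp add: \<rho>_def)
  obtain R where R: "0 < R" "\<forall>\<eta> s. 0 < \<eta> \<longrightarrow> 0 < s \<longrightarrow> (\<exists>\<epsilon>>0. \<forall>N w x. decomp \<epsilon> N w x \<longrightarrow>
    (\<exists>z I. (\<forall>i\<in>I. z i \<in> G \<and> norm (z i) \<le> R \<and> norm (x i - z i) \<le> \<eta>) \<and>
      QP N w (\<lambda>i \<omega>. i \<notin> I \<or> \<not> approx G s (z i) (Y \<omega>)) \<le> \<delta> / 4))"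
    using near_argmax[OF \<delta>4] by (elim exE conjE)
  \<comment> \<open>Pairs that witness \<open>Sigma1\<close> when both members are exact maximisers.
    Half of the threshold is kept because \<open>x i\<close> will be replaced by a nearby point of
    G.\<close>
  define K2 where "K2 = (K' \<times> (cball 0 R \<inter> G)) \<inter> {p. \<rho> / 2 \<le> q (fst p - snd p)}"
  have K2: "compact K2" unfolding K2_def
    by (intro compact_Int_closed compact_Times K' compact_cball G_closed closed_Collect_le continuous_intros)
  obtain s2 where s2: "0 < s2" "prob {\<omega>\<in>space M. Y \<omega> \<in> hits2 G K2 s2 \<and> Y \<omega> \<notin> hits2 G K2 0} \<le> \<delta> / 4"
    using hits2_small[OF K2, of "\<delta> / 4"] \<delta> by auto
  have null2: "AE \<omega> in M. Y \<omega> \<notin> hits2 G K2 0"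
    using Sigma1_null
  proof eventually_elim
    case (elim \<omega>)
    show ?case
    proof
      assume "Y \<omega> \<in> hits2 G K2 0"
      then obtain a b where "(a, b) \<in> K2" "a \<in> PG S G (Y \<omega>)" "b \<in> PG S G (Y \<omega>)"
        by (auto simp: hits2_def PG_approx)
      then show False using elim \<rho> by (force simp: K2_def Sigma1_iff)
    qed
  qed
  obtain k where k: "0 < k" "\<And>z. z \<in> K' \<Longrightarrow> norm z \<le> k"
    using compact_imp_bounded[OF K'] by (auto simp: bounded_pos)
  define den where "den = C * (1 + R + k)"
  have den: "0 < den" using C_pos R(1) k(1) by (simp add: den_def)
  \<comment> \<open>Moving \<open>x i\<close> by at most \<open>\<eta>\<close> to \<open>z i\<close>
    changes \<open>q (x i - u)\<close> by at most half of the threshold, uniformly for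
    \<open>u\<close> in \<open>K'\<close>.\<close>
  define \<eta> where "\<eta> = min 1 (\<rho> / (2 * den))"
  have \<eta>: "0 < \<eta>" "\<eta> \<le> 1" "C * \<eta> * (1 + R + k) \<le> \<rho> / 2"
  proof -
    show "0 < \<eta>" "\<eta> \<le> 1" using \<rho> den by (auto simp: \<eta>_def)
    have "\<eta> * den \<le> \<rho> / (2 * den) * den"
      using den by (intro mult_right_mono) (auto simp: \<eta>_def)
    also have "\<dots> = \<rho> / 2" using den by simp
    finally show "C * \<eta> * (1 + R + k) \<le> \<rho> / 2" by (simp add: den_def algebra_simps)
  qed
  obtain \<epsilon>1 where \<epsilon>1: "0 < \<epsilon>1" "\<forall>N w x. decomp \<epsilon>1 N w x \<longrightarrow>
    (\<exists>z I. (\<forall>i\<in>I. z i \<in> G \<and> norm (z i) \<le> R \<and> norm (x i - z i) \<le> \<eta>) \<and>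
      QP N w (\<lambda>i \<omega>. i \<notin> I \<or> \<not> approx G s2 (z i) (Y \<omega>)) \<le> \<delta> / 4)"
    using R(2)[rule_format, OF \<eta>(1) s2(1)] by (elim exE conjE)
  define \<epsilon> where "\<epsilon> = min \<epsilon>1 \<rho>"
  show "\<exists>\<epsilon>>0. \<forall>N w x. decomp \<epsilon> N w x \<longrightarrow> (\<exists>J. QP N w (\<lambda>i \<omega>. (Y \<omega> \<in> ?A) \<noteq> (i \<in> J)) \<le> \<delta>)"
  proof (intro exI[of _ \<epsilon>] conjI allI impI)
    show "0 < \<epsilon>" using \<epsilon>1 \<rho> by (simp add: \<epsilon>_def)
    fix N w x assume d: "decomp \<epsilon> N w x"
    note w = decompD(1)[OF d]
    define J where "J = {i. i < N \<and> (\<exists>z\<in>K'. q (x i - z) \<le> \<rho>)}"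
    have JN: "J \<subseteq> {..<N}" by (auto simp: J_def)
    have "\<exists>z\<in>K'. q (x i - z) \<le> \<rho>" if "i \<in> J" for i using that by (simp add: J_def)
    then obtain v where v: "\<And>i. i \<in> J \<Longrightarrow> v i \<in> K' \<and> q (x i - v i) \<le> \<rho>" by metis
    have 1: "QP N w (\<lambda>i \<omega>. i \<in> J \<and> \<not> approx G s1 (v i) (Y \<omega>)) \<le> \<delta> / 4"
    proof -
      have "s1 * QP N w (\<lambda>i \<omega>. i \<in> J \<and> \<not> approx G s1 (v i) (Y \<omega>)) \<le> \<epsilon> + (\<Sum>i\<in>J. mass w i * q (x i - v i))"
        using v by (intro deficit_prob_le[OF d s1(1) JN]) (auto simp: K'_def)
      also have "(\<Sum>i\<in>J. mass w i * q (x i - v i)) \<le> (\<Sum>i\<in>J. mass w i * \<rho>)"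
        using v mass_nonneg[OF w] by (intro sum_mono mult_left_mono) (auto simp: J_def)
      also have "\<dots> = (\<Sum>i\<in>J. mass w i) * \<rho>" by (simp add: sum_distrib_right)
      also have "\<dots> \<le> 1 * \<rho>"
      proof (rule mult_right_mono)
        have "(\<Sum>i\<in>J. mass w i) \<le> (\<Sum>i<N. mass w i)"
          using JN mass_nonneg[OF w] by (intro sum_mono2) auto
        then show "(\<Sum>i\<in>J. mass w i) \<le> 1" using mass_sum[OF w] by simp
      qed (use \<rho> in simp)
      finally have "s1 * QP N w (\<lambda>i \<omega>. i \<in> J \<and> \<not> approx G s1 (v i) (Y \<omega>)) \<le> s1 * (\<delta> / 4)"
        by (simp add: \<epsilon>_def \<rho>_def)
      then show ?thesis using s1(1) by (simp only: mult_le_cancel_left_pos)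
    qed
    note [measurable] = hits2_pred[OF K1] hits2_pred[OF K2]
    have J1: "QP N w (\<lambda>i \<omega>. i \<in> J \<and> Y \<omega> \<notin> ?A) \<le> \<delta> / 4 + \<delta> / 4"
    proof (rule QP_le_sum[OF w _ _ _ _ 1])
      show "QP N w (\<lambda>i \<omega>. Y \<omega> \<in> hits2 G K1 s1 \<and> Y \<omega> \<notin> hits2 G K1 0) \<le> \<delta> / 4"
        using s1(2) by (subst QP_fun[OF w]) auto
      show "AE \<omega> in M. i \<in> J \<and> Y \<omega> \<notin> ?A \<longrightarrow> i \<in> J \<and> \<not> approx G s1 (v i) (Y \<omega>) \<or> Y \<omega> \<in> hits2 G K1 s1 \<and> Y \<omega> \<notin> hits2 G K1 0" for i
        unfolding A1[symmetric] using v[of i] by (intro AE_I2) (auto simp: hits2_def K1_def)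
    qed measurable
    have d1: "decomp \<epsilon>1 N w x" using d decomp_mono by (auto simp: \<epsilon>_def)
    obtain z I where zI': "\<forall>i\<in>I. z i \<in> G \<and> norm (z i) \<le> R \<and> norm (x i - z i) \<le> \<eta>"
      and I: "QP N w (\<lambda>i \<omega>. i \<notin> I \<or> \<not> approx G s2 (z i) (Y \<omega>)) \<le> \<delta> / 4"
      using \<epsilon>1(2)[rule_format, OF d1] by (elim exE conjE)
    note zI = bspec[OF zI']
    have J2: "QP N w (\<lambda>i \<omega>. i \<notin> J \<and> Y \<omega> \<in> ?A) \<le> \<delta> / 4 + \<delta> / 4"
    proof (rule QP_le_sum[OF w _ _ _ _ I])
      show "QP N w (\<lambda>i \<omega>. Y \<omega> \<in> hits2 G K2 s2 \<and> Y \<omega> \<notin> hits2 G K2 0) \<le> \<delta> / 4"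
        using s2(2) by (subst QP_fun[OF w]) auto
      show "AE \<omega> in M. i \<notin> J \<and> Y \<omega> \<in> ?A \<longrightarrow> (i \<notin> I \<or> \<not> approx G s2 (z i) (Y \<omega>)) \<or> Y \<omega> \<in> hits2 G K2 s2 \<and> Y \<omega> \<notin> hits2 G K2 0"
        if i: "i < N" for i
        using null2
      proof eventually_elim
        case (elim \<omega>)
        have "Y \<omega> \<in> hits2 G K2 s2" if a: "i \<notin> J" "Y \<omega> \<in> ?A" "i \<in> I" "approx G s2 (z i) (Y \<omega>)"
        proof -
          obtain u where u: "u \<in> K'" "approx G 0 u (Y \<omega>)"
            using a(2) PG_subset[of G "Y \<omega>"] unfolding K'_def by (auto simp flip: PG_approx)
          have zz: "z i \<in> G" "norm (z i) \<le> R" "norm (x i - z i) \<le> \<eta>" using zI[OF a(3)] by auto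
          have "\<rho> < q (x i - u)" using a(1) i u(1) by (auto simp: J_def not_le)
          moreover have "q (x i - u) - q (z i - u) \<le> \<rho> / 2"
          proof -
            have "q (x i - u) - q (z i - u) \<le> \<bar>q (x i - u) - q (z i - u)\<bar>" by simp
            also have "\<dots> \<le> C / 2 * norm ((x i - u) - (z i - u)) * (norm (x i - u) + norm (z i - u))"
              by (rule q_diff_bound)
            also have "(x i - u) - (z i - u) = x i - z i" by simp
            also have "C / 2 * norm (x i - z i) * (norm (x i - u) + norm (z i - u)) \<le> C / 2 * \<eta> * (2 * (1 + R + k))"
            proof -
              have a1: "norm (z i - u) \<le> R + k"
                using norm_triangle_ineq4[of "z i" u] zz(2) k(2)[OF u(1)] by linarith
              have "norm (x i - u) \<le> norm (x i - z i) + norm (z i - u)"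
                using norm_triangle_ineq[of "x i - z i" "z i - u"] by simp
              also have "\<dots> \<le> 1 + (R + k)" using a1 zz(3) \<eta>(2) by (intro add_mono) auto
              finally have "norm (x i - u) + norm (z i - u) \<le> (1 + (R + k)) + (R + k)"
                using a1 by (rule add_mono)
              then have "norm (x i - u) + norm (z i - u) \<le> 2 * (1 + R + k)" by simp
              then show ?thesis using zz C_pos \<eta>(1) by (intro mult_mono) auto
            qed
            also have "\<dots> = C * \<eta> * (1 + R + k)" by simp
            finally show ?thesis using \<eta>(3) by linarith
          qed
          ultimately have "\<rho> / 2 \<le> q (u - z i)" by (simp add: q_minus_commute[of u])
          then have "(u, z i) \<in> K2" using u(1) zz by (simp add: K2_def)
          moreover have "approx G s2 u (Y \<omega>)" using s2(1) by (intro approx_mono[OF u(2)]) simp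
          ultimately show ?thesis using a(4) unfolding hits2_def by (intro CollectI bexI[of _ "(u, z i)"]) auto
        qed
        then show ?case using elim by blast
      qed
    qed measurable
    have "QP N w (\<lambda>i \<omega>. (Y \<omega> \<in> ?A) \<noteq> (i \<in> J)) \<le> (\<delta> / 4 + \<delta> / 4) + (\<delta> / 4 + \<delta> / 4)"
    proof (rule QP_le_sum[OF w _ _ _ _ J1 J2])
      show "AE \<omega> in M. (Y \<omega> \<in> ?A) \<noteq> (i \<in> J) \<longrightarrow> i \<in> J \<and> Y \<omega> \<notin> ?A \<or> i \<notin> J \<and> Y \<omega> \<in> ?A" for i
        by (intro AE_I2) blast
    qed measurable
    then show "\<exists>J. QP N w (\<lambda>i \<omega>. (Y \<omega> \<in> ?A) \<noteq> (i \<in> J)) \<le> \<delta>" by (intro exI[of _ J]) simp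
  qed
qed

lemma almost_label_event_sigma_PG:
  assumes "A \<in> sets (sigma_PG S G)"
  shows "almost_label_event A"
  using assms unfolding sets_sigma_PG
proof (induction rule: sigma_sets.induct)
  case (Basic A)
  then obtain U where A: "A = {y. PG S G y \<inter> U \<noteq> {}}" "open U" by blast
  obtain K :: "nat \<Rightarrow> (real^'n) set" where K: "\<And>n. compact (K n)"
    "{y. PG S G y \<inter> U \<noteq> {}} = (\<Union>n. {y. PG S G y \<inter> K n \<noteq> {}})"
    by (rule hits_open_Union[OF A(2), of G]) blast
  show ?case unfolding A(1) K(2) by (intro almost_label_event_UN almost_label_event_hits_compact K(1))
qed (auto intro: almost_label_event_empty almost_label_event_Compl almost_label_event_UN)

text \<open>Near maximisers can be confined to one compact part of G up to small probability,
  whatever the slack; there the supremum is attained.\<close>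

lemma PG_nonempty: "AE \<omega> in M. PG S G (Y \<omega>) \<noteq> {}"
proof -
  have [measurable]: "{y. PG S G y \<inter> UNIV \<noteq> {}} \<in> sets borel"
    using hit_in_sigma_PG[of UNIV G] sigma_PG_subset_borel[OF G_closed] by blast
  have [measurable]: "Measurable.pred M (\<lambda>\<omega>. PG S G (Y \<omega>) = {})"
  proof -
    have "Measurable.pred M (\<lambda>\<omega>. Y \<omega> \<notin> {y. PG S G y \<inter> UNIV \<noteq> {}})" by measurable
    then show ?thesis by simp
  qed
  have "prob {\<omega>\<in>space M. PG S G (Y \<omega>) = {}} \<le> 0 + e" if e: "0 < e" for e
  proof -
    have e2: "0 < e / 2" using e by simp
    obtain R where R: "\<forall>\<eta> s. 0 < \<eta> \<longrightarrow> 0 < s \<longrightarrow> (\<exists>\<epsilon>>0. \<forall>N w x. decomp \<epsilon> N w x \<longrightarrow>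
      (\<exists>z I. (\<forall>i\<in>I. z i \<in> G \<and> norm (z i) \<le> R \<and> norm (x i - z i) \<le> \<eta>) \<and>
      QP N w (\<lambda>i \<omega>. i \<notin> I \<or> \<not> approx G s (z i) (Y \<omega>)) \<le> e / 2))"
      using near_argmax[OF e2] by (elim exE conjE)
    define K where "K = (\<lambda>z. (z, z)) ` (cball 0 R \<inter> G)"
    have K: "compact K" unfolding K_def
      by (intro compact_continuous_image compact_Int_closed compact_cball G_closed continuous_intros)
    note [measurable] = hits2_pred[OF K]
    obtain s where s: "0 < s" "prob {\<omega>\<in>space M. Y \<omega> \<in> hits2 G K s \<and> Y \<omega> \<notin> hits2 G K 0} \<le> e / 2"
      using hits2_small[OF K e2] by blast
    obtain \<epsilon> where \<epsilon>: "0 < \<epsilon>" "\<forall>N w x. decomp \<epsilon> N w x \<longrightarrow>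
      (\<exists>z I. (\<forall>i\<in>I. z i \<in> G \<and> norm (z i) \<le> R \<and> norm (x i - z i) \<le> 1) \<and>
      QP N w (\<lambda>i \<omega>. i \<notin> I \<or> \<not> approx G s (z i) (Y \<omega>)) \<le> e / 2)"
      using R[rule_format, OF zero_less_one s(1)] by (elim exE conjE)
    obtain N w x where d: "decomp \<epsilon> N w x" by (rule decomp_exists[OF \<epsilon>(1)])
    note w = decompD(1)[OF d]
    obtain z I where zI': "\<forall>i\<in>I. z i \<in> G \<and> norm (z i) \<le> R \<and> norm (x i - z i) \<le> 1"
      and I: "QP N w (\<lambda>i \<omega>. i \<notin> I \<or> \<not> approx G s (z i) (Y \<omega>)) \<le> e / 2"
      using \<epsilon>(2)[rule_format, OF d] by (elim exE conjE)
    note zI = bspec[OF zI']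
    have "QP N w (\<lambda>i \<omega>. PG S G (Y \<omega>) = {}) \<le> e / 2 + e / 2"
    proof (rule QP_le_sum[OF w _ _ _ _ I])
      show "QP N w (\<lambda>i \<omega>. Y \<omega> \<in> hits2 G K s \<and> Y \<omega> \<notin> hits2 G K 0) \<le> e / 2"
        using s(2) by (subst QP_fun[OF w]) auto
      show "AE \<omega> in M. PG S G (Y \<omega>) = {} \<longrightarrow> (i \<notin> I \<or> \<not> approx G s (z i) (Y \<omega>)) \<or> Y \<omega> \<in> hits2 G K s \<and> Y \<omega> \<notin> hits2 G K 0" for i
        using zI[of i] by (intro AE_I2) (auto simp: hits2_def K_def PG_approx[symmetric])
    qed measurable
    then show ?thesis by (simp add: QP_fun[OF w])
  qed
  then have "prob {\<omega>\<in>space M. PG S G (Y \<omega>) = {}} \<le> 0" by (rule field_le_epsilon)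
  then have "prob {\<omega>\<in>space M. \<not> PG S G (Y \<omega>) \<noteq> {}} = 0" by (simp add: measure_le_0_iff)
  then show ?thesis by (subst AE_iff_measurable[OF _ refl]) (auto simp: emeasure_eq_measure)
qed

subsection \<open>The conditional expectation selects from the argmax map\<close>

text \<open>The slack e allows v and c to be restricted to a countable dense set, although P(Y) may be
  unbounded.\<close>

definition probe :: "real^'n \<Rightarrow> real^'n \<Rightarrow> real \<Rightarrow> real^'n \<Rightarrow> real" where
  "probe v c e k = v \<bullet> (k - c) - e * (1 + norm c + norm k)"

lemma probe_int: "integrable M (\<lambda>\<omega>. probe v c e (Y \<omega>))"
  unfolding probe_def
  by (intro Bochner_Integration.integrable_diff Bochner_Integration.integrable_add integrable_mult_right
      integrable_inner_right integrable_const Y_int Y_norm)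

lemma continuous_on_probe: "continuous_on UNIV (probe v c e)"
  unfolding probe_def by (intro continuous_intros)

text \<open>Jensen's inequality within a label: \<open>probe\<close> is concave because the norm
  enters with a negative coefficient, and \<open>x i\<close> is the mean of \<open>Y\<close> under
  label i.\<close>

lemma probe_concave:
  assumes d: "decomp \<epsilon> N w x" and i: "i < N" and e: "0 \<le> e"
  shows "(\<integral>\<omega>. w i \<omega> * probe v c e (Y \<omega>) \<partial>M) \<le> mass w i * probe v c e (x i)"
proof -
  note w = decompD(1)[OF d]
  have 1: "(\<integral>\<omega>. w i \<omega> * (0 + v \<bullet> (Y \<omega> - c)) \<partial>M) = mass w i * (v \<bullet> (x i - c))"
    unfolding moment_pair[OF w i] decompD(2)[OF d i] by (simp add: scaleR_diff_right[symmetric])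
  have 2: "mass w i * norm (x i) \<le> (\<integral>\<omega>. w i \<omega> * norm (Y \<omega>) \<partial>M)"
    using norm_moment[OF w i] mass_nonneg[OF w i] unfolding decompD(2)[OF d i] by simp
  have "(\<integral>\<omega>. w i \<omega> * probe v c e (Y \<omega>) \<partial>M)
    = (\<integral>\<omega>. w i \<omega> * (0 + v \<bullet> (Y \<omega> - c)) - (e * (1 + norm c) * w i \<omega> + e * (w i \<omega> * norm (Y \<omega>))) \<partial>M)"
    by (intro Bochner_Integration.integral_cong) (auto simp: probe_def algebra_simps)
  also have "\<dots> = (\<integral>\<omega>. w i \<omega> * (0 + v \<bullet> (Y \<omega> - c)) \<partial>M) - (\<integral>\<omega>. e * (1 + norm c) * w i \<omega> + e * (w i \<omega> * norm (Y \<omega>)) \<partial>M)"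
    by (intro Bochner_Integration.integral_diff Bochner_Integration.integrable_add weights_int_real[OF w i]
        integrable_mult_right weights_integrable[OF w i] integrable_const integrable_inner_right
        Bochner_Integration.integrable_diff Y_int Y_norm)
  also have "(\<integral>\<omega>. e * (1 + norm c) * w i \<omega> + e * (w i \<omega> * norm (Y \<omega>)) \<partial>M)
    = e * (1 + norm c) * mass w i + e * (\<integral>\<omega>. w i \<omega> * norm (Y \<omega>) \<partial>M)"
    unfolding mass_def
    by (subst Bochner_Integration.integral_add)
       (auto intro!: integrable_mult_right weights_int_real[OF w i] weights_integrable[OF w i] Y_norm)
  finally show ?thesis unfolding 1 using mult_left_mono[OF 2 e]
    by (simp add: probe_def algebra_simps)
qed

text \<open>The event that \<open>Y\<close> lies in \<open>A\<close> is exchanged for a label event,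
  on which Jensen's inequality replaces \<open>Y\<close> by the barycentre. The barycentre is close
  to a near maximiser, and on \<open>A\<close> all exact maximisers have nonpositive probe. Unlikely
  exceptions are controlled by second moments.\<close>

lemma probe_integral_nonpos:
  assumes A: "A \<in> sets (sigma_PG S G)" and e: "0 < e"
    and le: "\<And>y k. y \<in> A \<Longrightarrow> k \<in> PG S G y \<Longrightarrow> probe v c e k \<le> 0"
  shows "(\<integral>\<omega>. (if Y \<omega> \<in> A then probe v c e (Y \<omega>) else 0) \<partial>M) \<le> 0"
proof -
  define l where "l = probe v c e"
  \<comment> \<open>One constant for both the linear growth and the Lipschitz bound of
    \<open>probe\<close>.\<close>
  define \<Lambda> where "\<Lambda> = (norm v + e) * (1 + norm c)"
  have \<Lambda>: "0 < \<Lambda>" using e by (simp add: \<Lambda>_def add_nonneg_pos add_pos_nonneg)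
  have l_bound: "\<bar>l k\<bar> \<le> \<Lambda> * (1 + norm k)" for k
  proof -
    have "norm (k - c) \<le> norm k + norm c" by (rule norm_triangle_ineq4)
    then have "norm v * norm (k - c) \<le> norm v * (norm k + norm c)" by (intro mult_left_mono) auto
    then have "\<bar>v \<bullet> (k - c)\<bar> \<le> norm v * (norm k + norm c)"
      using Cauchy_Schwarz_ineq2[of v "k - c"] by linarith
    also have "\<dots> \<le> norm v * ((1 + norm c) * (1 + norm k))"
      by (intro mult_left_mono) (auto simp: algebra_simps)
    finally have 1: "\<bar>v \<bullet> (k - c)\<bar> \<le> norm v * ((1 + norm c) * (1 + norm k))" .
    have "e * (1 + norm c + norm k) \<le> e * ((1 + norm c) * (1 + norm k))"
      using e by (intro mult_left_mono) (auto simp: algebra_simps)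
    moreover have "0 \<le> e * (1 + norm c + norm k)" using e by simp
    ultimately have "\<bar>l k\<bar> \<le> norm v * ((1 + norm c) * (1 + norm k)) + e * ((1 + norm c) * (1 + norm k))"
      using 1 unfolding l_def probe_def by linarith
    then show ?thesis by (simp add: \<Lambda>_def algebra_simps)
  qed
  have l_lip: "l k - \<Lambda> * norm (k - k') \<le> l k'" for k k'
  proof -
    have "v \<bullet> (k - c) - v \<bullet> (k' - c) = v \<bullet> (k - k')" by (simp add: inner_diff_right)
    then have "v \<bullet> (k - c) - v \<bullet> (k' - c) \<le> norm v * norm (k - k')"
      using Cauchy_Schwarz_ineq2[of v "k - k'"] by linarith
    moreover have "e * norm k' - e * norm k \<le> e * norm (k - k')"
    proof -
      have "norm k' - norm k \<le> norm (k - k')" by (metis norm_minus_commute norm_triangle_ineq2)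
      then have "e * (norm k' - norm k) \<le> e * norm (k - k')" using e by (intro mult_left_mono) auto
      then show ?thesis by (simp add: right_diff_distrib)
    qed
    ultimately have "l k - l k' \<le> (norm v + e) * norm (k - k')"
      unfolding l_def probe_def by (simp add: algebra_simps)
    also have "\<dots> \<le> \<Lambda> * norm (k - k')"
      unfolding \<Lambda>_def using e by (intro mult_right_mono) (auto simp: algebra_simps)
    finally show ?thesis by simp
  qed
  define V where "V = (\<integral>\<omega>. (norm (Y \<omega>))\<^sup>2 \<partial>M)"
  have V: "0 \<le> V" by (simp add: V_def)
  have [measurable]: "Measurable.pred M (\<lambda>\<omega>. Y \<omega> \<in> A)" by (rule almost_label_event_meas[OF almost_label_event_sigma_PG[OF A]])
  have [measurable]: "(\<lambda>\<omega>. l (Y \<omega>)) \<in> borel_measurable M" unfolding l_def using probe_int by auto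
  have lY_int: "integrable M (\<lambda>\<omega>. l (Y \<omega>))" unfolding l_def by (rule probe_int)
  have ind_int: "integrable M (\<lambda>\<omega>. if Y \<omega> \<in> A then l (Y \<omega>) else 0)"
    by (rule Bochner_Integration.integrable_bound[OF lY_int]) auto
  have "(\<integral>\<omega>. (if Y \<omega> \<in> A then l (Y \<omega>) else 0) \<partial>M) \<le> 0 + \<xi>" if \<xi>: "0 < \<xi>" for \<xi>
  proof -
    \<comment> \<open>Each of the two exchanges costs \<open>\<xi> / 8\<close> through the second
      moment and \<open>\<xi> / 8\<close> through the exceptional probability \<open>p\<close>. With
      \<open>\<theta> = \<xi> / 4\<close> the total is three quarters of
      \<open>\<xi>\<close>.\<close>
    define \<kappa> where "\<kappa> = \<xi> / (16 * \<Lambda> * (1 + V))"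
    have \<kappa>: "0 < \<kappa>" "\<Lambda> * (2 * \<kappa> * (1 + V)) = \<xi> / 8"
    proof -
      show "0 < \<kappa>" using \<xi> \<Lambda> V by (simp add: \<kappa>_def)
      have "\<kappa> * (16 * \<Lambda> * (1 + V)) = \<xi>"
      proof -
        have den: "16 * \<Lambda> * (1 + V) \<noteq> 0" using \<Lambda> V by simp
        show ?thesis by (simp only: \<kappa>_def times_divide_eq_left nonzero_mult_div_cancel_right[OF den])
      qed
      then show "\<Lambda> * (2 * \<kappa> * (1 + V)) = \<xi> / 8" by (simp add: algebra_simps)
    qed
    define p where "p = \<xi> * \<kappa> / (2 * \<Lambda>)"
    have p: "0 < p" "\<Lambda> * (1 / (4 * \<kappa>) * p) = \<xi> / 8" using \<xi> \<kappa>(1) \<Lambda> by (auto simp: p_def field_simps)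
    have p4: "0 < p / 4" using p by simp
    obtain \<epsilon>1 where \<epsilon>1: "0 < \<epsilon>1" "\<forall>N w x. decomp \<epsilon>1 N w x \<longrightarrow> (\<exists>J. QP N w (\<lambda>i \<omega>. (Y \<omega> \<in> A) \<noteq> (i \<in> J)) \<le> p / 4)"
      using almost_label_eventD[OF almost_label_event_sigma_PG[OF A] p4] by (elim exE conjE)
    obtain R where R: "\<forall>\<eta> s. 0 < \<eta> \<longrightarrow> 0 < s \<longrightarrow> (\<exists>\<epsilon>>0. \<forall>N w x. decomp \<epsilon> N w x \<longrightarrow>
      (\<exists>z I. (\<forall>i\<in>I. z i \<in> G \<and> norm (z i) \<le> R \<and> norm (x i - z i) \<le> \<eta>) \<and>
      QP N w (\<lambda>i \<omega>. i \<notin> I \<or> \<not> approx G s (z i) (Y \<omega>)) \<le> p / 4))"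
      using near_argmax[OF p4] by (elim exE conjE)
    define \<theta> where "\<theta> = \<xi> / 4"
    have \<theta>: "0 < \<theta>" using \<xi> by (simp add: \<theta>_def)
    \<comment> \<open>Points of G where the probe is clearly positive. A near maximiser there would,
      outside a small event, produce an exact one, which is excluded on \<open>A\<close>.\<close>
    define K where "K = (\<lambda>z. (z, z)) ` ((cball 0 R \<inter> G) \<inter> {z. \<theta> / 2 \<le> l z})"
    have K: "compact K" unfolding K_def l_def
      by (intro compact_continuous_image compact_Int_closed compact_cball G_closed closed_Collect_le
          continuous_on_probe continuous_intros)
    obtain s where s: "0 < s" "prob {\<omega>\<in>space M. Y \<omega> \<in> hits2 G K s \<and> Y \<omega> \<notin> hits2 G K 0} \<le> p / 4"
      using hits2_small[OF K p4] by blast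
    note [measurable] = hits2_pred[OF K]
    define \<eta> where "\<eta> = \<theta> / (2 * \<Lambda>)"
    have \<eta>: "0 < \<eta>" "\<Lambda> * \<eta> = \<theta> / 2" using \<theta> \<Lambda> by (auto simp: \<eta>_def)
    obtain \<epsilon>2 where \<epsilon>2: "0 < \<epsilon>2" "\<forall>N w x. decomp \<epsilon>2 N w x \<longrightarrow>
      (\<exists>z I. (\<forall>i\<in>I. z i \<in> G \<and> norm (z i) \<le> R \<and> norm (x i - z i) \<le> \<eta>) \<and>
      QP N w (\<lambda>i \<omega>. i \<notin> I \<or> \<not> approx G s (z i) (Y \<omega>)) \<le> p / 4)"
      using R[rule_format, OF \<eta>(1) s(1)] by (elim exE conjE)
    have "0 < min \<epsilon>1 \<epsilon>2" using \<epsilon>1 \<epsilon>2 by simp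
    then obtain N w x where d: "decomp (min \<epsilon>1 \<epsilon>2) N w x" by (rule decomp_exists)
    note w = decompD(1)[OF d]
    have d1: "decomp \<epsilon>1 N w x" and d2: "decomp \<epsilon>2 N w x" using d decomp_mono by auto
    obtain J where J: "QP N w (\<lambda>i \<omega>. (Y \<omega> \<in> A) \<noteq> (i \<in> J)) \<le> p / 4"
      using \<epsilon>1(2)[rule_format, OF d1] by (elim exE)
    obtain z I where zI': "\<forall>i\<in>I. z i \<in> G \<and> norm (z i) \<le> R \<and> norm (x i - z i) \<le> \<eta>"
      and I: "QP N w (\<lambda>i \<omega>. i \<notin> I \<or> \<not> approx G s (z i) (Y \<omega>)) \<le> p / 4"
      using \<epsilon>2(2)[rule_format, OF d2] by (elim exE conjE)
    note zI = bspec[OF zI']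
    define bad1 where "bad1 i \<omega> \<longleftrightarrow> (i \<notin> I \<or> \<not> approx G s (z i) (Y \<omega>)) \<or> (Y \<omega> \<in> hits2 G K s \<and> Y \<omega> \<notin> hits2 G K 0)" for i \<omega>
    define bad where "bad i \<omega> \<longleftrightarrow> ((Y \<omega> \<in> A) \<noteq> (i \<in> J)) \<or> bad1 i \<omega>" for i \<omega>
    have [measurable]: "Measurable.pred M (bad1 i)" for i unfolding bad1_def[abs_def] by measurable
    have [measurable]: "Measurable.pred M (bad i)" for i unfolding bad_def[abs_def] by measurable
    have "QP N w (\<lambda>i \<omega>. Y \<omega> \<in> hits2 G K s \<and> Y \<omega> \<notin> hits2 G K 0) \<le> p / 4"
      using s(2) by (subst QP_fun[OF w]) auto
    with I have "QP N w bad1 \<le> p / 4 + p / 4"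
      by (intro QP_le_sum[OF w, where F = "\<lambda>i \<omega>. i \<notin> I \<or> \<not> approx G s (z i) (Y \<omega>)"
            and H = "\<lambda>i \<omega>. Y \<omega> \<in> hits2 G K s \<and> Y \<omega> \<notin> hits2 G K 0"
            and a = "p / 4" and b = "p / 4"]) (measurable, auto simp: bad1_def)
    with J have "QP N w bad \<le> p / 4 + (p / 4 + p / 4)"
      by (intro QP_le_sum[OF w, where F = "\<lambda>i \<omega>. (Y \<omega> \<in> A) \<noteq> (i \<in> J)" and H = bad1
            and a = "p / 4" and b = "p / 4 + p / 4"]) (measurable, auto simp: bad_def)
    then have bad: "QP N w bad \<le> p" using p(1) by linarith
    have Jp: "QP N w (\<lambda>i \<omega>. (Y \<omega> \<in> A) \<noteq> (i \<in> J)) \<le> p" using J p(1) by linarith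
    have half: "0 \<le> \<Lambda> * (1 / (4 * \<kappa>))" using \<Lambda> \<kappa>(1) by simp
    have dist: "\<Lambda> * (a + b * r) = \<Lambda> * a + \<Lambda> * b * r" for a b r by (simp add: algebra_simps)
    let ?E1 = "\<lambda>i \<omega>. if (Y \<omega> \<in> A) \<noteq> (i \<in> J) then 1 else 0 :: real"
    let ?E2 = "\<lambda>i \<omega>. if bad i \<omega> then 1 else 0 :: real"
    have E1_int: "integrable M (?E1 i)" for i by (intro indicator_int) measurable
    have E2_int: "integrable M (?E2 i)" for i by (intro indicator_int) measurable
    have Y2_int: "integrable M (\<lambda>\<omega>. \<Lambda> * (2 * \<kappa> * (1 + (norm (Y \<omega>))\<^sup>2)))"
      by (intro integrable_mult_right Bochner_Integration.integrable_add integrable_const Y_sq)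
    have JlY_int: "integrable M (\<lambda>\<omega>. if i \<in> J then l (Y \<omega>) else 0)" for i
      using lY_int by (cases "i \<in> J") auto
    have "(\<integral>\<omega>. (if Y \<omega> \<in> A then l (Y \<omega>) else 0) \<partial>M) = EQ N w (\<lambda>i \<omega>. if Y \<omega> \<in> A then l (Y \<omega>) else 0)"
      by (rule EQ_fun[OF w ind_int, symmetric])
    also have "\<dots> \<le> EQ N w (\<lambda>i \<omega>. (if i \<in> J then l (Y \<omega>) else 0)
        + (\<Lambda> * (2 * \<kappa> * (1 + (norm (Y \<omega>))\<^sup>2)) + \<Lambda> * (1 / (4 * \<kappa>)) * ?E1 i \<omega>))"
    proof (intro EQ_mono[OF w] ind_int Bochner_Integration.integrable_add JlY_int Y2_int integrable_mult_right E1_int AE_I2)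
      fix i \<omega>
      have "\<Lambda> * ((1 + norm (Y \<omega>)) * ?E1 i \<omega>) \<le> \<Lambda> * (2 * \<kappa> * (1 + (norm (Y \<omega>))\<^sup>2) + 1 / (4 * \<kappa>) * ?E1 i \<omega>)"
        using \<Lambda> by (intro mult_left_mono linear_on_event_le \<kappa>(1)) auto
      then have "\<Lambda> * ((1 + norm (Y \<omega>)) * ?E1 i \<omega>) \<le> \<Lambda> * (2 * \<kappa> * (1 + (norm (Y \<omega>))\<^sup>2)) + \<Lambda> * (1 / (4 * \<kappa>)) * ?E1 i \<omega>"
        by (simp only: dist)
      moreover have "(if Y \<omega> \<in> A then l (Y \<omega>) else 0) \<le> (if i \<in> J then l (Y \<omega>) else 0) + \<Lambda> * ((1 + norm (Y \<omega>)) * ?E1 i \<omega>)"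
        using l_bound[of "Y \<omega>"] by (auto simp: abs_le_iff)
      ultimately show "(if Y \<omega> \<in> A then l (Y \<omega>) else 0) \<le> (if i \<in> J then l (Y \<omega>) else 0)
        + (\<Lambda> * (2 * \<kappa> * (1 + (norm (Y \<omega>))\<^sup>2)) + \<Lambda> * (1 / (4 * \<kappa>)) * ?E1 i \<omega>)" by linarith
    qed
    also have "\<dots> = EQ N w (\<lambda>i \<omega>. if i \<in> J then l (Y \<omega>) else 0)
      + (EQ N w (\<lambda>i \<omega>. \<Lambda> * (2 * \<kappa> * (1 + (norm (Y \<omega>))\<^sup>2))) + EQ N w (\<lambda>i \<omega>. \<Lambda> * (1 / (4 * \<kappa>)) * ?E1 i \<omega>))"
      by (simp only: EQ_add[OF w JlY_int Bochner_Integration.integrable_add[OF Y2_int integrable_mult_right[OF E1_int]]]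
          EQ_add[OF w Y2_int integrable_mult_right[OF E1_int]])
    also have "EQ N w (\<lambda>i \<omega>. \<Lambda> * (2 * \<kappa> * (1 + (norm (Y \<omega>))\<^sup>2))) = \<xi> / 8"
    proof -
      have "EQ N w (\<lambda>i \<omega>. \<Lambda> * (2 * \<kappa> * (1 + (norm (Y \<omega>))\<^sup>2))) = (\<integral>\<omega>. \<Lambda> * (2 * \<kappa> * (1 + (norm (Y \<omega>))\<^sup>2)) \<partial>M)"
        by (rule EQ_fun[OF w Y2_int])
      also have "\<dots> = \<Lambda> * (2 * \<kappa> * (1 + V))"
        unfolding V_def using Y_sq by (simp add: prob_space)
      finally show ?thesis using \<kappa>(2) by simp
    qed
    also have "EQ N w (\<lambda>i \<omega>. \<Lambda> * (1 / (4 * \<kappa>)) * ?E1 i \<omega>) \<le> \<xi> / 8"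
    proof -
      have "EQ N w (\<lambda>i \<omega>. \<Lambda> * (1 / (4 * \<kappa>)) * ?E1 i \<omega>) = \<Lambda> * (1 / (4 * \<kappa>)) * QP N w (\<lambda>i \<omega>. (Y \<omega> \<in> A) \<noteq> (i \<in> J))"
        unfolding EQ_cmult QP_def ..
      also have "\<dots> \<le> \<Lambda> * (1 / (4 * \<kappa>)) * p" by (rule mult_left_mono[OF Jp half])
      finally show ?thesis using p(2) by simp
    qed
    \<comment> \<open>Here the exchange pays off: membership in \<open>J\<close> is constant within
      a label, so the average of \<open>Y\<close> over the label may be taken inside
      \<open>probe\<close>.\<close>
    also have "EQ N w (\<lambda>i \<omega>. if i \<in> J then l (Y \<omega>) else 0) \<le> EQ N w (\<lambda>i \<omega>. if i \<in> J then l (x i) else 0)"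
      unfolding EQ_def
    proof (intro sum_mono)
      fix i assume "i \<in> {..<N}"
      then show "(\<integral>\<omega>. w i \<omega> * (if i \<in> J then l (Y \<omega>) else 0) \<partial>M) \<le> (\<integral>\<omega>. w i \<omega> * (if i \<in> J then l (x i) else 0) \<partial>M)"
        using probe_concave[OF d, of i e v c] e by (cases "i \<in> J") (auto simp: l_def mass_def)
    qed
    also have "EQ N w (\<lambda>i \<omega>. if i \<in> J then l (x i) else 0)
      \<le> EQ N w (\<lambda>i \<omega>. (\<theta> + \<Lambda> * (2 * \<kappa> * (1 + (norm (x i))\<^sup>2))) + \<Lambda> * (1 / (4 * \<kappa>)) * ?E2 i \<omega>)"
    proof (intro EQ_mono[OF w] Bochner_Integration.integrable_add integrable_const integrable_mult_right E2_int AE_I2)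
      fix i \<omega>
      have "\<Lambda> * ((1 + norm (x i)) * ?E2 i \<omega>) \<le> \<Lambda> * (2 * \<kappa> * (1 + (norm (x i))\<^sup>2) + 1 / (4 * \<kappa>) * ?E2 i \<omega>)"
        using \<Lambda> by (intro mult_left_mono linear_on_event_le \<kappa>(1)) auto
      then have 1: "\<Lambda> * ((1 + norm (x i)) * ?E2 i \<omega>) \<le> \<Lambda> * (2 * \<kappa> * (1 + (norm (x i))\<^sup>2)) + \<Lambda> * (1 / (4 * \<kappa>)) * ?E2 i \<omega>"
        by (simp only: dist)
      have "(if i \<in> J then l (x i) else 0) \<le> \<theta> + \<Lambda> * ((1 + norm (x i)) * ?E2 i \<omega>)"
      proof (cases "bad i \<omega>")
        case True
        have "0 \<le> \<Lambda> * (1 + norm (x i))" using \<Lambda> by simp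
        then show ?thesis using l_bound[of "x i"] \<theta> True by (auto simp: abs_le_iff)
      next
        case False
        then have nb: "Y \<omega> \<in> A \<longleftrightarrow> i \<in> J" "i \<in> I" "approx G s (z i) (Y \<omega>)"
          "Y \<omega> \<in> hits2 G K s \<Longrightarrow> Y \<omega> \<in> hits2 G K 0" by (auto simp: bad_def bad1_def)
        have "l (x i) \<le> \<theta>" if iJ: "i \<in> J"
        proof (rule ccontr)
          assume "\<not> l (x i) \<le> \<theta>"
          moreover have "\<Lambda> * norm (x i - z i) \<le> \<Lambda> * \<eta>" using zI[OF nb(2)] \<Lambda> by (intro mult_left_mono) auto
          ultimately have "\<theta> / 2 \<le> l (z i)" using l_lip[of "x i" "z i"] \<eta>(2) by linarith
          then have "(z i, z i) \<in> K" using zI[OF nb(2)] by (auto simp: K_def)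
          then have "Y \<omega> \<in> hits2 G K s" using nb(3) unfolding hits2_def
            by (intro CollectI bexI[of _ "(z i, z i)"]) auto
          then obtain k where "k \<in> PG S G (Y \<omega>)" "\<theta> / 2 \<le> l k"
            using nb(4) by (auto simp: hits2_def K_def PG_approx)
          then show False using le[of "Y \<omega>" k] nb(1) iJ \<theta> by (simp add: l_def)
        qed
        then show ?thesis using False \<theta> by auto
      qed
      with 1 show "(if i \<in> J then l (x i) else 0) \<le> (\<theta> + \<Lambda> * (2 * \<kappa> * (1 + (norm (x i))\<^sup>2))) + \<Lambda> * (1 / (4 * \<kappa>)) * ?E2 i \<omega>"
        by linarith
    qed
    also have "\<dots> = EQ N w (\<lambda>i \<omega>. \<theta> + \<Lambda> * (2 * \<kappa> * (1 + (norm (x i))\<^sup>2))) + EQ N w (\<lambda>i \<omega>. \<Lambda> * (1 / (4 * \<kappa>)) * ?E2 i \<omega>)"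
      by (intro EQ_add[OF w] integrable_const integrable_mult_right E2_int)
    also have "EQ N w (\<lambda>i \<omega>. \<theta> + \<Lambda> * (2 * \<kappa> * (1 + (norm (x i))\<^sup>2))) \<le> \<theta> + \<xi> / 8"
    proof -
      have "EQ N w (\<lambda>i \<omega>. \<theta> + \<Lambda> * (2 * \<kappa> * (1 + (norm (x i))\<^sup>2)))
        = (\<Sum>i<N. \<theta> * mass w i + \<Lambda> * (2 * \<kappa>) * mass w i + \<Lambda> * (2 * \<kappa>) * (mass w i * (norm (x i))\<^sup>2))"
        unfolding EQ_index by (intro sum.cong) (auto simp: algebra_simps)
      also have "\<dots> = \<theta> + \<Lambda> * (2 * \<kappa>) + \<Lambda> * (2 * \<kappa>) * (\<Sum>i<N. mass w i * (norm (x i))\<^sup>2)"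
        unfolding sum.distrib sum_distrib_left[symmetric] mass_sum[OF w] by simp
      also have "\<dots> \<le> \<theta> + \<Lambda> * (2 * \<kappa>) + \<Lambda> * (2 * \<kappa>) * V"
        using second_moment_le[OF d] \<Lambda> \<kappa>(1) by (intro add_left_mono mult_left_mono) (auto simp: V_def)
      also have "\<dots> = \<theta> + \<Lambda> * (2 * \<kappa> * (1 + V))" by (simp add: algebra_simps)
      finally show ?thesis using \<kappa>(2) by simp
    qed
    also have "EQ N w (\<lambda>i \<omega>. \<Lambda> * (1 / (4 * \<kappa>)) * ?E2 i \<omega>) \<le> \<xi> / 8"
    proof -
      have "EQ N w (\<lambda>i \<omega>. \<Lambda> * (1 / (4 * \<kappa>)) * ?E2 i \<omega>) = \<Lambda> * (1 / (4 * \<kappa>)) * QP N w bad"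
        unfolding EQ_cmult QP_def ..
      also have "\<dots> \<le> \<Lambda> * (1 / (4 * \<kappa>)) * p" by (rule mult_left_mono[OF bad half])
      finally show ?thesis using p(2) by simp
    qed
    finally show ?thesis using \<xi> by (simp add: \<theta>_def)
  qed
  then have "(\<integral>\<omega>. (if Y \<omega> \<in> A then l (Y \<omega>) else 0) \<partial>M) \<le> 0" by (rule field_le_epsilon)
  then show ?thesis unfolding l_def .
qed

definition sigma_PG_Y :: "'a measure" where
  "sigma_PG_Y = vimage_algebra (space M) Y (sigma_PG S G)"

definition X :: "'a \<Rightarrow> real^'n" where
  "X = vcond_exp M sigma_PG_Y Y"

lemma sets_sigma_PG_Y: "sets sigma_PG_Y = {Y -` A \<inter> space M | A. A \<in> sets (sigma_PG S G)}"
  unfolding sigma_PG_Y_def by (rule sets_vimage_algebra2) auto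

lemma space_sigma_PG_Y [simp]: "space sigma_PG_Y = space M"
  by (simp add: sigma_PG_Y_def)

lemma subalgebra_sigma_PG_Y: "subalgebra M sigma_PG_Y"
  unfolding subalgebra_def sets_sigma_PG_Y
  using sigma_PG_subset_borel[OF G_closed] by (auto intro: measurable_sets[OF Y_meas])

sublocale PGY: finite_measure_subalgebra M sigma_PG_Y
  by unfold_locales (rule subalgebra_sigma_PG_Y)

lemma probe_cond_exp:
  "AE \<omega> in M. real_cond_exp M sigma_PG_Y (\<lambda>\<omega>. probe v c e (Y \<omega>)) \<omega>
    = v \<bullet> (X \<omega> - c) - e * (1 + norm c + real_cond_exp M sigma_PG_Y (\<lambda>\<omega>. norm (Y \<omega>)) \<omega>)"
proof -
  define b where "b = - (v \<bullet> c) - e * (1 + norm c)"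
  have vY: "integrable M (\<lambda>\<omega>. v \<bullet> Y \<omega>)" by (intro integrable_inner_right Y_int)
  have eY: "integrable M (\<lambda>\<omega>. e * norm (Y \<omega>))" by (intro integrable_mult_right Y_norm)
  have eq: "probe v c e (Y \<omega>) = (v \<bullet> Y \<omega> - e * norm (Y \<omega>)) + b" for \<omega>
    by (simp add: probe_def b_def inner_diff_right algebra_simps)
  have "AE \<omega> in M. real_cond_exp M sigma_PG_Y (\<lambda>\<omega>. (v \<bullet> Y \<omega> - e * norm (Y \<omega>)) + b) \<omega>
    = real_cond_exp M sigma_PG_Y (\<lambda>\<omega>. v \<bullet> Y \<omega> - e * norm (Y \<omega>)) \<omega> + real_cond_exp M sigma_PG_Y (\<lambda>\<omega>. b) \<omega>"
    by (intro PGY.real_cond_exp_add Bochner_Integration.integrable_diff vY eY integrable_const)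
  moreover have "AE \<omega> in M. real_cond_exp M sigma_PG_Y (\<lambda>\<omega>. v \<bullet> Y \<omega> - e * norm (Y \<omega>)) \<omega>
    = real_cond_exp M sigma_PG_Y (\<lambda>\<omega>. v \<bullet> Y \<omega>) \<omega> - real_cond_exp M sigma_PG_Y (\<lambda>\<omega>. e * norm (Y \<omega>)) \<omega>"
    by (intro PGY.real_cond_exp_diff vY eY)
  moreover have "AE \<omega> in M. real_cond_exp M sigma_PG_Y (\<lambda>\<omega>. b) \<omega> = b"
    by (intro PGY.real_cond_exp_F_meas) auto
  moreover have "AE \<omega> in M. real_cond_exp M sigma_PG_Y (\<lambda>\<omega>. e * norm (Y \<omega>)) \<omega> = e * real_cond_exp M sigma_PG_Y (\<lambda>\<omega>. norm (Y \<omega>)) \<omega>"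
    by (intro PGY.real_cond_exp_cmult Y_norm)
  moreover have "AE \<omega> in M. real_cond_exp M sigma_PG_Y (\<lambda>\<omega>. v \<bullet> Y \<omega>) \<omega> = v \<bullet> X \<omega>"
    unfolding X_def by (rule PGY.vcond_exp_inner[OF Y_int])
  ultimately show ?thesis unfolding eq
    by eventually_elim (simp add: b_def inner_diff_right algebra_simps)
qed

text \<open>The points \<open>y\<close> at which P(y) lies where the probe is nonpositive form the
  complement of a set hitting an open set, hence a set of sigma(P). The integral inequality holds on
  each of its sigma(P)-measurable subsets and so passes to the conditional expectation.\<close>

lemma probe_X:
  assumes e: "0 < e"
  shows "AE \<omega> in M. (\<forall>k\<in>PG S G (Y \<omega>). probe v c e k \<le> 0) \<longrightarrow>
    v \<bullet> (X \<omega> - c) \<le> e * (1 + norm c + real_cond_exp M sigma_PG_Y (\<lambda>\<omega>. norm (Y \<omega>)) \<omega>)"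
proof -
  define A where "A = UNIV - {y. PG S G y \<inter> {k. 0 < probe v c e k} \<noteq> {}}"
  have "open {k. 0 < probe v c e k}"
    by (intro open_Collect_less continuous_on_probe continuous_intros)
  then have A: "A \<in> sets (sigma_PG S G)"
    unfolding A_def using sets.compl_sets[OF hit_in_sigma_PG[of _ G]] by simp
  have A_iff: "y \<in> A \<longleftrightarrow> (\<forall>k\<in>PG S G y. probe v c e k \<le> 0)" for y by (auto simp: A_def not_less)
  have "AE \<omega> in M. \<omega> \<in> Y -` A \<inter> space M \<longrightarrow> real_cond_exp M sigma_PG_Y (\<lambda>\<omega>. probe v c e (Y \<omega>)) \<omega> \<le> 0"
  proof (rule PGY.real_cond_exp_nonpos_on[OF probe_int])
    show "Y -` A \<inter> space M \<in> sets sigma_PG_Y" using A by (auto simp: sets_sigma_PG_Y)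
    fix C' assume C': "C' \<in> sets sigma_PG_Y" "C' \<subseteq> Y -` A \<inter> space M"
    then obtain A' where A': "A' \<in> sets (sigma_PG S G)" "C' = Y -` A' \<inter> space M" by (auto simp: sets_sigma_PG_Y)
    have "(\<integral>\<omega>\<in>C'. probe v c e (Y \<omega>) \<partial>M) = (\<integral>\<omega>. (if Y \<omega> \<in> A \<inter> A' then probe v c e (Y \<omega>) else 0) \<partial>M)"
      unfolding set_lebesgue_integral_def using C'(2)
      by (intro Bochner_Integration.integral_cong) (auto simp: A'(2) indicator_def)
    also have "\<dots> \<le> 0"
      using A A'(1) A_iff by (intro probe_integral_nonpos[OF _ e]) auto
    finally show "(\<integral>\<omega>\<in>C'. probe v c e (Y \<omega>) \<partial>M) \<le> 0" .
  qed
  then show ?thesis using probe_cond_exp[of v c e] AE_space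
    by eventually_elim (use A_iff in auto)
qed

text \<open>Separation from the closed convex set P(Y) by its closest point. Normal and base point
  are approximated from a countable dense set, so that one null set serves all probes.\<close>

theorem X_in_PG: "AE \<omega> in M. X \<omega> \<in> PG S G (Y \<omega>)"
proof -
  obtain Q :: "(real^'n) set" where Q: "countable Q" "\<And>U. open U \<Longrightarrow> U \<noteq> {} \<Longrightarrow> \<exists>d\<in>Q. d \<in> U"
    using countable_dense_exists by metis
  let ?N = "real_cond_exp M sigma_PG_Y (\<lambda>\<omega>. norm (Y \<omega>))"
  have "AE \<omega> in M. \<forall>v\<in>Q. \<forall>c\<in>Q. \<forall>n::nat. (\<forall>k\<in>PG S G (Y \<omega>). probe v c (1 / real (Suc n)) k \<le> 0) \<longrightarrow>
    v \<bullet> (X \<omega> - c) \<le> 1 / real (Suc n) * (1 + norm c + ?N \<omega>)"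
    unfolding AE_ball_countable[OF Q(1)] AE_all_countable
    by (intro ballI allI probe_X) simp
  then show ?thesis using PG_nonempty Sigma1_null
  proof eventually_elim
    case (elim \<omega>)
    define K where "K = PG S G (Y \<omega>)"
    have K: "convex K" "closed K" "K \<noteq> {}"
      unfolding K_def using elim PG_convex[OF G] PG_closed[OF G_closed] by auto
    show ?case
    proof (rule ccontr)
      assume nin: "X \<omega> \<notin> PG S G (Y \<omega>)"
      define k0 where "k0 = closest_point K (X \<omega>)"
      define v0 where "v0 = X \<omega> - k0"
      have k0: "k0 \<in> K" unfolding k0_def by (rule closest_point_in_set[OF K(2,3)])
      have v0: "v0 \<noteq> 0" using nin k0 by (auto simp: v0_def K_def)
      have dot: "v0 \<bullet> (k - k0) \<le> 0" if "k \<in> K" for k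
        using closest_point_dot[OF K(1,2) that, of "X \<omega>"] by (simp add: v0_def k0_def)
      \<comment> \<open>Bounds all error coefficients independently of the approximation, so the
        squared distance is at most \<open>b / Suc n\<close> for every \<open>n\<close>.\<close>
      define b where "b = 4 + 2 * norm k0 + norm (X \<omega>) + ?N \<omega>"
      have main: "(norm v0)\<^sup>2 \<le> 1 / real (Suc n) * b" for n
      proof -
        define e where "e = 1 / real (Suc n)"
        have e: "0 < e" "e \<le> 1" by (auto simp: e_def)
        obtain v where v: "v \<in> Q" "norm (v - v0) < e"
          using Q(2)[of "ball v0 e"] e by (auto simp: dist_norm norm_minus_commute)
        \<comment> \<open>The scale at which replacing \<open>k0\<close> by a dense point changes
          the pairing with \<open>v0\<close> by at most \<open>e\<close>.\<close>
        define r where "r = e / (1 + norm v0)"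
        have r: "0 < r" "r \<le> 1" "norm v0 * r \<le> e"
        proof -
          have p: "0 < 1 + norm v0" by (simp add: add_pos_nonneg)
          show "0 < r" using e p by (simp add: r_def)
          have "r * (1 + norm v0) = e" using p by (simp add: r_def)
          moreover have "0 \<le> r * norm v0" using \<open>0 < r\<close> by simp
          ultimately have "r \<le> e" "norm v0 * r \<le> e" using \<open>0 < r\<close> by (auto simp: algebra_simps)
          then show "r \<le> 1" "norm v0 * r \<le> e" using e by auto
        qed
        obtain c where c: "c \<in> Q" "norm (k0 - c) < r"
          using Q(2)[of "ball k0 r"] r by (auto simp: dist_norm)
        have v0c: "\<bar>v0 \<bullet> (k0 - c)\<bar> \<le> e"
        proof -
          have "norm v0 * norm (k0 - c) \<le> norm v0 * r" using c by (intro mult_left_mono) auto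
          then show ?thesis using Cauchy_Schwarz_ineq2[of v0 "k0 - c"] r(3) by linarith
        qed
        have dv: "\<bar>(v - v0) \<bullet> (k - c)\<bar> \<le> e * (norm k + norm c)" for k
        proof -
          have "norm (v - v0) * norm (k - c) \<le> e * (norm k + norm c)"
            using v e norm_triangle_ineq4[of k c] by (intro mult_mono) auto
          then show ?thesis using Cauchy_Schwarz_ineq2[of "v - v0" "k - c"] by linarith
        qed
        have "probe v c e k \<le> 0" if "k \<in> K" for k
        proof -
          have "v \<bullet> (k - c) = v0 \<bullet> (k - k0) + v0 \<bullet> (k0 - c) + (v - v0) \<bullet> (k - c)"
            by (simp add: inner_diff_right inner_diff_left)
          then have "v \<bullet> (k - c) \<le> e + e * (norm k + norm c)"
            using dot[OF that] v0c dv[of k] by linarith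
          then show ?thesis by (simp add: probe_def algebra_simps)
        qed
        then have up: "v \<bullet> (X \<omega> - c) \<le> e * (1 + norm c + ?N \<omega>)"
          using elim(1) v(1) c(1) unfolding e_def K_def by blast
        have "v \<bullet> (X \<omega> - c) = (norm v0)\<^sup>2 + v0 \<bullet> (k0 - c) + (v - v0) \<bullet> (X \<omega> - c)"
          unfolding power2_norm_eq_inner by (simp add: v0_def inner_diff_right inner_diff_left)
        then have "(norm v0)\<^sup>2 \<le> e * (1 + norm c + ?N \<omega>) + e + e * (norm (X \<omega>) + norm c)"
          using up v0c dv[of "X \<omega>"] by linarith
        also have "\<dots> = e * (2 + 2 * norm c + norm (X \<omega>) + ?N \<omega>)" by (simp add: algebra_simps)
        also have "\<dots> \<le> e * b"
        proof (rule mult_left_mono)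
          have "norm c \<le> norm k0 + norm (k0 - c)" using norm_triangle_sub[of c k0] by (simp add: norm_minus_commute)
          then show "2 + 2 * norm c + norm (X \<omega>) + ?N \<omega> \<le> b" using c(2) r(2) by (simp add: b_def)
        qed (use e in simp)
        finally show ?thesis by (simp add: e_def)
      qed
      have pos: "0 < (norm v0)\<^sup>2" using v0 by simp
      then have "0 < (norm v0)\<^sup>2 / (\<bar>b\<bar> + 1)" by (simp add: add_nonneg_pos)
      then obtain n where "1 / real (Suc n) < (norm v0)\<^sup>2 / (\<bar>b\<bar> + 1)" using nat_approx_posE by blast
      then have "1 / real (Suc n) * (\<bar>b\<bar> + 1) < (norm v0)\<^sup>2" by (simp add: pos_less_divide_eq add_nonneg_pos)
      moreover have "1 / real (Suc n) * b \<le> 1 / real (Suc n) * (\<bar>b\<bar> + 1)" by (intro mult_left_mono) auto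
      ultimately show False using main[of n] by linarith
    qed
  qed
qed

end

subsection \<open>Weak duality and optimal couplings\<close>

text \<open>The locale is also instantiated on a plan itself, with the two coordinate projections as
  \<open>Z\<close> and \<open>Y\<close>; weak duality for maps and for plans is then one
  lemma.\<close>

locale martingale_coupling = potential S M Y G \<Psi> for S :: "real^'n^'n" and M :: "'a measure"
    and Y :: "'a \<Rightarrow> real^'n" and G :: "(real^'n) set" and \<Psi> :: "'a \<Rightarrow> real" +
  fixes Z :: "'a \<Rightarrow> real^'n"
  assumes L2_Z: "L2 M Z" and mart: "mart M Z Y"
begin

lemma Z_meas [measurable]: "Z \<in> borel_measurable M"
  using L2_Z by (simp add: L2_def)

abbreviation FZ :: "'a measure" where "FZ \<equiv> sigma_rv M Z"

sublocale FZ: finite_measure_subalgebra M FZ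
  by unfold_locales (rule subalgebra_sigma_rv[OF Z_meas])

lemma cond_exp_Y: "AE \<omega> in M. vcond_exp M FZ Y \<omega> = Z \<omega>"
  using mart mart_iff[OF L2_Y L2_Z] by simp

lemma S_mult_meas [measurable]: "(\<lambda>x. S *v x) \<in> borel_measurable borel"
  by (intro borel_measurable_continuous_onI continuous_intros)

lemma B_meas [measurable]: "f \<in> borel_measurable M \<Longrightarrow> g \<in> borel_measurable M \<Longrightarrow> (\<lambda>\<omega>. B (f \<omega>) (g \<omega>)) \<in> borel_measurable M"
  unfolding Sform_def by (intro borel_measurable_inner measurable_compose[OF _ S_mult_meas])

lemma B_int:
  assumes f: "L2 M f" and g: "L2 M g"
  shows "integrable M (\<lambda>\<omega>. B (f \<omega>) (g \<omega>))"
proof (rule L2_prod_integrable[OF f g])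
  show "(\<lambda>\<omega>. B (f \<omega>) (g \<omega>)) \<in> borel_measurable M" using f g by (intro B_meas) (auto simp: L2_def)
qed (use B_bound C_pos in auto)

lemma qZ_int: "integrable M (\<lambda>\<omega>. q (Z \<omega>))"
  unfolding q_def using B_int[OF L2_Z L2_Z] by simp

lemma B_Z_Y: "(\<integral>\<omega>. B (Z \<omega>) (Y \<omega>) \<partial>M) = (\<integral>\<omega>. B (Z \<omega>) (Z \<omega>) \<partial>M)"
proof -
  let ?s = "\<lambda>\<omega>. S *v Z \<omega>"
  have eq: "B (Z \<omega>) y = (\<Sum>i\<in>UNIV. ?s \<omega> $ i * y $ i)" for \<omega> y
    by (simp add: B_commute[of "Z \<omega>" y]) (simp add: Sform_def inner_vec_def mult.commute)
  have int: "integrable M (\<lambda>\<omega>. ?s \<omega> $ i * f \<omega> $ i)" if f: "L2 M f" for f i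
  proof (rule L2_prod_integrable[OF L2_Z f])
    have [measurable]: "f \<in> borel_measurable M" using f by (simp add: L2_def)
    have [measurable]: "?s \<in> borel_measurable M" by (rule measurable_compose[OF Z_meas S_mult_meas])
    show "(\<lambda>\<omega>. ?s \<omega> $ i * f \<omega> $ i) \<in> borel_measurable M" by measurable
    show "\<bar>?s \<omega> $ i * f \<omega> $ i\<bar> \<le> C * norm (Z \<omega>) * norm (f \<omega>)" for \<omega>
    proof -
      have "\<bar>?s \<omega> $ i\<bar> \<le> norm (?s \<omega>)" by (rule component_le_norm_cart)
      also have "\<dots> \<le> onorm ((*v) S) * norm (Z \<omega>)" by (rule onorm[OF matrix_vector_mul_bounded_linear])
      also have "\<dots> \<le> C * norm (Z \<omega>)" by (simp add: C_def mult_right_mono)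
      finally have "\<bar>?s \<omega> $ i\<bar> * \<bar>f \<omega> $ i\<bar> \<le> (C * norm (Z \<omega>)) * norm (f \<omega>)"
        using component_le_norm_cart[of "f \<omega>" i] C_pos by (intro mult_mono) auto
      then show ?thesis by (simp add: abs_mult)
    qed
  qed (use C_pos in simp)
  have comp_eq: "(\<integral>\<omega>. ?s \<omega> $ i * Y \<omega> $ i \<partial>M) = (\<integral>\<omega>. ?s \<omega> $ i * Z \<omega> $ i \<partial>M)" for i
  proof -
    have sF: "(\<lambda>\<omega>. ?s \<omega> $ i) \<in> borel_measurable FZ"
      by (rule measurable_sigma_rv_comp[of "\<lambda>x. (S *v x) $ i"]) measurable
    have [measurable]: "(\<lambda>\<omega>. ?s \<omega> $ i) \<in> borel_measurable M"
      by (rule measurable_from_subalg[OF FZ.subalg sF])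
    have "(\<integral>\<omega>. ?s \<omega> $ i * Y \<omega> $ i \<partial>M) = (\<integral>\<omega>. ?s \<omega> $ i * real_cond_exp M FZ (\<lambda>\<omega>. Y \<omega> $ i) \<omega> \<partial>M)"
      by (rule FZ.real_cond_exp_intg(2)[symmetric]) (use int[OF L2_Y] sF in auto)
    also have "\<dots> = (\<integral>\<omega>. ?s \<omega> $ i * Z \<omega> $ i \<partial>M)"
    proof (rule integral_cong_AE)
      show "AE \<omega> in M. ?s \<omega> $ i * real_cond_exp M FZ (\<lambda>\<omega>. Y \<omega> $ i) \<omega> = ?s \<omega> $ i * Z \<omega> $ i"
        using cond_exp_Y by eventually_elim (auto simp: vcond_exp_def vec_eq_iff)
    qed measurable
    finally show ?thesis .
  qed
  show ?thesis unfolding eq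
    by (subst (1 2) Bochner_Integration.integral_sum) (auto simp: comp_eq int L2_Y L2_Z)
qed

lemma value_eq: "(\<integral>\<omega>. B (Z \<omega>) (Y \<omega>) / 2 \<partial>M) = (\<integral>\<omega>. q (Z \<omega>) \<partial>M)"
  using B_Z_Y by (simp add: q_def)

abbreviation W :: "'a \<Rightarrow> real" where "W \<equiv> real_cond_exp M FZ \<Psi>"

lemma cond_exp_h: "AE \<omega> in M. real_cond_exp M FZ (\<lambda>\<omega>. h z (Y \<omega>)) \<omega> = h z (Z \<omega>)"
proof -
  have i: "integrable M (\<lambda>\<omega>. (S *v z) \<bullet> Y \<omega>)" by (intro integrable_inner_right Y_int)
  have "AE \<omega> in M. real_cond_exp M FZ (\<lambda>\<omega>. (S *v z) \<bullet> Y \<omega> - q z) \<omega>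
     = real_cond_exp M FZ (\<lambda>\<omega>. (S *v z) \<bullet> Y \<omega>) \<omega> - real_cond_exp M FZ (\<lambda>\<omega>. q z) \<omega>"
    by (intro FZ.real_cond_exp_diff i) simp
  moreover have "AE \<omega> in M. real_cond_exp M FZ (\<lambda>\<omega>. q z) \<omega> = q z"
    by (intro FZ.real_cond_exp_F_meas) auto
  moreover note FZ.vcond_exp_inner[OF Y_int, of "S *v z"] cond_exp_Y
  ultimately show ?thesis unfolding h_inner by eventually_elim simp
qed

text \<open>Conditional monotonicity is applied for a countable dense part of G, giving one null
  set; continuity of \<open>h\<close> in its first argument extends it to G.\<close>

lemma W_ge: "AE \<omega> in M. \<forall>z\<in>G. h z (Z \<omega>) \<le> W \<omega>"
proof -
  obtain T where T: "countable T" "T \<subseteq> G" "G \<subseteq> closure T" by (rule separable)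
  have "AE \<omega> in M. \<forall>z\<in>T. h z (Z \<omega>) \<le> W \<omega>"
    unfolding AE_ball_countable[OF T(1)]
  proof
    fix z assume "z \<in> T"
    then have z: "z \<in> G" using T by auto
    have "AE \<omega> in M. real_cond_exp M FZ (\<lambda>\<omega>. h z (Y \<omega>)) \<omega> \<le> W \<omega>"
    proof (rule FZ.real_cond_exp_mono[OF _ h_int \<Psi>_int])
      show "AE \<omega> in M. h z (Y \<omega>) \<le> \<Psi> \<omega>" using \<Psi>_ub by eventually_elim (use z in auto)
    qed
    then show "AE \<omega> in M. h z (Z \<omega>) \<le> W \<omega>" using cond_exp_h[of z] by eventually_elim simp
  qed
  then show ?thesis
  proof eventually_elim
    case (elim \<omega>)
    have "closed {z. h z (Z \<omega>) \<le> W \<omega>}" by (intro closed_Collect_le continuous_intros)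
    moreover have "T \<subseteq> {z. h z (Z \<omega>) \<le> W \<omega>}" using elim by auto
    ultimately have "closure T \<subseteq> {z. h z (Z \<omega>) \<le> W \<omega>}" by (intro closure_minimal)
    then show ?case using T(3) by auto
  qed
qed

lemma W_ge_q: "AE \<omega> in M. q (Z \<omega>) \<le> W \<omega>"
  using W_ge
proof eventually_elim
  case (elim \<omega>)
  obtain z where "z \<in> G" "q (Z \<omega> - z) \<le> 0" by (rule max_S_monotone_nonpos[OF G])
  then show ?case using elim by (force simp: h_eq)
qed

lemma W_int: "integrable M W" "(\<integral>\<omega>. W \<omega> \<partial>M) = D"
  using FZ.real_cond_exp_int[OF \<Psi>_int] by auto

theorem weak_duality: "(\<integral>\<omega>. B (Z \<omega>) (Y \<omega>) / 2 \<partial>M) \<le> D"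
  unfolding value_eq W_int(2)[symmetric] by (intro integral_mono_AE qZ_int W_int W_ge_q)

context
  assumes attains: "D \<le> (\<integral>\<omega>. B (Z \<omega>) (Y \<omega>) / 2 \<partial>M)"
begin

lemma q_eq_D: "(\<integral>\<omega>. q (Z \<omega>) \<partial>M) = D"
  using weak_duality attains unfolding value_eq by linarith

lemma W_eq: "AE \<omega> in M. W \<omega> = q (Z \<omega>)"
proof -
  have "(\<integral>\<omega>. W \<omega> - q (Z \<omega>) \<partial>M) = 0"
    using W_int qZ_int by (simp add: q_eq_D)
  moreover have "AE \<omega> in M. 0 \<le> W \<omega> - q (Z \<omega>)" using W_ge_q by eventually_elim simp
  ultimately have "AE \<omega> in M. W \<omega> - q (Z \<omega>) = 0"
    using W_int qZ_int by (subst (asm) integral_nonneg_eq_0_iff_AE) auto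
  then show ?thesis by eventually_elim simp
qed

text \<open>Equality in weak duality gives \<open>h z (Z \<omega>) \<le> q (Z \<omega>)\<close> for
  all \<open>z\<close> in G, that is monotone relation of \<open>Z \<omega>\<close> to all of G;
  maximality does the rest.\<close>

lemma Z_in_G: "AE \<omega> in M. Z \<omega> \<in> G"
  using W_ge W_eq
proof eventually_elim
  case (elim \<omega>)
  show ?case using elim by (intro max_S_monotone_memI[OF G]) (force simp: h_eq)
qed

lemma Z_in_PG_Z: "AE \<omega> in M. Z \<omega> \<in> PG S G (Z \<omega>)"
  using Z_in_G
  by eventually_elim (use max_S_monotone_mono[OF G] in \<open>auto simp: PG_approx approx_def h_eq\<close>)

lemma Z_in_PG_Y: "AE \<omega> in M. Z \<omega> \<in> PG S G (Y \<omega>)"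
proof -
  have int: "integrable M (\<lambda>\<omega>. h (Z \<omega>) (Y \<omega>))"
    unfolding h_def by (intro Bochner_Integration.integrable_diff B_int L2_Z L2_Y qZ_int)
  have "(\<integral>\<omega>. h (Z \<omega>) (Y \<omega>) \<partial>M) = (\<integral>\<omega>. q (Z \<omega>) \<partial>M)"
    unfolding h_def using value_eq by (simp add: B_int[OF L2_Z L2_Y] qZ_int)
  then have "(\<integral>\<omega>. \<Psi> \<omega> - h (Z \<omega>) (Y \<omega>) \<partial>M) = 0"
    using \<Psi>_int int by (simp add: q_eq_D)
  moreover have "AE \<omega> in M. 0 \<le> \<Psi> \<omega> - h (Z \<omega>) (Y \<omega>)" using \<Psi>_ub Z_in_G by eventually_elim auto
  ultimately have "AE \<omega> in M. \<Psi> \<omega> - h (Z \<omega>) (Y \<omega>) = 0"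
    using \<Psi>_int int by (subst (asm) integral_nonneg_eq_0_iff_AE) auto
  then show ?thesis using \<Psi>_ub Z_in_G
    by eventually_elim (auto simp: PG_approx approx_def)
qed

text \<open>Given Z, the gap of a point k of G at Y has conditional mean q (Z - k), so by Markov's
  inequality it is small when k is close to P(Z).  Only countably many k and neighbourhoods of Y
  are needed, which avoids measurable selections.\<close>

lemma PG_Z_subset: "AE \<omega> in M. PG S G (Z \<omega>) \<subseteq> PG S G (Y \<omega>)"
proof -
  obtain T where T: "countable T" "T \<subseteq> G" "G \<subseteq> closure T" by (rule separable)
  obtain N :: "(real^'n) set set" where N: "countable N" "topological_basis N"
    using ex_countable_basis by blast
  have N_meas [measurable]: "A \<in> N \<Longrightarrow> A \<in> sets borel" for A
    using topological_basis_open[OF N(2)] by auto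
  let ?P = "\<lambda>A. real_cond_exp M FZ (\<lambda>\<omega>. indicator A (Y \<omega>))"
  have ind_int: "A \<in> N \<Longrightarrow> integrable M (\<lambda>\<omega>. indicator A (Y \<omega>) :: real)" for A
    by (rule Bochner_Integration.integrable_bound[of _ "\<lambda>_. 1 :: real"]) (auto simp: indicator_def)
  \<comment> \<open>Almost surely \<open>Y\<close> avoids every basic open set whose conditional
    probability given \<open>Z\<close> vanishes.\<close>
  have pos: "AE \<omega> in M. \<forall>A\<in>N. Y \<omega> \<in> A \<longrightarrow> 0 < ?P A \<omega>"
    unfolding AE_ball_countable[OF N(1)]
  proof
    fix A assume A: "A \<in> N"
    note [measurable] = N_meas[OF A]
    define E where "E = {\<omega>\<in>space M. ?P A \<omega> \<le> 0}"
    have EF: "E \<in> sets FZ"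
    proof -
      have "{\<omega>\<in>space FZ. ?P A \<omega> \<le> 0} \<in> sets FZ" by measurable
      moreover have "space FZ = space M" using FZ.subalg by (simp add: subalgebra_def)
      ultimately show ?thesis by (simp only: E_def)
    qed
    then have [measurable]: "E \<in> sets M" using FZ.subalg by (auto simp: subalgebra_def)
    have "(\<integral>\<omega>. indicator E \<omega> * indicator A (Y \<omega>) \<partial>M) = (\<integral>\<omega>. indicator E \<omega> * ?P A \<omega> \<partial>M)"
      using FZ.real_cond_exp_intA[OF ind_int[OF A] EF] by (simp add: set_lebesgue_integral_def)
    also have "\<dots> \<le> (\<integral>\<omega>. 0 \<partial>M)"
    proof (rule Bochner_Integration.integral_mono)
      show "integrable M (\<lambda>\<omega>. indicator E \<omega> * ?P A \<omega>)"
        using integrable_mult_indicator[OF \<open>E \<in> sets M\<close> FZ.real_cond_exp_int(1)[OF ind_int[OF A]]] by simp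
    qed (auto simp: E_def indicator_def)
    finally have "(\<integral>\<omega>. indicator E \<omega> * indicator A (Y \<omega>) \<partial>M) \<le> (0 :: real)" by simp
    moreover have "0 \<le> (\<integral>\<omega>. indicator E \<omega> * indicator A (Y \<omega>) \<partial>M :: real)"
      by (intro Bochner_Integration.integral_nonneg) auto
    moreover have int: "integrable M (\<lambda>\<omega>. indicator E \<omega> * indicator A (Y \<omega>) :: real)"
      using integrable_mult_indicator[OF \<open>E \<in> sets M\<close> ind_int[OF A]] by simp
    ultimately have "AE \<omega> in M. indicator E \<omega> * indicator A (Y \<omega>) = (0 :: real)"
      by (subst integral_nonneg_eq_0_iff_AE[symmetric]) auto
    then show "AE \<omega> in M. Y \<omega> \<in> A \<longrightarrow> 0 < ?P A \<omega>"
      using AE_space by eventually_elim (auto simp: E_def indicator_def split: if_splits)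
  qed
  have markov: "AE \<omega> in M. \<forall>k\<in>T. \<forall>A\<in>N. \<forall>n::nat. (\<forall>y\<in>A. \<exists>x\<in>G. 1 / real (Suc n) \<le> h x y - h k y) \<longrightarrow>
    1 / real (Suc n) * ?P A \<omega> \<le> q (Z \<omega> - k)"
    unfolding AE_ball_countable[OF T(1)] AE_ball_countable[OF N(1)] AE_all_countable
  proof (intro ballI allI)
    fix k A and n :: nat assume k: "k \<in> T" and A: "A \<in> N"
    define r where "r = 1 / real (Suc n)"
    show "AE \<omega> in M. (\<forall>y\<in>A. \<exists>x\<in>G. 1 / real (Suc n) \<le> h x y - h k y) \<longrightarrow> 1 / real (Suc n) * ?P A \<omega> \<le> q (Z \<omega> - k)"
    proof (cases "\<forall>y\<in>A. \<exists>x\<in>G. r \<le> h x y - h k y")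
      case True
      have "AE \<omega> in M. real_cond_exp M FZ (\<lambda>\<omega>. r * indicator A (Y \<omega>)) \<omega> \<le> real_cond_exp M FZ (\<lambda>\<omega>. \<Psi> \<omega> - h k (Y \<omega>)) \<omega>"
      proof (rule FZ.real_cond_exp_mono)
        show "AE \<omega> in M. r * indicator A (Y \<omega>) \<le> \<Psi> \<omega> - h k (Y \<omega>)"
          using \<Psi>_ub
        proof eventually_elim
          case (elim \<omega>)
          show ?case
          proof (cases "Y \<omega> \<in> A")
            case True
            then obtain x where "x \<in> G" "r \<le> h x (Y \<omega>) - h k (Y \<omega>)" using \<open>\<forall>y\<in>A. \<exists>x\<in>G. r \<le> h x y - h k y\<close> by blast
            then show ?thesis using elim True by fastforce
          next
            case False
            then show ?thesis using elim k T(2) by auto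
          qed
        qed
      qed (intro integrable_mult_right ind_int A Bochner_Integration.integrable_diff \<Psi>_int h_int)+
      moreover have "AE \<omega> in M. real_cond_exp M FZ (\<lambda>\<omega>. r * indicator A (Y \<omega>)) \<omega> = r * ?P A \<omega>"
        by (intro FZ.real_cond_exp_cmult ind_int A)
      moreover have "AE \<omega> in M. real_cond_exp M FZ (\<lambda>\<omega>. \<Psi> \<omega> - h k (Y \<omega>)) \<omega> = W \<omega> - real_cond_exp M FZ (\<lambda>\<omega>. h k (Y \<omega>)) \<omega>"
        by (intro FZ.real_cond_exp_diff \<Psi>_int h_int)
      moreover note W_eq cond_exp_h[of k]
      ultimately show ?thesis unfolding r_def[symmetric] by eventually_elim (simp add: h_eq)
    next
      case False
      then show ?thesis unfolding r_def by (intro AE_I2) blast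
    qed
  qed
  show ?thesis using pos markov Z_in_G
  proof eventually_elim
    case (elim \<omega>)
    show ?case
    proof
      fix z assume z: "z \<in> PG S G (Z \<omega>)"
      then have zG: "z \<in> G" by (simp add: PG_approx approx_def)
      have "h (Z \<omega>) (Z \<omega>) \<le> h z (Z \<omega>)" using z elim(3) by (auto simp: PG_approx approx_def)
      then have qz: "q (Z \<omega> - z) \<le> 0" by (simp add: h_eq)
      show "z \<in> PG S G (Y \<omega>)"
      proof (rule ccontr)
        assume "z \<notin> PG S G (Y \<omega>)"
        then obtain x where x: "x \<in> G" "h z (Y \<omega>) < h x (Y \<omega>)" using zG by (auto simp: PG_approx approx_def not_le)
        then obtain n where n: "1 / real (Suc n) < h x (Y \<omega>) - h z (Y \<omega>)"
          using nat_approx_posE[of "h x (Y \<omega>) - h z (Y \<omega>)"] by auto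
        define r where "r = 1 / real (Suc n)"
        \<comment> \<open>Openness jointly in the point and the candidate gives one neighbourhood of
          \<open>Y \<omega>\<close> and one of \<open>z\<close> on which the same \<open>x\<close>
          beats the candidate by \<open>r\<close>.\<close>
        have "open {p. r < h x (fst p) - h (snd p) (fst p)}"
          by (intro open_Collect_less continuous_intros)
        moreover have "(Y \<omega>, z) \<in> {p. r < h x (fst p) - h (snd p) (fst p)}" using n by (simp add: r_def)
        ultimately obtain U V where UV': "open U" "open V" "(Y \<omega>, z) \<in> U \<times> V"
          "U \<times> V \<subseteq> {p. r < h x (fst p) - h (snd p) (fst p)}"
          by (rule open_prod_elim)
        then have UV: "open U" "open V" "Y \<omega> \<in> U" "z \<in> V"
          "U \<times> V \<subseteq> {p. r < h x (fst p) - h (snd p) (fst p)}" by auto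
        obtain A where A: "A \<in> N" "Y \<omega> \<in> A" "A \<subseteq> U"
          using topological_basisE[OF N(2) UV(1,3)] by blast
        have le: "r * ?P A \<omega> \<le> q (Z \<omega> - k)" if k: "k \<in> T \<inter> V" for k
        proof -
          have "\<forall>y\<in>A. \<exists>x\<in>G. r \<le> h x y - h k y"
          proof
            fix y assume "y \<in> A"
            then have "(y, k) \<in> U \<times> V" using A(3) k by auto
            then have "r < h x y - h k y" using UV(5) by auto
            then show "\<exists>x\<in>G. r \<le> h x y - h k y" using x(1) by (intro bexI[of _ x]) auto
          qed
          then show ?thesis using elim(2) k A(1) unfolding r_def by blast
        qed
        have "z \<in> closure (T \<inter> V)"
          using T(3) zG UV(2,4) open_Int_closure_subset[of V T] by (auto simp: Int_commute)
        moreover have "closed {k. r * ?P A \<omega> \<le> q (Z \<omega> - k)}" by (intro closed_Collect_le continuous_intros)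
        ultimately have "r * ?P A \<omega> \<le> q (Z \<omega> - z)"
          using closure_minimal[of "T \<inter> V" "{k. r * ?P A \<omega> \<le> q (Z \<omega> - k)}"] le by blast
        then have "r * ?P A \<omega> \<le> 0" using qz by simp
        moreover have "0 < r * ?P A \<omega>" using elim(1) A by (simp add: r_def)
        ultimately show False by simp
      qed
    qed
  qed
qed

text \<open>Both \<open>Z\<close> and \<open>z\<close> maximise at \<open>Y\<close>, so off
  \<open>Sigma1\<close> their difference is isotropic. As \<open>Z\<close> lies in G, the maximal
  value at \<open>Z\<close> is \<open>q Z\<close>, and \<open>z\<close> attains it.\<close>

lemma PG_Y_subset:
  assumes "AE \<omega> in M. Y \<omega> \<notin> Sigma1 S G"
  shows "AE \<omega> in M. PG S G (Y \<omega>) \<subseteq> PG S G (Z \<omega>)"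
  using assms Z_in_PG_Y
proof eventually_elim
  case (elim \<omega>)
  have ZG: "Z \<omega> \<in> G" using elim(2) PG_subset by blast
  show ?case
  proof
    fix z assume z: "z \<in> PG S G (Y \<omega>)"
    have "q (Z \<omega> - z) = 0" by (rule PG_isotropic[OF G elim(1,2) z])
    then show "z \<in> PG S G (Z \<omega>)"
      using z PG_subset max_S_monotone_mono[OF G ZG] by (auto simp: PG_approx approx_def h_eq)
  qed
qed

end

end

section \<open>Optimality of X and the structure of all optimal couplings\<close>

context dual_optimum begin

lemma X_meas_PG: "X \<in> borel_measurable sigma_PG_Y"
  unfolding X_def vcond_exp_def by (intro borel_measurable_vec_lambda borel_measurable_cond_exp)

lemma X_meas [measurable]: "X \<in> borel_measurable M"
  by (rule measurable_from_subalg[OF subalgebra_sigma_PG_Y X_meas_PG])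

lemma L2_X: "L2 M X"
  unfolding L2_def
proof (intro conjI X_meas)
  have comp: "integrable M (\<lambda>\<omega>. (X \<omega> $ i)\<^sup>2)" for i
    unfolding X_def vcond_exp_def vec_lambda_beta
  proof (rule PGY.integrable_convex_cond_exp[where I = UNIV])
    show "integrable M (\<lambda>\<omega>. (Y \<omega> $ i)\<^sup>2)"
    proof (rule Bochner_Integration.integrable_bound[OF Y_sq])
      have "(y $ i)\<^sup>2 \<le> (norm y)\<^sup>2" for y :: "real^'n"
        using power_mono[OF component_le_norm_cart abs_ge_zero, of y i 2] by simp
      then show "AE \<omega> in M. norm ((Y \<omega> $ i)\<^sup>2) \<le> norm ((norm (Y \<omega>))\<^sup>2)" by simp
    qed measurable
  qed (use L2_integrable[OF L2_Y] convex_power2 in \<open>auto simp: emeasure_space_1\<close>)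
  have "(norm (X \<omega>))\<^sup>2 = (\<Sum>i\<in>UNIV. (X \<omega> $ i)\<^sup>2)" for \<omega>
    unfolding power2_norm_eq_inner by (simp add: inner_vec_def power2_eq_square)
  then show "integrable M (\<lambda>\<omega>. (norm (X \<omega>))\<^sup>2)"
    using comp by (simp only:) (intro Bochner_Integration.integrable_sum)
qed

lemma sets_sigma_rv_X: "sets (sigma_rv M X) \<subseteq> sets sigma_PG_Y"
  unfolding sets_sigma_rv using measurable_sets[OF X_meas_PG] by auto

lemma mart_X: "mart M X Y"
proof -
  have "AE \<omega> in M. vcond_exp M (sigma_rv M X) Y \<omega> = X \<omega>"
  proof (rule vcond_exp_charact[OF subalgebra_sigma_rv[OF X_meas] L2_Y L2_X measurable_sigma_rv])
    fix A i assume "A \<in> sets (sigma_rv M X)"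
    then have "A \<in> sets sigma_PG_Y" using sets_sigma_rv_X by blast
    then show "(\<integral>\<omega>. indicator A \<omega> * Y \<omega> $ i \<partial>M) = (\<integral>\<omega>. indicator A \<omega> * X \<omega> $ i \<partial>M)"
      unfolding X_def by (rule vcond_exp_integral[OF subalgebra_sigma_PG_Y L2_Y])
  qed
  then show ?thesis by (simp add: mart_iff[OF L2_Y L2_X])
qed

sublocale X: martingale_coupling S M Y G \<Psi> X
  by unfold_locales (rule L2_X mart_X)+

text \<open>Being a selection of P(Y), \<open>X\<close> attains \<open>\<Psi>\<close> almost surely;
  the martingale property makes the expectation of \<open>q (X \<omega>)\<close> half of that of
  \<open>B (X \<omega>) (Y \<omega>)\<close>.\<close>

lemma X_attains: "D \<le> (\<integral>\<omega>. B (X \<omega>) (Y \<omega>) / 2 \<partial>M)"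
proof -
  have int: "integrable M (\<lambda>\<omega>. h (X \<omega>) (Y \<omega>))"
    unfolding h_def by (intro Bochner_Integration.integrable_diff X.B_int L2_X L2_Y X.qZ_int)
  have "D \<le> (\<integral>\<omega>. h (X \<omega>) (Y \<omega>) \<partial>M)"
  proof (rule integral_mono_AE[OF \<Psi>_int int])
    show "AE \<omega> in M. \<Psi> \<omega> \<le> h (X \<omega>) (Y \<omega>)"
      using \<Psi>_lub X_in_PG by eventually_elim (auto simp: PG_approx approx_def)
  qed
  also have "\<dots> = (\<integral>\<omega>. B (X \<omega>) (Y \<omega>) \<partial>M) - (\<integral>\<omega>. q (X \<omega>) \<partial>M)"
    unfolding h_def by (intro Bochner_Integration.integral_diff X.B_int L2_X L2_Y X.qZ_int)
  also have "\<dots> = (\<integral>\<omega>. B (X \<omega>) (Y \<omega>) / 2 \<partial>M)"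
    using X.value_eq by simp
  finally show ?thesis .
qed

lemma X_in_Xset: "X \<in> Xset M Y"
proof -
  have "sets sigma_PG_Y \<subseteq> sets (sigma_rv M Y)"
    unfolding sets_sigma_PG_Y sets_sigma_rv using sigma_PG_subset_borel[OF G_closed] by blast
  then have "subalgebra (sigma_rv M Y) sigma_PG_Y"
    by (auto simp: subalgebra_def sigma_rv_def)
  then have "X \<in> borel_measurable (sigma_rv M Y)"
    using X_meas_PG by (rule measurable_from_subalg)
  then show ?thesis
    using L2_X mart_X mart_iff[OF L2_Y L2_X] by (auto simp: Xset_def rv_measurable_wrt_def)
qed

theorem optimal_coupling:
  assumes Z: "L2 M Z" "mart M Z Y" and att: "D \<le> (\<integral>\<omega>. B (Z \<omega>) (Y \<omega>) / 2 \<partial>M)"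
  shows "AE \<omega> in M. Z \<omega> \<in> PG S G (Z \<omega>) \<and> PG S G (Z \<omega>) = PG S G (Y \<omega>)"
    "rv_measurable_wrt M X Z"
    "AE \<omega> in M. X \<omega> = vcond_exp M (sigma_rv M X) Z \<omega>"
    "AE \<omega> in M. B (Z \<omega> - X \<omega>) (Z \<omega> - X \<omega>) = 0"
proof -
  interpret Z: martingale_coupling S M Y G \<Psi> Z by unfold_locales (rule Z)+
  have eq: "AE \<omega> in M. PG S G (Z \<omega>) = PG S G (Y \<omega>)"
    using Z.PG_Z_subset[OF att] Z.PG_Y_subset[OF att Sigma1_null] by eventually_elim auto
  show "AE \<omega> in M. Z \<omega> \<in> PG S G (Z \<omega>) \<and> PG S G (Z \<omega>) = PG S G (Y \<omega>)"
    using Z.Z_in_PG_Z[OF att] eq by eventually_elim auto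
  show "AE \<omega> in M. B (Z \<omega> - X \<omega>) (Z \<omega> - X \<omega>) = 0"
    using Z.Z_in_PG_Y[OF att] X_in_PG Sigma1_null
  proof eventually_elim
    case (elim \<omega>)
    then show ?case using PG_isotropic[OF G elim(3,1,2)] by (simp add: q_def)
  qed
  \<comment> \<open>\<open>X\<close> is a sigma(P)-measurable function of \<open>Y\<close>. Such a
    function takes equal values at points with equal P, so evaluating it at \<open>Z\<close> gives
    the same result.\<close>
  have "\<exists>\<xi>\<in>borel_measurable (sigma_PG S G). \<forall>\<omega>\<in>space M. X \<omega> $ i = \<xi> (Y \<omega>)" for i
  proof -
    have "(\<lambda>\<omega>. X \<omega> $ i) \<in> borel_measurable (vimage_algebra (space M) Y (sigma_PG S G))"
      using X_meas_PG unfolding sigma_PG_Y_def by measurable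
    then show ?thesis by (rule vimage_algebra_factor) auto
  qed
  then obtain \<xi> where \<xi>: "\<And>i. \<xi> i \<in> borel_measurable (sigma_PG S G)" "\<And>i \<omega>. \<omega> \<in> space M \<Longrightarrow> X \<omega> $ i = \<xi> i (Y \<omega>)"
    by metis
  have "subalgebra borel (sigma_PG S G)"
    using sigma_PG_subset_borel[OF G_closed] by (auto simp: subalgebra_def)
  then have "\<xi> i \<in> borel_measurable borel" for i using \<xi>(1) by (rule measurable_from_subalg)
  then have "(\<lambda>\<omega>. \<chi> i. \<xi> i (Z \<omega>)) \<in> borel_measurable (sigma_rv M Z)"
    by (intro borel_measurable_vec_lambda measurable_sigma_rv_comp)
  moreover have "AE \<omega> in M. X \<omega> = (\<chi> i. \<xi> i (Z \<omega>))"
    using eq AE_space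
  proof eventually_elim
    case (elim \<omega>)
    then show ?case using \<xi>(2)[OF elim(2)] sigma_PG_measurable_saturated[OF \<xi>(1) elim(1)] by (simp add: vec_eq_iff)
  qed
  ultimately show "rv_measurable_wrt M X Z" unfolding rv_measurable_wrt_def by blast
  have "AE \<omega> in M. vcond_exp M (sigma_rv M X) Z \<omega> = X \<omega>"
  proof (rule vcond_exp_charact[OF subalgebra_sigma_rv[OF X_meas] Z(1) L2_X measurable_sigma_rv])
    fix A i assume "A \<in> sets (sigma_rv M X)"
    then have A: "A \<in> sets sigma_PG_Y" using sets_sigma_rv_X by blast
    then obtain A0 where A0: "A0 \<in> sets (sigma_PG S G)" "A = Y -` A0 \<inter> space M" by (auto simp: sets_sigma_PG_Y)
    have A0b [measurable]: "A0 \<in> sets borel" using A0(1) sigma_PG_subset_borel[OF G_closed] by blast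
    \<comment> \<open>An event of sigma(P(Y)) is thereby also an event of \<open>Z\<close>, on which
      the martingale property exchanges \<open>Z\<close> for \<open>Y\<close>.\<close>
    have sat: "AE \<omega> in M. Y \<omega> \<in> A0 \<longleftrightarrow> Z \<omega> \<in> A0"
      using eq by eventually_elim (rule sigma_PG_saturated[OF A0(1), symmetric])
    have [measurable]: "Z \<in> borel_measurable M" using Z(1) by (simp add: L2_def)
    have cong: "(\<integral>\<omega>. indicator A0 (Y \<omega>) * f \<omega> $ i \<partial>M) = (\<integral>\<omega>. indicator A0 (Z \<omega>) * f \<omega> $ i \<partial>M)"
      if [measurable]: "f \<in> borel_measurable M" for f :: "'a \<Rightarrow> real^'n"
    proof (rule integral_cong_AE)
      show "AE \<omega> in M. indicator A0 (Y \<omega>) * f \<omega> $ i = indicator A0 (Z \<omega>) * f \<omega> $ i"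
        using sat by eventually_elim (simp add: indicator_def)
    qed measurable
    have "(\<integral>\<omega>. indicator A \<omega> * Z \<omega> $ i \<partial>M) = (\<integral>\<omega>. indicator A0 (Y \<omega>) * Z \<omega> $ i \<partial>M)"
      by (intro Bochner_Integration.integral_cong) (auto simp: A0(2) indicator_def)
    also have "\<dots> = (\<integral>\<omega>. indicator A0 (Z \<omega>) * Z \<omega> $ i \<partial>M)"
      by (rule cong) measurable
    also have "\<dots> = (\<integral>\<omega>. indicator A0 (Z \<omega>) * Y \<omega> $ i \<partial>M)"
      using Z(2) A0b by (simp add: mart_def)
    also have "\<dots> = (\<integral>\<omega>. indicator A0 (Y \<omega>) * Y \<omega> $ i \<partial>M)"
      by (rule cong[symmetric]) measurable
    also have "\<dots> = (\<integral>\<omega>. indicator A \<omega> * Y \<omega> $ i \<partial>M)"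
      by (intro Bochner_Integration.integral_cong) (auto simp: A0(2) indicator_def)
    also have "\<dots> = (\<integral>\<omega>. indicator A \<omega> * X \<omega> $ i \<partial>M)"
      unfolding X_def by (rule vcond_exp_integral[OF subalgebra_sigma_PG_Y L2_Y A])
    finally show "(\<integral>\<omega>. indicator A \<omega> * Z \<omega> $ i \<partial>M) = (\<integral>\<omega>. indicator A \<omega> * X \<omega> $ i \<partial>M)" .
  qed
  then show "AE \<omega> in M. X \<omega> = vcond_exp M (sigma_rv M X) Z \<omega>" by eventually_elim simp
qed

end

subsection \<open>The dual problem over maximal monotone sets\<close>

text \<open>The probability space is free because this is applied both to \<open>M\<close> and to
  arbitrary plans; the hypotheses concern only the law of \<open>Y\<close>.\<close>

lemma (in S_space) potentialI:
  fixes N :: "'b measure"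
  assumes N: "prob_space N" and Y: "L2 N Y" and G: "G \<in> max_S_monotone S"
    and fin: "AE y in law N Y. psi S G y \<noteq> \<infinity>" and int: "integrable (law N Y) (\<lambda>y. real_of_ereal (psi S G y))"
  shows "potential S N Y G (\<lambda>\<omega>. real_of_ereal (psi S G (Y \<omega>)))"
    "(\<integral>\<omega>. real_of_ereal (psi S G (Y \<omega>)) \<partial>N) = (\<integral>y. real_of_ereal (psi S G y) \<partial>law N Y)"
proof -
  interpret N: prob_space N by (rule N)
  interpret transport S N Y by unfold_locales (rule Y)
  have ne: "G \<noteq> {}" by (rule max_S_monotone_nonempty[OF G])
  have fin': "AE \<omega> in N. psi S G (Y \<omega>) \<noteq> \<infinity>"
    using fin unfolding law_def by (rule AE_distrD[OF Y_meas])
  show "(\<integral>\<omega>. real_of_ereal (psi S G (Y \<omega>)) \<partial>N) = (\<integral>y. real_of_ereal (psi S G y) \<partial>law N Y)"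
    unfolding law_def by (rule integral_distr[symmetric]) measurable
  show "potential S N Y G (\<lambda>\<omega>. real_of_ereal (psi S G (Y \<omega>)))"
  proof unfold_locales
    show "G \<in> max_S_monotone S" by (rule G)
    show "integrable N (\<lambda>\<omega>. real_of_ereal (psi S G (Y \<omega>)))"
      using int unfolding law_def by (subst (asm) integrable_distr_eq) auto
    show "AE \<omega> in N. \<forall>x\<in>G. h x (Y \<omega>) \<le> real_of_ereal (psi S G (Y \<omega>))"
      using fin'
    proof eventually_elim
      case (elim \<omega>)
      show ?case
      proof
        fix x assume "x \<in> G"
        then have "ereal (h x (Y \<omega>)) \<le> psi S G (Y \<omega>)" by (rule psi_ge)
        then show "h x (Y \<omega>) \<le> real_of_ereal (psi S G (Y \<omega>))" using psi_real[OF elim ne] by (metis ereal_less_eq(3))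
      qed
    qed
    show "AE \<omega> in N. \<forall>t. (\<forall>x\<in>G. h x (Y \<omega>) \<le> t) \<longrightarrow> real_of_ereal (psi S G (Y \<omega>)) \<le> t"
      using fin'
    proof eventually_elim
      case (elim \<omega>)
      show ?case
      proof (intro allI impI)
        fix t assume "\<forall>x\<in>G. h x (Y \<omega>) \<le> t"
        then have "psi S G (Y \<omega>) \<le> ereal t" unfolding psi_eq by (intro SUP_least) auto
        then show "real_of_ereal (psi S G (Y \<omega>)) \<le> t" using psi_real[OF elim ne] by (metis ereal_less_eq(3))
      qed
    qed
  qed
qed

context transport begin

text \<open>On the maximal set below \<open>\<phi>\<close> the potential lies between one tangent
  and \<open>\<phi>\<close>, both integrable at \<open>Y\<close>, so the objective takes its finite
  branch.\<close>

lemma dual_obj_le: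
  assumes \<phi>: "convex_on UNIV \<phi>" "\<And>x. q x \<le> \<phi> x" and int: "integrable M (\<lambda>\<omega>. \<phi> (Y \<omega>))"
  obtains H where "H \<in> max_S_monotone S" "dual_obj S (law M Y) H \<le> ereal (\<integral>\<omega>. \<phi> (Y \<omega>) \<partial>M)"
proof -
  obtain H where H: "H \<in> max_S_monotone S" "\<And>y. psi S H y \<le> ereal (\<phi> y)"
    using maximal_monotone_below[OF \<phi>] by blast
  have ne: "H \<noteq> {}" by (rule max_S_monotone_nonempty[OF H(1)])
  then obtain z where z: "z \<in> H" by blast
  let ?p = "\<lambda>y. real_of_ereal (psi S H y)"
  have fin: "psi S H y \<noteq> \<infinity>" for y using H(2)[of y] by auto
  have p: "h z y \<le> ?p y" "?p y \<le> \<phi> y" for y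
    using psi_ge[OF z, of y] H(2)[of y] psi_real[OF fin ne, of y] by (metis ereal_less_eq(3))+
  have pi: "integrable M (\<lambda>\<omega>. ?p (Y \<omega>))"
  proof (rule Bochner_Integration.integrable_bound)
    show "integrable M (\<lambda>\<omega>. \<bar>h z (Y \<omega>)\<bar> + \<bar>\<phi> (Y \<omega>)\<bar>)" using h_int int by auto
    have "\<bar>?p y\<bar> \<le> \<bar>h z y\<bar> + \<bar>\<phi> y\<bar>" for y using p[of y] by linarith
    then show "AE \<omega> in M. norm (?p (Y \<omega>)) \<le> norm (\<bar>h z (Y \<omega>)\<bar> + \<bar>\<phi> (Y \<omega>)\<bar>)" by simp
  qed measurable
  have "integrable (law M Y) ?p" unfolding law_def using pi by (subst integrable_distr_eq) auto
  then have "dual_obj S (law M Y) H = ereal (\<integral>y. ?p y \<partial>law M Y)"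
    using fin by (simp add: dual_obj_def)
  also have "(\<integral>y. ?p y \<partial>law M Y) = (\<integral>\<omega>. ?p (Y \<omega>) \<partial>M)"
    unfolding law_def by (rule integral_distr) measurable
  also have "ereal \<dots> \<le> ereal (\<integral>\<omega>. \<phi> (Y \<omega>) \<partial>M)"
    using p(2) pi int by (auto intro!: Bochner_Integration.integral_mono)
  finally show thesis by (rule that[OF H(1)])
qed

lemma optimal_dual_imp:
  assumes opt: "optimal_dual S (law M Y) G" and null: "Sigma1 S G \<in> null_sets (law M Y)"
  shows "dual_optimum S M Y G (\<lambda>\<omega>. real_of_ereal (psi S G (Y \<omega>)))"
    "AE y in law M Y. psi S G y \<noteq> \<infinity>" "integrable (law M Y) (\<lambda>y. real_of_ereal (psi S G y))"
proof -
  have G: "G \<in> max_S_monotone S" and min: "\<And>H. H \<in> max_S_monotone S \<Longrightarrow> dual_obj S (law M Y) G \<le> dual_obj S (law M Y) H"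
    using opt by (auto simp: optimal_dual_def)
  have le: "dual_obj S (law M Y) G \<le> ereal (\<integral>\<omega>. \<phi> (Y \<omega>) \<partial>M)"
    if \<phi>: "convex_on UNIV \<phi>" "\<And>x. q x \<le> \<phi> x" "integrable M (\<lambda>\<omega>. \<phi> (Y \<omega>))" for \<phi>
  proof -
    obtain H where "H \<in> max_S_monotone S" "dual_obj S (law M Y) H \<le> ereal (\<integral>\<omega>. \<phi> (Y \<omega>) \<partial>M)"
      by (rule dual_obj_le[OF \<phi>])
    then show ?thesis using min by (meson order_trans)
  qed
  \<comment> \<open>The multiple of the squared norm that bounds \<open>q\<close> is a convex
    majorant with finite expectation; it makes the optimal dual value finite.\<close>
  have "dual_obj S (law M Y) G \<le> ereal (\<integral>\<omega>. C / 2 * (norm (Y \<omega>))\<^sup>2 \<partial>M)"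
  proof (rule le)
    show "convex_on UNIV (\<lambda>x :: real^'n. C / 2 * (norm x)\<^sup>2)"
      using C_pos by (intro convex_on_cmul convex_on_norm_sq) simp
    show "q x \<le> C / 2 * (norm x)\<^sup>2" for x using q_bound[of x] by linarith
  qed (use Y_sq in simp)
  then have fin: "dual_obj S (law M Y) G \<noteq> \<infinity>" by auto
  then show ae: "AE y in law M Y. psi S G y \<noteq> \<infinity>" and int: "integrable (law M Y) (\<lambda>y. real_of_ereal (psi S G y))"
    unfolding dual_obj_def by (auto split: if_splits)
  have val: "dual_obj S (law M Y) G = ereal (\<integral>y. real_of_ereal (psi S G y) \<partial>law M Y)"
    using ae int by (simp add: dual_obj_def)
  note pot = potentialI[OF prob_space_axioms L2_Y G ae int]
  interpret potential S M Y G "\<lambda>\<omega>. real_of_ereal (psi S G (Y \<omega>))" by (rule pot(1))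
  show "dual_optimum S M Y G (\<lambda>\<omega>. real_of_ereal (psi S G (Y \<omega>)))"
  proof unfold_locales
    show "dual_bound D" unfolding dual_bound_def pot(2) using le val by auto
    have "AE y in law M Y. y \<notin> Sigma1 S G" using null by (rule AE_not_in)
    then show "AE \<omega> in M. Y \<omega> \<notin> Sigma1 S G" unfolding law_def by (rule AE_distrD[OF Y_meas])
  qed
qed

end

subsection \<open>Laws of couplings\<close>

lemma mart_law:
  fixes Z Y :: "'a \<Rightarrow> real^'n"
  assumes [measurable]: "Z \<in> borel_measurable M" "Y \<in> borel_measurable M"
  shows "mart (law M (\<lambda>\<omega>. (Z \<omega>, Y \<omega>))) fst snd \<longleftrightarrow> mart M Z Y"
proof -
  have "(\<integral>p. indicator A (fst p) * snd p $ i \<partial>law M (\<lambda>\<omega>. (Z \<omega>, Y \<omega>))) = (\<integral>\<omega>. indicator A (Z \<omega>) * Y \<omega> $ i \<partial>M)"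
    "(\<integral>p. indicator A (fst p) * fst p $ i \<partial>law M (\<lambda>\<omega>. (Z \<omega>, Y \<omega>))) = (\<integral>\<omega>. indicator A (Z \<omega>) * Z \<omega> $ i \<partial>M)"
    if [measurable]: "A \<in> sets borel" for A i
  proof -
    have [measurable]: "fst \<in> borel_measurable (borel :: ((real^'n) \<times> (real^'n)) measure)"
      "snd \<in> borel_measurable (borel :: ((real^'n) \<times> (real^'n)) measure)"
      by (auto intro!: borel_measurable_continuous_onI continuous_intros)
    show "(\<integral>p. indicator A (fst p) * snd p $ i \<partial>law M (\<lambda>\<omega>. (Z \<omega>, Y \<omega>))) = (\<integral>\<omega>. indicator A (Z \<omega>) * Y \<omega> $ i \<partial>M)"
      "(\<integral>p. indicator A (fst p) * fst p $ i \<partial>law M (\<lambda>\<omega>. (Z \<omega>, Y \<omega>))) = (\<integral>\<omega>. indicator A (Z \<omega>) * Z \<omega> $ i \<partial>M)"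
      unfolding law_def by (subst integral_distr; simp)+
  qed
  then show ?thesis unfolding mart_def by auto
qed

lemma Gamma_iff:
  fixes \<gamma> :: "((real^'n) \<times> (real^'n)) measure"
  shows "\<gamma> \<in> Gamma \<nu> \<longleftrightarrow> sets \<gamma> = sets borel \<and> prob_space \<gamma> \<and> L2 \<gamma> fst \<and> L2 \<gamma> snd \<and>
    law \<gamma> snd = \<nu> \<and> mart \<gamma> fst snd"
proof -
  have meas: "sets \<gamma> = sets borel \<Longrightarrow> fst \<in> borel_measurable \<gamma> \<and> snd \<in> borel_measurable \<gamma>"
    unfolding measurable_cong_sets[OF _ refl, of \<gamma> borel]
    by (auto intro!: borel_measurable_continuous_onI continuous_intros)
  show ?thesis
  proof
    assume g: "\<gamma> \<in> Gamma \<nu>"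
    then have L: "L2 \<gamma> fst" "L2 \<gamma> snd" using meas by (auto simp: Gamma_def L2_def)
    interpret prob_space \<gamma> using g by (simp add: Gamma_def)
    show "sets \<gamma> = sets borel \<and> prob_space \<gamma> \<and> L2 \<gamma> fst \<and> L2 \<gamma> snd \<and> law \<gamma> snd = \<nu> \<and> mart \<gamma> fst snd"
      using g L mart_iff[OF L(2,1)] by (auto simp: Gamma_def law_def)
  next
    assume a: "sets \<gamma> = sets borel \<and> prob_space \<gamma> \<and> L2 \<gamma> fst \<and> L2 \<gamma> snd \<and> law \<gamma> snd = \<nu> \<and> mart \<gamma> fst snd"
    interpret prob_space \<gamma> using a by simp
    show "\<gamma> \<in> Gamma \<nu>" using a mart_iff[of snd fst] by (auto simp: Gamma_def law_def L2_def)
  qed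
qed

lemma (in prob_space) law_pair_Gamma:
  fixes Z Y :: "'a \<Rightarrow> real^'n"
  assumes Z: "L2 M Z" and Y: "L2 M Y"
  shows "law M (\<lambda>\<omega>. (Z \<omega>, Y \<omega>)) \<in> Gamma (law M Y) \<longleftrightarrow> mart M Z Y"
proof -
  have [measurable]: "Z \<in> borel_measurable M" "Y \<in> borel_measurable M" using Z Y by (auto simp: L2_def)
  have fs [measurable]: "fst \<in> borel_measurable (borel :: ((real^'n) \<times> (real^'n)) measure)"
    "snd \<in> borel_measurable (borel :: ((real^'n) \<times> (real^'n)) measure)"
    by (auto intro!: borel_measurable_continuous_onI continuous_intros)
  let ?\<gamma> = "law M (\<lambda>\<omega>. (Z \<omega>, Y \<omega>))"
  have "prob_space ?\<gamma>" unfolding law_def by (rule prob_space_distr) measurable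
  moreover have "L2 ?\<gamma> fst" "L2 ?\<gamma> snd"
    using Z Y unfolding law_def L2_def by (auto simp: integrable_distr_eq)
  moreover have "law ?\<gamma> snd = law M Y"
    unfolding law_def by (subst distr_distr) (auto simp: comp_def)
  moreover have "sets ?\<gamma> = sets borel" by (simp add: law_def)
  ultimately show ?thesis using mart_law[of Z M Y] by (auto simp: Gamma_iff)
qed

theorem theorem3:
  fixes M :: "'a measure" and S :: "real^'n^'n" and m :: nat
    and Y :: "'a \<Rightarrow> real^'n" and G :: "(real^'n) set"
  assumes "prob_space M"
    and "S \<in> Sdm m"
    and "L2 M Y"
    and "optimal_dual S (law M Y) G"
    and "Sigma1 S G \<in> null_sets (law M Y)"
  defines "X \<equiv> vcond_exp M (vimage_algebra (space M) Y (sigma_PG S G)) Y"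
  shows "optimal_map M S Y X
    \<and> optimal_plan S (law M Y) (law M (\<lambda>\<omega>. (X \<omega>, Y \<omega>)))
    \<and> (\<forall>Z. L2 M Z \<longrightarrow>
           (optimal_plan S (law M Y) (law M (\<lambda>\<omega>. (Z \<omega>, Y \<omega>))) \<or> optimal_map M S Y Z) \<longrightarrow>
           (AE \<omega> in M. Z \<omega> \<in> PG S G (Z \<omega>) \<and> PG S G (Z \<omega>) = PG S G (Y \<omega>))
           \<and> rv_measurable_wrt M X Z
           \<and> (AE \<omega> in M. X \<omega> = vcond_exp M (sigma_rv M X) Z \<omega>)
           \<and> (AE \<omega> in M. Sform S (Z \<omega> - X \<omega>) (Z \<omega> - X \<omega>) = 0))"
proof -
  interpret M: prob_space M by fact
  interpret S_space S using \<open>S \<in> Sdm m\<close> by unfold_locales (auto simp: Sdm_def)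
  interpret T: transport S M Y by unfold_locales fact
  let ?psi = "\<lambda>y. real_of_ereal (psi S G y)"
  note od = T.optimal_dual_imp[OF assms(4,5)]
  interpret P: dual_optimum S M Y G "\<lambda>\<omega>. ?psi (Y \<omega>)" by (rule od(1))
  have X: "X = P.X" by (simp add: X_def P.X_def P.sigma_PG_Y_def)
  have [measurable]: "Y \<in> borel_measurable M" by (rule T.Y_meas)
  have mapsto: "(\<integral>p. B (fst p) (snd p) / 2 \<partial>law M (\<lambda>\<omega>. (Z \<omega>, Y \<omega>))) = (\<integral>\<omega>. B (Z \<omega>) (Y \<omega>) / 2 \<partial>M)"
    if "L2 M Z" for Z
  proof -
    have [measurable]: "Z \<in> borel_measurable M" using that by (simp add: L2_def)
    have "(\<lambda>p. B (fst p) (snd p) / 2) \<in> borel_measurable borel"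
      by (intro borel_measurable_continuous_onI continuous_intros) auto
    then show ?thesis unfolding law_def by (subst integral_distr) auto
  qed
  have map_le: "(\<integral>\<omega>. B (Z \<omega>) (Y \<omega>) / 2 \<partial>M) \<le> P.D" if "L2 M Z" "mart M Z Y" for Z
  proof -
    interpret Z: martingale_coupling S M Y G "\<lambda>\<omega>. ?psi (Y \<omega>)" Z by unfold_locales (rule that)+
    show ?thesis by (rule Z.weak_duality)
  qed
  have plan_le: "(\<integral>p. B (fst p) (snd p) / 2 \<partial>\<gamma>) \<le> P.D" if "\<gamma> \<in> Gamma (law M Y)" for \<gamma>
  proof -
    have g: "prob_space \<gamma>" "L2 \<gamma> fst" "L2 \<gamma> snd" "law \<gamma> snd = law M Y" "mart \<gamma> fst snd"
      using that by (auto simp: Gamma_iff)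
    note pot = potentialI[OF g(1,3) P.G, unfolded g(4), OF od(2,3)]
    interpret Q: potential S \<gamma> snd G "\<lambda>p. ?psi (snd p)" by (rule pot(1))
    interpret Q: martingale_coupling S \<gamma> snd G "\<lambda>p. ?psi (snd p)" fst by unfold_locales (rule g)+
    \<comment> \<open>Both are the integral of \<open>psi\<close> against the law of
      \<open>Y\<close>, which every plan has as second marginal.\<close>
    have "Q.D = P.D"
      using pot(2) potentialI(2)[OF assms(1,3) P.G od(2,3)] by simp
    then show ?thesis using Q.weak_duality by simp
  qed
  have map_X: "optimal_map M S Y X"
    unfolding optimal_map_def X
  proof (intro conjI ballI P.X_in_Xset)
    fix X' assume "X' \<in> Xset M Y"
    then have "L2 M X'" "mart M X' Y" using M.mart_iff[OF assms(3)] by (auto simp: Xset_def)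
    then show "(\<integral>\<omega>. B (X' \<omega>) (Y \<omega>) / 2 \<partial>M) \<le> (\<integral>\<omega>. B (P.X \<omega>) (Y \<omega>) / 2 \<partial>M)"
      using map_le P.X_attains by (meson order_trans)
  qed
  have law_X: "law M (\<lambda>\<omega>. (X \<omega>, Y \<omega>)) \<in> Gamma (law M Y)"
    using M.law_pair_Gamma[OF P.L2_X assms(3)] P.mart_X by (simp add: X)
  have val_X: "P.D \<le> (\<integral>p. B (fst p) (snd p) / 2 \<partial>law M (\<lambda>\<omega>. (X \<omega>, Y \<omega>)))"
    unfolding X mapsto[OF P.L2_X] by (rule P.X_attains)
  have plan_X: "optimal_plan S (law M Y) (law M (\<lambda>\<omega>. (X \<omega>, Y \<omega>)))"
    unfolding optimal_plan_def using law_X plan_le val_X by (meson order_trans)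
  \<comment> \<open>An optimal plan is compared with the law of (X, Y), an optimal map with
    \<open>X\<close> itself; either comparison yields the dual value.\<close>
  have coupling: "mart M Z Y \<and> P.D \<le> (\<integral>\<omega>. B (Z \<omega>) (Y \<omega>) / 2 \<partial>M)"
    if Z: "L2 M Z" and opt: "optimal_plan S (law M Y) (law M (\<lambda>\<omega>. (Z \<omega>, Y \<omega>))) \<or> optimal_map M S Y Z" for Z
    using opt
  proof
    assume o: "optimal_plan S (law M Y) (law M (\<lambda>\<omega>. (Z \<omega>, Y \<omega>)))"
    then have "(\<integral>p. B (fst p) (snd p) / 2 \<partial>law M (\<lambda>\<omega>. (X \<omega>, Y \<omega>))) \<le> (\<integral>p. B (fst p) (snd p) / 2 \<partial>law M (\<lambda>\<omega>. (Z \<omega>, Y \<omega>)))"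
      using law_X unfolding optimal_plan_def by blast
    moreover have "mart M Z Y" using o M.law_pair_Gamma[OF Z assms(3)] by (simp add: optimal_plan_def)
    ultimately show ?thesis using order_trans[OF val_X] unfolding mapsto[OF Z] by blast
  next
    assume o: "optimal_map M S Y Z"
    then have "(\<integral>\<omega>. B (P.X \<omega>) (Y \<omega>) / 2 \<partial>M) \<le> (\<integral>\<omega>. B (Z \<omega>) (Y \<omega>) / 2 \<partial>M)"
      using P.X_in_Xset unfolding optimal_map_def by blast
    moreover have "mart M Z Y" using o M.mart_iff[OF assms(3) Z] by (simp add: optimal_map_def Xset_def)
    ultimately show ?thesis using order_trans[OF P.X_attains] by blast
  qed
  show ?thesis
  proof (intro conjI allI impI map_X plan_X)
    fix Z assume Z: "L2 M Z"
      and "optimal_plan S (law M Y) (law M (\<lambda>\<omega>. (Z \<omega>, Y \<omega>))) \<or> optimal_map M S Y Z"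
    then have c: "mart M Z Y" "P.D \<le> (\<integral>\<omega>. B (Z \<omega>) (Y \<omega>) / 2 \<partial>M)" using coupling by blast+
    note oc = P.optimal_coupling[OF Z c, folded X]
    show "AE \<omega> in M. Z \<omega> \<in> PG S G (Z \<omega>) \<and> PG S G (Z \<omega>) = PG S G (Y \<omega>)" by (rule oc(1))
    show "rv_measurable_wrt M X Z" by (rule oc(2))
    show "AE \<omega> in M. X \<omega> = vcond_exp M (sigma_rv M X) Z \<omega>" by (rule oc(3))
    show "AE \<omega> in M. B (Z \<omega> - X \<omega>) (Z \<omega> - X \<omega>) = 0" by (rule oc(4))
  qed
qed

end
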